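(* For every fixed choice of a real number $\epsilon>0$ and an integer $r\ge 2$, there exists an algorithm $\mathcal{A}(\epsilon,r)$ that finds, in time polynomial in the size of the input, a perfect matching in any given $r$-uniform bipartite hypergraph $H=(A,B,E)$ satisfying \[\tau(E_S) > (2r-3+\epsilon)(|S|-1)\quad \text{for all } S\subseteq A.\]
   Context: An $r$-uniform bipartite hypergraph $H=(A,B,E)$ is a (finite) hypergraph whose vertex set is partitioned into two sets $A$ and $B$ such that every edge $e\in E$ satisfies $|e\cap A|=1$ and $|e\cap B|=r-1$. The bipartition $(A,B)$ is given to the algorithm as part of the input. A perfect matching in $H$ is a collection of pairwise disjoint edges such that every vertex of $A$ is contained in exactly one edge of the collection (vertices of $B$ need not be covered). For $S\subseteq A$, $E_S:=\{e\in E : |e\cap S|=1\}$ is the set of edges incident to $S$. For $F\subseteq E$, $\tau(F)$ is the smallest cardinality of a subset of $B$ that hits all edges of $F$, where $R\subseteq B$ hits $F$ if $R\cap e\ne\emptyset$ for every $e\in F$. The running time is polynomial for each fixed pair $(\epsilon,r)$; the polynomial may depend on $\epsilon$ and $r$. *)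

theory Defs
  imports Complex_Main "HOL-Computational_Algebra.Polynomial"
begin

section \<open>Bipartite hypergraphs\<close>

definition uniform_bipartite_hypergraph ::
    "nat \<Rightarrow> 'v set \<Rightarrow> 'v set \<Rightarrow> 'v set set \<Rightarrow> bool" where
  "uniform_bipartite_hypergraph r A B E \<longleftrightarrow>
     finite A \<and> finite B \<and> A \<inter> B = {} \<and>
     (\<forall>e\<in>E. e \<subseteq> A \<union> B \<and> card (e \<inter> A) = 1 \<and> card (e \<inter> B) = r - 1)"

definition perfect_matching :: "'v set \<Rightarrow> 'v set set \<Rightarrow> 'v set set \<Rightarrow> bool" where
  "perfect_matching A E M \<longleftrightarrow>
     M \<subseteq> E \<and> pairwise disjnt M \<and> (\<forall>a\<in>A. \<exists>!e. e \<in> M \<and> a \<in> e)"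

definition incident_edges :: "'v set set \<Rightarrow> 'v set \<Rightarrow> 'v set set" where
  "incident_edges E S = {e\<in>E. card (e \<inter> S) = 1}"

definition hits :: "'v set \<Rightarrow> 'v set set \<Rightarrow> bool" where
  "hits R F \<longleftrightarrow> (\<forall>e\<in>F. R \<inter> e \<noteq> {})"

text \<open>If \<open>r \<ge> 2\<close>, the finite set \<open>B\<close> itself hits every set of edges, so the minimum below is
  over a nonempty set of numbers.\<close>

definition hitting_number :: "'v set \<Rightarrow> 'v set set \<Rightarrow> nat" where
  "hitting_number B F = (LEAST n. \<exists>R\<subseteq>B. hits R F \<and> card R = n)"


section \<open>Model of computation\<close>

text \<open>Algorithms are programs of the WHILE language on binary trees of N. D. Jones
  (Computability and Complexity from a Programming Perspective, 1997). Its polynomial-time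
  computations are those of Turing machines. Jones charges one unit per elementary operation.
  Here an operation is charged the full size of the tree it produces, so that no program can
  build a tree larger than its running time (for instance by repeatedly assigning \<open>Cons_Expr (Var x) (Var x)\<close> to \<open>x\<close>), and a
  Turing machine that stores all trees explicitly simulates a run with polynomial overhead.\<close>

datatype tree = Leaf | Node tree tree

fun tree_size :: "tree \<Rightarrow> nat" where
  "tree_size Leaf = 1"
| "tree_size (Node l r) = 1 + tree_size l + tree_size r"

datatype expr = Var nat | Const_Leaf | Cons_Expr expr expr | Hd expr | Tl expr

fun left_part :: "tree \<Rightarrow> tree" where
  "left_part Leaf = Leaf"
| "left_part (Node l r) = l"

fun right_part :: "tree \<Rightarrow> tree" where
  "right_part Leaf = Leaf"
| "right_part (Node l r) = r"

type_synonym store = "nat \<Rightarrow> tree"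

fun eval_expr :: "expr \<Rightarrow> store \<Rightarrow> tree" where
  "eval_expr (Var x) s = s x"
| "eval_expr Const_Leaf s = Leaf"
| "eval_expr (Cons_Expr a b) s = Node (eval_expr a s) (eval_expr b s)"
| "eval_expr (Hd a) s = left_part (eval_expr a s)"
| "eval_expr (Tl a) s = right_part (eval_expr a s)"

fun expr_cost :: "expr \<Rightarrow> store \<Rightarrow> nat" where
  "expr_cost (Var x) s = tree_size (s x)"
| "expr_cost Const_Leaf s = 1"
| "expr_cost (Cons_Expr a b) s =
     expr_cost a s + expr_cost b s + tree_size (eval_expr (Cons_Expr a b) s)"
| "expr_cost (Hd a) s = expr_cost a s + tree_size (eval_expr (Hd a) s)"
| "expr_cost (Tl a) s = expr_cost a s + tree_size (eval_expr (Tl a) s)"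

datatype program =
    Skip
  | Assign nat expr
  | Seq program program
  | Cond expr program program
  | While expr program

text \<open>\<open>exec P s t s'\<close>: started in store \<open>s\<close>, the program \<open>P\<close> halts after time exactly \<open>t\<close>
  in store \<open>s'\<close>. A test succeeds iff its value is not \<open>Leaf\<close>.\<close>

inductive exec :: "program \<Rightarrow> store \<Rightarrow> nat \<Rightarrow> store \<Rightarrow> bool" where
  Skip: "exec Skip s 1 s"
| Assign: "exec (Assign x a) s (1 + expr_cost a s) (s(x := eval_expr a s))"
| Seq: "\<lbrakk>exec P s t s'; exec Q s' u s''\<rbrakk> \<Longrightarrow> exec (Seq P Q) s (1 + t + u) s''"
| Cond_True: "\<lbrakk>eval_expr a s \<noteq> Leaf; exec P s t s'\<rbrakk>
    \<Longrightarrow> exec (Cond a P Q) s (1 + expr_cost a s + t) s'"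
| Cond_False: "\<lbrakk>eval_expr a s = Leaf; exec Q s t s'\<rbrakk>
    \<Longrightarrow> exec (Cond a P Q) s (1 + expr_cost a s + t) s'"
| While_False: "eval_expr a s = Leaf \<Longrightarrow> exec (While a P) s (1 + expr_cost a s) s"
| While_True: "\<lbrakk>eval_expr a s \<noteq> Leaf; exec P s t s'; exec (While a P) s' u s''\<rbrakk>
    \<Longrightarrow> exec (While a P) s (1 + expr_cost a s + t + u) s''"

inductive_cases exec_SkipE: "exec Skip s t s'"
inductive_cases exec_AssignE: "exec (Assign x a) s t s'"
inductive_cases exec_SeqE: "exec (Seq P Q) s t s'"
inductive_cases exec_CondE: "exec (Cond a P Q) s t s'"
inductive_cases exec_WhileE: "exec (While a P) s t s'"

lemma exec_deterministic:
  "exec P s t s' \<Longrightarrow> exec P s u s'' \<Longrightarrow> u = t \<and> s'' = s'"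
proof (induction arbitrary: u s'' rule: exec.induct)
  case Skip
  then show ?case by (auto elim: exec_SkipE)
next
  case Assign
  then show ?case by (auto elim: exec_AssignE)
next
  case (Seq P s t s1 Q t' s2)
  from Seq.prems obtain v w r where "exec P s v r" "exec Q r w s''" "u = 1 + v + w"
    by (rule exec_SeqE) simp
  with Seq.IH(1)[of v r] Seq.IH(2)[of w s''] show ?case by simp
next
  case (Cond_True a s P t s' Q)
  from Cond_True.prems Cond_True.hyps(1)
  obtain v where "exec P s v s''" "u = 1 + expr_cost a s + v"
    by (cases rule: exec_CondE) auto
  with Cond_True.IH[of v s''] show ?case by simp
next
  case (Cond_False a s Q t s' P)
  from Cond_False.prems Cond_False.hyps(1)
  obtain v where "exec Q s v s''" "u = 1 + expr_cost a s + v"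
    by (cases rule: exec_CondE) auto
  with Cond_False.IH[of v s''] show ?case by simp
next
  case (While_False a s P)
  from While_False.prems While_False.hyps show ?case
    by (cases rule: exec_WhileE) auto
next
  case (While_True a s P t s1 t' s2)
  from While_True.prems While_True.hyps(1)
  obtain v w r where "exec P s v r" "exec (While a P) r w s''"
      "u = 1 + expr_cost a s + v + w"
    by (cases rule: exec_WhileE) auto
  with While_True.IH(1)[of v r] While_True.IH(2)[of w s''] show ?case by simp
qed

text \<open>Variable 0 holds the input at the start and the output at the end.\<close>

definition initial_store :: "tree \<Rightarrow> store" where
  "initial_store x = (\<lambda>_. Leaf)(0 := x)"

definition runs_in_time :: "program \<Rightarrow> tree \<Rightarrow> nat \<Rightarrow> tree \<Rightarrow> bool" where
  "runs_in_time P x n y \<longleftrightarrow> (\<exists>t s. exec P (initial_store x) t s \<and> t \<le> n \<and> s 0 = y)"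


section \<open>Encoding of hypergraphs\<close>

text \<open>Vertex names are natural numbers, in binary with the least significant bit first; the
  digit 0 is \<open>Leaf\<close> and the digit 1 is \<open>Node Leaf Leaf\<close>.\<close>

fun encode_nat :: "nat \<Rightarrow> tree" where
  "encode_nat n = (if n = 0 then Leaf
     else Node (if odd n then Node Leaf Leaf else Leaf) (encode_nat (n div 2)))"

declare encode_nat.simps [simp del]

fun encode_list :: "('a \<Rightarrow> tree) \<Rightarrow> 'a list \<Rightarrow> tree" where
  "encode_list f [] = Leaf"
| "encode_list f (x # xs) = Node (f x) (encode_list f xs)"

text \<open>Sets are given by repetition-free lists of their elements, in arbitrary order.\<close>

definition encodes_vertices :: "tree \<Rightarrow> nat set \<Rightarrow> bool" where
  "encodes_vertices x X \<longleftrightarrow>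
     (\<exists>vs. x = encode_list encode_nat vs \<and> distinct vs \<and> set vs = X)"

definition encodes_edges :: "tree \<Rightarrow> nat set set \<Rightarrow> bool" where
  "encodes_edges x E \<longleftrightarrow>
     (\<exists>es. x = encode_list (encode_list encode_nat) es \<and> (\<forall>e\<in>set es. distinct e) \<and>
           distinct (map set es) \<and> set (map set es) = E)"

definition encodes_hypergraph :: "tree \<Rightarrow> nat set \<Rightarrow> nat set \<Rightarrow> nat set set \<Rightarrow> bool" where
  "encodes_hypergraph x A B E \<longleftrightarrow>
     (\<exists>a b c. x = Node a (Node b c) \<and> encodes_vertices a A \<and> encodes_vertices b B \<and>
              encodes_edges c E)"

lemma encode_nat_0: "encode_nat 0 = Leaf"
  by (simp add: encode_nat.simps[of 0])

lemma encode_nat_pos: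
  "n > 0 \<Longrightarrow> encode_nat n = Node (if odd n then Node Leaf Leaf else Leaf) (encode_nat (n div 2))"
  by (simp add: encode_nat.simps[of n])

lemma encode_nat_inject: "encode_nat m = encode_nat n \<longleftrightarrow> m = n"
proof (induction m arbitrary: n rule: less_induct)
  case (less m)
  consider "m = 0" "n = 0" | "m = 0" "n > 0" | "m > 0" "n = 0" | "m > 0" "n > 0" by blast
  then show ?case
  proof cases
    case 4
    have "encode_nat m = encode_nat n \<longleftrightarrow> odd m = odd n \<and> m div 2 = n div 2"
      using less.IH[of "m div 2" "n div 2"] 4
      by (simp add: encode_nat_pos[of m] encode_nat_pos[of n])
    also have "\<dots> \<longleftrightarrow> m = n" by presburger
    finally show ?thesis .
  qed (simp_all add: encode_nat_0 encode_nat_pos)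
qed

lemma encode_list_inject:
  assumes "inj f"
  shows "encode_list f xs = encode_list f ys \<longleftrightarrow> xs = ys"
proof (induction xs arbitrary: ys)
  case Nil then show ?case by (cases ys) auto
next
  case (Cons x xs) then show ?case using assms by (cases ys) (auto dest: injD)
qed

lemma encodes_hypergraph_unique:
  assumes "encodes_hypergraph x A B E" and "encodes_hypergraph x A' B' E'"
  shows "A' = A \<and> B' = B \<and> E' = E"
proof -
  have n: "inj encode_nat" by (simp add: inj_def encode_nat_inject)
  then have l: "inj (encode_list encode_nat)" by (simp add: inj_def encode_list_inject)
  show ?thesis using assms
    unfolding encodes_hypergraph_def encodes_vertices_def encodes_edges_def
    by (auto simp: encode_list_inject[OF n] encode_list_inject[OF l])
qed

end

theory Submission
  imports Defs
begin

text \<open>The search grows alternating trees as in Haxell's proof, layer by layer. A new layer consists of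
  edges at tree vertices that avoid in \<open>B\<close> everything the tree covers so far, at most \<open>U\<close> of them per
  vertex; the edges of the matching that block them supply the next tree vertices. Each blocker adds at
  most \<open>2 * r - 3\<close> covered vertices, so by the hypothesis a maximal new layer is larger than a constant
  fraction of the tree, unless many tree edges are unblocked. In that case a constant fraction of some
  layer of tree vertices can be rematched at once along unblocked edges, and all later layers are
  discarded. The tree sizes therefore grow geometrically with the depth, and the sum of their \<open>p\<close>-th
  inverse powers, plus a multiple of the size of the matching, increases by an inverse polynomial in
  every step, which bounds the number of steps.\<close>

section \<open>Polynomial-time functions on trees\<close>

text \<open>The surplus \<open>\<epsilon>\<close> over \<open>2 * r - 3\<close> pays for two losses.
  An unblocked tree edge covers \<open>r - 1\<close> vertices of \<open>B\<close> but supplies no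
  tree vertex. The cap \<open>U\<close> bounds the number of such edges by \<open>U\<close> times
  the number of vertices that own one, and these are few as long as no layer can be rematched. The
  cap in turn creates saturated vertices, about whose remaining edges a maximal layer says nothing;
  each of them owns \<open>U\<close> tree edges, so they are rare. Rematching many vertices at once
  is sound because tree edges are pairwise disjoint in \<open>B\<close>. No matching edge blocks two
  of them either, so blockers can simply be counted edge by edge. On the machine side the search is
  a loop of fixed length over lists, and the only danger is growth of the data. States consist of
  distinct input edges, but this rests on the invariant and so on the hypothesis of the theorem.
  Therefore running times are stated relative to a set of admissible inputs.\<close>

definition poly_bounded :: "(nat \<Rightarrow> nat) \<Rightarrow> bool" where
  "poly_bounded T \<longleftrightarrow> (\<exists>p. \<forall>n. T n \<le> poly p n)"

lemma poly_nat_mono: "m \<le> n \<Longrightarrow> poly p m \<le> poly p n" for p :: "nat poly"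
  by (induction p) (auto intro!: add_mono mult_mono)

lemma poly_bounded_const: "poly_bounded (\<lambda>n. c)"
  unfolding poly_bounded_def by (rule exI[of _ "[:c:]"]) simp

lemma poly_bounded_id: "poly_bounded (\<lambda>n. n)"
  unfolding poly_bounded_def by (rule exI[of _ "[:0, 1:]"]) simp

lemma poly_bounded_add:
  assumes "poly_bounded S" "poly_bounded T"
  shows "poly_bounded (\<lambda>n. S n + T n)"
proof -
  obtain p q where "\<forall>n. S n \<le> poly p n" "\<forall>n. T n \<le> poly q n"
    using assms unfolding poly_bounded_def by blast
  then have "\<forall>n. S n + T n \<le> poly (p + q) n" by (simp add: add_mono)
  then show ?thesis unfolding poly_bounded_def by blast
qed

lemma poly_bounded_mult:
  assumes "poly_bounded S" "poly_bounded T"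
  shows "poly_bounded (\<lambda>n. S n * T n)"
proof -
  obtain p q where "\<forall>n. S n \<le> poly p n" "\<forall>n. T n \<le> poly q n"
    using assms unfolding poly_bounded_def by blast
  then have "\<forall>n. S n * T n \<le> poly (p * q) n" by (simp add: mult_mono)
  then show ?thesis unfolding poly_bounded_def by blast
qed

lemma poly_bounded_poly_comp:
  assumes "poly_bounded T"
  shows "poly_bounded (\<lambda>n. poly p (T n))"
proof -
  obtain q where "\<forall>n. T n \<le> poly q n"
    using assms unfolding poly_bounded_def by blast
  then have "\<forall>n. poly p (T n) \<le> poly (pcompose p q) n"
    by (simp add: poly_pcompose poly_nat_mono)
  then show ?thesis unfolding poly_bounded_def by blast
qed

lemma poly_bounded_power: "poly_bounded T \<Longrightarrow> poly_bounded (\<lambda>n. T n ^ d)"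
  by (induction d) (auto intro: poly_bounded_const poly_bounded_mult)

lemmas poly_bounded_intros =
  poly_bounded_const poly_bounded_id poly_bounded_add poly_bounded_mult
  poly_bounded_poly_comp poly_bounded_power

section \<open>Time-bounded runs of composed programs\<close>

lemma tree_size_pos: "0 < tree_size t"
  by (cases t) auto

lemma expr_cost_ge: "tree_size (eval_expr a s) \<le> expr_cost a s"
  by (induction a) auto

text \<open>An assignment is charged at least the size of the tree that it stores, so a variable
  grows by at most the time spent. Every time bound thereby also bounds the size of the
  result.\<close>

lemma exec_size: "exec P s t s' \<Longrightarrow> tree_size (s' i) \<le> tree_size (s i) + t"
proof (induction rule: exec.induct)
  case (Assign x a s)
  then show ?case using expr_cost_ge[of a s] by (simp add: trans_le_add2)
qed auto

definition runs_within :: "program \<Rightarrow> store \<Rightarrow> nat \<Rightarrow> store \<Rightarrow> bool" where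
  "runs_within P s n s' \<longleftrightarrow> (\<exists>t\<le>n. exec P s t s')"

lemma runs_within_mono: "runs_within P s n s' \<Longrightarrow> n \<le> n' \<Longrightarrow> runs_within P s n' s'"
  unfolding runs_within_def by (meson order_trans)

lemma runs_within_Seq:
  "runs_within P s m s' \<Longrightarrow> runs_within Q s' n s'' \<Longrightarrow> runs_within (Seq P Q) s (1 + m + n) s''"
  unfolding runs_within_def by (meson add_le_mono exec.Seq order_refl)

lemma runs_within_Assign:
  "s' = s(x := eval_expr a s) \<Longrightarrow> runs_within (Assign x a) s (1 + expr_cost a s) s'"
  unfolding runs_within_def by (blast intro: exec.Assign)

lemma runs_within_Cond_True:
  "eval_expr a s \<noteq> Leaf \<Longrightarrow> runs_within P s n s'
   \<Longrightarrow> runs_within (Cond a P Q) s (1 + expr_cost a s + n) s'"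
  unfolding runs_within_def by (meson add_le_mono exec.Cond_True order_refl)

lemma runs_within_Cond_False:
  "eval_expr a s = Leaf \<Longrightarrow> runs_within Q s n s'
   \<Longrightarrow> runs_within (Cond a P Q) s (1 + expr_cost a s + n) s'"
  unfolding runs_within_def by (meson add_le_mono exec.Cond_False order_refl)

lemma runs_within_While_False:
  "eval_expr a s = Leaf \<Longrightarrow> runs_within (While a P) s (1 + expr_cost a s) s"
  unfolding runs_within_def by (blast intro: exec.While_False)

lemma runs_within_While_True:
  "eval_expr a s \<noteq> Leaf \<Longrightarrow> runs_within P s m s' \<Longrightarrow> runs_within (While a P) s' n s''
   \<Longrightarrow> runs_within (While a P) s (1 + expr_cost a s + m + n) s''"
  unfolding runs_within_def by (meson add_le_mono exec.While_True order_refl)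

lemma runs_within_size: "runs_within P s n s' \<Longrightarrow> tree_size (s' i) \<le> tree_size (s i) + n"
  unfolding runs_within_def using exec_size by (meson add_left_mono order_trans)

text \<open>Quantifying over the location \<open>k\<close> of the argument makes programs relocatable, so that
  subroutines can be composed without renaming variables; everything above \<open>k\<close> is scratch space
  with unknown contents.\<close>

definition computes_at ::
    "program \<Rightarrow> (nat \<Rightarrow> nat) \<Rightarrow> nat \<Rightarrow> tree set \<Rightarrow> (tree \<Rightarrow> tree) \<Rightarrow> bool" where
  "computes_at P T k D f \<longleftrightarrow> (\<forall>s. s k \<in> D \<longrightarrow>
     (\<exists>s'. runs_within P s (T (tree_size (s k))) s' \<and> s' k = f (s k) \<and> (\<forall>i<k. s' i = s i)))"

definition polytime_on :: "tree set \<Rightarrow> (tree \<Rightarrow> tree) \<Rightarrow> bool" where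
  "polytime_on D f \<longleftrightarrow> (\<forall>k. \<exists>P T. poly_bounded T \<and> computes_at P T k D f)"

abbreviation polytime :: "(tree \<Rightarrow> tree) \<Rightarrow> bool" where
  "polytime \<equiv> polytime_on UNIV"

lemma computes_atI:
  assumes "\<And>s. s k \<in> D \<Longrightarrow> \<exists>s'. runs_within P s (T (tree_size (s k))) s' \<and> s' k = f (s k) \<and> (\<forall>i<k. s' i = s i)"
  shows "computes_at P T k D f"
  using assms unfolding computes_at_def by blast

lemma computes_atE:
  assumes "computes_at P T k D f" "s k \<in> D"
  obtains s' where "runs_within P s (T (tree_size (s k))) s'" "s' k = f (s k)"
    "\<And>i. i < k \<Longrightarrow> s' i = s i"
  using assms unfolding computes_at_def by blast

lemma polytime_onI:
  assumes "\<And>k. computes_at (P k) T k D f" "poly_bounded T"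
  shows "polytime_on D f"
  using assms unfolding polytime_on_def by blast

text \<open>A \<open>poly_bounded\<close> function need not be monotone, whereas a polynomial over
  \<open>nat\<close> is. Composition needs this, since it evaluates the second bound at an
  overestimate of the size of the intermediate result.\<close>

lemma polytime_onE:
  assumes "polytime_on D f"
  obtains P p where "computes_at P (poly p) k D f"
proof -
  obtain P T where T: "poly_bounded T" and P: "computes_at P T k D f"
    using assms unfolding polytime_on_def by metis
  obtain p where "\<forall>n. T n \<le> poly p n" using T unfolding poly_bounded_def by blast
  with P have "computes_at P (poly p) k D f"
    unfolding computes_at_def by (meson runs_within_mono)
  then show ?thesis by (rule that)
qed

lemma polytime_size:
  assumes "polytime f"
  obtains p where "\<And>x. tree_size (f x) \<le> poly p (tree_size x)"
proof -
  obtain P p where P: "computes_at P (poly p) 0 UNIV f"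
    by (rule polytime_onE[OF assms])
  \<comment> \<open>The summand \<open>[:0, 1:]\<close> stands for the input, to whose size the
    running time is added.\<close>
  have "tree_size (f x) \<le> poly ([:0, 1:] + p) (tree_size x)" for x
  proof -
    obtain s' where "runs_within P (\<lambda>_. x) (poly p (tree_size x)) s'" "s' 0 = f x"
      using computes_atE[where s = "\<lambda>_. x", OF P] by auto
    then show ?thesis using runs_within_size[of P "\<lambda>_. x" _ s' 0] by simp
  qed
  then show ?thesis by (rule that)
qed

lemma polytime_on_comp:
  assumes "polytime_on D f" "polytime g"
  shows "polytime_on D (\<lambda>x. g (f x))"
  unfolding polytime_on_def
proof
  fix k
  obtain P p where P: "computes_at P (poly p) k D f"
    using polytime_onE[OF assms(1)] .
  obtain Q q where Q: "computes_at Q (poly q) k UNIV g"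
    using polytime_onE[OF assms(2)] .
  let ?T = "\<lambda>n. 1 + poly p n + poly q (n + poly p n)"
  have "computes_at (Seq P Q) ?T k D (\<lambda>x. g (f x))"
  proof (rule computes_atI)
    fix s :: store assume D: "s k \<in> D"
    obtain s1 where s1: "runs_within P s (poly p (tree_size (s k))) s1" "s1 k = f (s k)"
        "\<And>i. i < k \<Longrightarrow> s1 i = s i"
      using computes_atE[where s = s, OF P D] by metis
    obtain s2 where s2: "runs_within Q s1 (poly q (tree_size (s1 k))) s2" "s2 k = g (s1 k)"
        "\<And>i. i < k \<Longrightarrow> s2 i = s1 i"
      using computes_atE[where s = s1, OF Q UNIV_I] by metis
    have "poly q (tree_size (s1 k)) \<le> poly q (tree_size (s k) + poly p (tree_size (s k)))"
      by (rule poly_nat_mono) (rule runs_within_size[OF s1(1)])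
    then have "runs_within (Seq P Q) s (?T (tree_size (s k))) s2"
      using runs_within_Seq[OF s1(1) s2(1)] by (rule_tac runs_within_mono) auto
    with s1 s2 show "\<exists>s'. runs_within (Seq P Q) s (?T (tree_size (s k))) s' \<and>
        s' k = g (f (s k)) \<and> (\<forall>i<k. s' i = s i)"
      by auto
  qed
  moreover have "poly_bounded ?T" by (intro poly_bounded_intros)
  ultimately show "\<exists>P T. poly_bounded T \<and> computes_at P T k D (\<lambda>x. g (f x))"
    by blast
qed

lemma polytime_expr:
  assumes "\<And>k s. eval_expr (a k) s = f (s k)" and "poly_bounded T"
    and "\<And>k s. expr_cost (a k) s \<le> T (tree_size (s k))"
  shows "polytime f"
proof (rule polytime_onI)
  show "computes_at (Assign k (a k)) (\<lambda>n. 1 + T n) k UNIV f" for k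
  proof (rule computes_atI)
    fix s :: store
    have "runs_within (Assign k (a k)) s (1 + T (tree_size (s k))) (s(k := f (s k)))"
      by (rule runs_within_mono[OF runs_within_Assign]) (use assms in auto)
    then show "\<exists>s'. runs_within (Assign k (a k)) s (1 + T (tree_size (s k))) s' \<and>
        s' k = f (s k) \<and> (\<forall>i<k. s' i = s i)"
      by (intro exI[of _ "s(k := f (s k))"]) auto
  qed
  show "poly_bounded (\<lambda>n. 1 + T n)" by (intro poly_bounded_intros assms)
qed

lemma polytime_id: "polytime (\<lambda>x. x)"
  by (rule polytime_expr[where a = Var, OF _ poly_bounded_id]) auto

lemma polytime_Leaf: "polytime (\<lambda>x. Leaf)"
  by (rule polytime_expr[where a = "\<lambda>_. Const_Leaf", OF _ poly_bounded_const[of 1]]) auto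

lemma left_part_size: "tree_size (left_part t) \<le> tree_size t"
  by (cases t) auto

lemma right_part_size: "tree_size (right_part t) \<le> tree_size t"
  by (cases t) auto

lemma polytime_left_part: "polytime_on D f \<Longrightarrow> polytime_on D (\<lambda>x. left_part (f x))"
  by (erule polytime_on_comp, rule polytime_expr[where a = "\<lambda>k. Hd (Var k)" and T = "\<lambda>n. n + n"])
    (auto intro: poly_bounded_intros left_part_size)

lemma polytime_right_part: "polytime_on D f \<Longrightarrow> polytime_on D (\<lambda>x. right_part (f x))"
  by (erule polytime_on_comp, rule polytime_expr[where a = "\<lambda>k. Tl (Var k)" and T = "\<lambda>n. n + n"])
    (auto intro: poly_bounded_intros right_part_size)

text \<open>Copying the argument upwards keeps it intact at \<open>k\<close>, where later calls can
  read it again.\<close>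

definition call :: "nat \<Rightarrow> nat \<Rightarrow> program \<Rightarrow> program" where
  "call k j P = Seq (Assign j (Var k)) P"

lemma callE:
  assumes "computes_at P (poly p) j D f" and "s k \<in> D"
  obtains s' where "runs_within (call k j P) s (2 + tree_size (s k) + poly p (tree_size (s k))) s'"
    "s' j = f (s k)" "\<And>i. i < j \<Longrightarrow> s' i = s i"
    "tree_size (f (s k)) \<le> tree_size (s k) + poly p (tree_size (s k))"
proof -
  let ?s = "s(j := s k)"
  have "?s j \<in> D" using assms(2) by simp
  then obtain s' where s': "runs_within P ?s (poly p (tree_size (s k))) s'" "s' j = f (s k)"
      "\<And>i. i < j \<Longrightarrow> s' i = ?s i"
    using computes_atE[where s = ?s, OF assms(1)] by (metis fun_upd_same)
  have "runs_within (call k j P) s (2 + tree_size (s k) + poly p (tree_size (s k))) s'"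
    using runs_within_Seq[OF runs_within_Assign[where s = s and a = "Var k"] s'(1)] by (simp add: call_def)
  moreover have "tree_size (f (s k)) \<le> tree_size (s k) + poly p (tree_size (s k))"
    using runs_within_size[OF s'(1), of j] s'(2) by simp
  ultimately show ?thesis using s' by (intro that[of s']) auto
qed

lemma polytime_Node:
  assumes "polytime_on D f" "polytime_on D g"
  shows "polytime_on D (\<lambda>x. Node (f x) (g x))"
  unfolding polytime_on_def
proof
  fix k
  obtain P p where P: "computes_at P (poly p) (k+1) D f"
    using polytime_onE[OF assms(1)] .
  obtain Q q where Q: "computes_at Q (poly q) (k+2) D g"
    using polytime_onE[OF assms(2)] .
  let ?P = "Seq (call k (k+1) P) (Seq (call k (k+2) Q)
              (Assign k (Cons_Expr (Var (k+1)) (Var (k+2)))))"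
  let ?T = "\<lambda>n. 1 + (2 + n + poly p n) + (1 + (2 + n + poly q n)
              + (1 + (2 * (n + poly p n) + 2 * (n + poly q n) + 1)))"
  have "computes_at ?P ?T k D (\<lambda>x. Node (f x) (g x))"
  proof (rule computes_atI)
    fix s :: store assume D: "s k \<in> D"
    let ?n = "tree_size (s k)"
    obtain s1 where s1: "runs_within (call k (k+1) P) s (2 + ?n + poly p ?n) s1"
      "s1 (k+1) = f (s k)" "\<And>i. i < k+1 \<Longrightarrow> s1 i = s i" "tree_size (f (s k)) \<le> ?n + poly p ?n"
      using callE[where k = k and s = s, OF P D] by metis
    have k: "s1 k = s k" using s1(3) by simp
    obtain s2 where s2: "runs_within (call k (k+2) Q) s1 (2 + ?n + poly q ?n) s2"
      "s2 (k+2) = g (s k)" "\<And>i. i < k+2 \<Longrightarrow> s2 i = s1 i" "tree_size (g (s k)) \<le> ?n + poly q ?n"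
      using callE[where k = k and s = s1, OF Q] D k by metis
    let ?s3 = "s2(k := Node (f (s k)) (g (s k)))"
    have s3: "runs_within (Assign k (Cons_Expr (Var (k+1)) (Var (k+2)))) s2
        (1 + (2 * (?n + poly p ?n) + 2 * (?n + poly q ?n) + 1)) ?s3"
      by (rule runs_within_mono[OF runs_within_Assign])
         (use s1 s2 s2(3)[of "k+1"] in auto)
    have "runs_within ?P s (?T ?n) ?s3"
      using runs_within_Seq[OF s1(1) runs_within_Seq[OF s2(1) s3]] by simp
    then show "\<exists>s'. runs_within ?P s (?T ?n) s' \<and> s' k = Node (f (s k)) (g (s k)) \<and> (\<forall>i<k. s' i = s i)"
      using s1(3) s2(3) by (intro exI[of _ ?s3]) auto
  qed
  moreover have "poly_bounded ?T" by (intro poly_bounded_intros)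
  ultimately show "\<exists>P T. poly_bounded T \<and> computes_at P T k D (\<lambda>x. Node (f x) (g x))"
    by blast
qed

lemma polytime_if:
  assumes "polytime_on D c" "polytime_on D f" "polytime_on D g"
  shows "polytime_on D (\<lambda>x. if c x \<noteq> Leaf then f x else g x)"
  unfolding polytime_on_def
proof
  fix k
  obtain C c' where C: "computes_at C (poly c') (k+1) D c"
    using polytime_onE[OF assms(1)] .
  obtain P p where P: "computes_at P (poly p) k D f"
    using polytime_onE[OF assms(2)] .
  obtain Q q where Q: "computes_at Q (poly q) k D g"
    using polytime_onE[OF assms(3)] .
  let ?P = "Seq (call k (k+1) C) (Cond (Var (k+1)) P Q)"
  let ?T = "\<lambda>n. 1 + (2 + n + poly c' n) + (1 + (n + poly c' n) + (poly p n + poly q n))"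
  let ?h = "\<lambda>x. if c x \<noteq> Leaf then f x else g x"
  have "computes_at ?P ?T k D ?h"
  proof (rule computes_atI)
    fix s :: store assume D: "s k \<in> D"
    let ?n = "tree_size (s k)"
    obtain s1 where s1: "runs_within (call k (k+1) C) s (2 + ?n + poly c' ?n) s1"
      "s1 (k+1) = c (s k)" "\<And>i. i < k+1 \<Longrightarrow> s1 i = s i" "tree_size (c (s k)) \<le> ?n + poly c' ?n"
      using callE[where k = k and s = s, OF C D] by metis
    have D1: "s1 k \<in> D" and k: "s1 k = s k" using D s1(3) by simp_all
    obtain s2 where s2: "runs_within (Cond (Var (k+1)) P Q) s1
        (1 + (?n + poly c' ?n) + (poly p ?n + poly q ?n)) s2"
      "s2 k = ?h (s k)" "\<And>i. i < k \<Longrightarrow> s2 i = s1 i"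
    proof (cases "c (s k) = Leaf")
      case True
      obtain s2 where "runs_within Q s1 (poly q ?n) s2" "s2 k = g (s k)" "\<And>i. i < k \<Longrightarrow> s2 i = s1 i"
        using computes_atE[where s = s1, OF Q D1] k by metis
      then show ?thesis using s1 True
        by (intro that[of s2] runs_within_mono[OF runs_within_Cond_False, of _ _ _ "poly q ?n"]) auto
    next
      case False
      obtain s2 where "runs_within P s1 (poly p ?n) s2" "s2 k = f (s k)" "\<And>i. i < k \<Longrightarrow> s2 i = s1 i"
        using computes_atE[where s = s1, OF P D1] k by metis
      then show ?thesis using s1 False
        by (intro that[of s2] runs_within_mono[OF runs_within_Cond_True, of _ _ _ "poly p ?n"]) auto
    qed
    have "runs_within ?P s (?T ?n) s2" using runs_within_Seq[OF s1(1) s2(1)] by simp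
    then show "\<exists>s'. runs_within ?P s (?T ?n) s' \<and> s' k = ?h (s k) \<and> (\<forall>i<k. s' i = s i)"
      using s1(3) s2 by (intro exI[of _ s2]) auto
  qed
  moreover have "poly_bounded ?T" by (intro poly_bounded_intros)
  ultimately show "\<exists>P T. poly_bounded T \<and> computes_at P T k D ?h"
    by blast
qed

text \<open>A list of trees is the same thing as a tree: \<open>spine\<close> and \<open>from_spine\<close> are inverse bijections.\<close>

fun spine :: "tree \<Rightarrow> tree list" where
  "spine Leaf = []"
| "spine (Node l r) = l # spine r"

abbreviation from_spine :: "tree list \<Rightarrow> tree" where
  "from_spine \<equiv> encode_list (\<lambda>t. t)"

lemma spine_from_spine [simp]: "spine (from_spine ts) = ts"
  by (induction ts) auto

lemma from_spine_spine [simp]: "from_spine (spine t) = t"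
  by (induction t) auto

lemma spine_eq_Nil: "spine t = [] \<longleftrightarrow> t = Leaf"
  by (cases t) auto

lemma length_spine_le: "length (spine t) \<le> tree_size t"
  by (induction t) auto

text \<open>Location \<open>k\<close> holds the fixed context, \<open>k+1\<close> the rest of the
  list, \<open>k+2\<close> the accumulator, and \<open>k+3\<close> the argument and result of the
  step \<open>Q\<close>. Since all stored trees stay within \<open>N\<close>, one cost bound serves
  every round; its coefficients are rounded up generously.\<close>

lemma runs_within_fold:
  assumes Q: "computes_at Q (poly q) (k+3) UNIV (\<lambda>z. h (left_part z) (left_part (right_part z)) (right_part (right_part z)))"
    and P: "P = While (Var (k+1)) (Seq (Assign (k+3) (Cons_Expr (Var k) (Cons_Expr (Hd (Var (k+1))) (Var (k+2)))))
              (Seq Q (Seq (Assign (k+2) (Var (k+3))) (Assign (k+1) (Tl (Var (k+1)))))))"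
    and "\<And>n. n \<le> length (spine (s (k+1))) \<Longrightarrow> tree_size (fold (h (s k)) (take n (spine (s (k+1)))) (s (k+2))) \<le> N"
    and "tree_size (s k) \<le> N" "tree_size (s (k+1)) \<le> N"
  shows "\<exists>s'. runs_within P s (length (spine (s (k+1))) * (100 * N + 100 + 2 * poly q (5 * N + 5)) + 1 + N) s' \<and>
    s' (k+2) = fold (h (s k)) (spine (s (k+1))) (s (k+2)) \<and> (\<forall>i\<le>k. s' i = s i)"
  using assms(3-5)
proof (induction "spine (s (k+1))" arbitrary: s)
  case Nil
  then have "s (k+1) = Leaf" using spine_eq_Nil by metis
  moreover have "runs_within P s (1 + expr_cost (Var (k+1)) s) s"
    unfolding P by (rule runs_within_While_False) (use \<open>s (k+1) = Leaf\<close> in simp)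
  ultimately have "runs_within P s (1 + N) s"
    using Nil by (elim runs_within_mono) auto
  then show ?case using \<open>s (k+1) = Leaf\<close> by auto
next
  case (Cons a as)
  let ?W = "100 * N + 100 + 2 * poly q (5 * N + 5)"
  obtain t where t: "s (k+1) = Node a t" "as = spine t" using Cons.hyps(2) by (cases "s (k+1)") auto
  let ?z = "Node (s k) (Node a (s (k+2)))"
  let ?s1 = "s(k+3 := ?z)"
  have N2: "tree_size (s (k+2)) \<le> N" using Cons.prems(1)[of 0] by simp
  have "N > 0" using N2 tree_size_pos[of "s (k+2)"] by linarith
  have z: "tree_size ?z \<le> 5 * N + 5" using N2 Cons.prems t by simp
  have r1: "runs_within (Assign (k+3) (Cons_Expr (Var k) (Cons_Expr (Hd (Var (k+1))) (Var (k+2))))) s (20 * N + 20) ?s1"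
    by (rule runs_within_mono[OF runs_within_Assign]) (use N2 Cons.prems t in auto)
  obtain s2 where s2: "runs_within Q ?s1 (poly q (tree_size ?z)) s2"
     "s2 (k+3) = h (s k) a (s (k+2))" "\<And>i. i < k+3 \<Longrightarrow> s2 i = ?s1 i"
    using computes_atE[where s = ?s1, OF Q] by auto
  let ?acc = "h (s k) a (s (k+2))"
  have acc: "tree_size ?acc \<le> N" using Cons.prems(1)[of 1] Cons.hyps(2)[symmetric] by simp
  have r2: "runs_within Q ?s1 (poly q (5 * N + 5)) s2"
    by (rule runs_within_mono[OF s2(1)]) (rule poly_nat_mono[OF z])
  let ?s3 = "s2(k+2 := ?acc)"
  have r3: "runs_within (Assign (k+2) (Var (k+3))) s2 (1 + N) ?s3"
    by (rule runs_within_mono[OF runs_within_Assign]) (use acc s2 in auto)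
  let ?s4 = "?s3(k+1 := t)"
  have s3: "?s3 (k+1) = Node a t" using s2(3)[of "k+1"] t by simp
  have r4: "runs_within (Assign (k+1) (Tl (Var (k+1)))) ?s3 (1 + N + N) ?s4"
    by (rule runs_within_mono[OF runs_within_Assign]) (use t Cons.prems s3 in auto)
  have s4: "?s4 k = s k" "?s4 (k+1) = t" "?s4 (k+2) = ?acc" "\<And>i. i \<le> k \<Longrightarrow> ?s4 i = s i"
    using s2(3) by auto
  have "\<exists>s'. runs_within P ?s4 (length (spine (?s4 (k+1))) * ?W + 1 + N) s' \<and>
    s' (k+2) = fold (h (?s4 k)) (spine (?s4 (k+1))) (?s4 (k+2)) \<and> (\<forall>i\<le>k. s' i = ?s4 i)"
  proof (rule Cons.hyps(1))
    show "as = spine (?s4 (k+1))" using t by simp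
    show "tree_size (fold (h (?s4 k)) (take n (spine (?s4 (k+1)))) (?s4 (k+2))) \<le> N"
      if "n \<le> length (spine (?s4 (k+1)))" for n
      using Cons.prems(1)[of "Suc n"] that t s4 by simp
  qed (use Cons.prems s4 t in auto)
  then obtain s' where s': "runs_within P ?s4 (length as * ?W + 1 + N) s'"
    "s' (k+2) = fold (h (s k)) as ?acc" "\<And>i. i \<le> k \<Longrightarrow> s' i = s i"
    using s4 t by auto
  have "runs_within P s (length (spine (s (k+1))) * ?W + 1 + N) s'"
  proof -
    have "runs_within P s (1 + expr_cost (Var (k+1)) s + (1 + (20 * N + 20) + (1 + poly q (5 * N + 5) + (1 + (1 + N) + (1 + N + N)))) +
        (length as * ?W + 1 + N)) s'"
      using runs_within_While_True[OF _ runs_within_Seq[OF r1 runs_within_Seq[OF r2 runs_within_Seq[OF r3 r4]]],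
          of "Var (k+1)", folded P, OF _ s'(1)] t by simp
    then show ?thesis
      by (rule runs_within_mono) (use Cons.prems Cons.hyps(2)[symmetric] t \<open>N > 0\<close> in simp)
  qed
  then show ?case using s' Cons.hyps(2)[symmetric] by (intro exI[of _ s']) (auto simp del: One_nat_def)
qed

text \<open>The bound on the intermediate results cannot be dropped: iterating a polynomial-time step
  may double the size of the accumulator each time.\<close>

lemma polytime_on_fold:
  assumes l: "polytime_on D (\<lambda>x. from_spine (l x))" and i: "polytime_on D i"
    and h: "polytime (\<lambda>z. h (left_part z) (left_part (right_part z)) (right_part (right_part z)))"
    and b: "poly_bounded b" "\<And>x n. x \<in> D \<Longrightarrow> n \<le> length (l x) \<Longrightarrow>
      tree_size (fold (h x) (take n (l x)) (i x)) \<le> b (tree_size x)"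
  shows "polytime_on D (\<lambda>x. fold (h x) (l x) (i x))"
  unfolding polytime_on_def
proof
  fix k
  obtain P p where P: "computes_at P (poly p) (k+1) D (\<lambda>x. from_spine (l x))"
    using polytime_onE[OF l] .
  obtain Q q where Q: "computes_at Q (poly q) (k+2) D i"
    using polytime_onE[OF i] .
  obtain H q' where H: "computes_at H (poly q') (k+3) UNIV (\<lambda>z. h (left_part z) (left_part (right_part z)) (right_part (right_part z)))"
    using polytime_onE[OF h] .
  define W where "W = While (Var (k+1)) (Seq (Assign (k+3) (Cons_Expr (Var k) (Cons_Expr (Hd (Var (k+1))) (Var (k+2)))))
              (Seq H (Seq (Assign (k+2) (Var (k+3))) (Assign (k+1) (Tl (Var (k+1)))))))"
  let ?P = "Seq (call k (k+1) P) (Seq (call k (k+2) Q) (Seq W (Assign k (Var (k+2)))))"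
  let ?N = "\<lambda>n. n + poly p n + b n"
  let ?T = "\<lambda>n. 1 + (2 + n + poly p n) + (1 + (2 + n + poly q n) +
     (1 + (?N n * (100 * ?N n + 100 + 2 * poly q' (5 * ?N n + 5)) + 1 + ?N n) + (1 + ?N n)))"
  have "computes_at ?P ?T k D (\<lambda>x. fold (h x) (l x) (i x))"
  proof (rule computes_atI)
    fix s :: store assume D: "s k \<in> D"
    let ?n = "tree_size (s k)"
    let ?M = "?N ?n"
    obtain s1 where s1: "runs_within (call k (k+1) P) s (2 + ?n + poly p ?n) s1"
      "s1 (k+1) = from_spine (l (s k))" "\<And>i. i < k+1 \<Longrightarrow> s1 i = s i"
      "tree_size (from_spine (l (s k))) \<le> ?n + poly p ?n"
      using callE[where k = k and s = s, OF P D] by metis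
    have k: "s1 k = s k" using s1(3) by simp
    obtain s2 where s2: "runs_within (call k (k+2) Q) s1 (2 + ?n + poly q ?n) s2"
      "s2 (k+2) = i (s k)" "\<And>i. i < k+2 \<Longrightarrow> s2 i = s1 i"
      using callE[where k = k and s = s1, OF Q] D k by metis
    have s2': "s2 k = s k" "s2 (k+1) = from_spine (l (s k))" "\<And>i. i < k \<Longrightarrow> s2 i = s i"
      using s1 s2 by auto
    have "\<exists>s'. runs_within W s2 (length (spine (s2 (k+1))) * (100 * ?M + 100 + 2 * poly q' (5 * ?M + 5)) + 1 + ?M) s' \<and>
      s' (k+2) = fold (h (s2 k)) (spine (s2 (k+1))) (s2 (k+2)) \<and> (\<forall>i\<le>k. s' i = s2 i)"
      by (rule runs_within_fold[OF H W_def]) (use s1(4) s2(2) s2' b(2)[OF D] in \<open>auto simp: trans_le_add2\<close>)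
    then obtain s3 where s3: "runs_within W s2 (length (l (s k)) * (100 * ?M + 100 + 2 * poly q' (5 * ?M + 5)) + 1 + ?M) s3"
      "s3 (k+2) = fold (h (s k)) (l (s k)) (i (s k))" "\<And>i. i \<le> k \<Longrightarrow> s3 i = s2 i"
      using s2 s2' by auto
    have len: "length (l (s k)) \<le> ?M"
      using length_spine_le[of "from_spine (l (s k))"] s1(4) by simp
    have r3: "runs_within W s2 (?M * (100 * ?M + 100 + 2 * poly q' (5 * ?M + 5)) + 1 + ?M) s3"
      by (rule runs_within_mono[OF s3(1)]) (intro add_right_mono mult_right_mono len, simp)
    let ?s4 = "s3(k := fold (h (s k)) (l (s k)) (i (s k)))"
    have r4: "runs_within (Assign k (Var (k+2))) s3 (1 + ?M) ?s4"
      by (rule runs_within_mono[OF runs_within_Assign])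
        (use s3(2) b(2)[OF D, of "length (l (s k))"] in auto)
    have "runs_within ?P s (?T ?n) ?s4"
      using runs_within_Seq[OF s1(1) runs_within_Seq[OF s2(1) runs_within_Seq[OF r3 r4]]] by simp
    then show "\<exists>s'. runs_within ?P s (?T ?n) s' \<and> s' k = fold (h (s k)) (l (s k)) (i (s k)) \<and> (\<forall>i<k. s' i = s i)"
      using s3(3) s2'(3) by (intro exI[of _ ?s4]) auto
  qed
  moreover have "poly_bounded ?T" by (intro poly_bounded_intros b)
  ultimately show "\<exists>P T. poly_bounded T \<and> computes_at P T k D (\<lambda>x. fold (h x) (l x) (i x))"
    by blast
qed

lemma tree_size_from_spine: "tree_size (from_spine ts) = 1 + (\<Sum>t\<leftarrow>ts. 1 + tree_size t)"
  by (induction ts) auto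

lemma tree_size_mem_spine: "t \<in> set ts \<Longrightarrow> tree_size t \<le> tree_size (from_spine ts)"
  by (induction ts) auto

lemma length_le_tree_size: "length ts \<le> tree_size (from_spine ts)"
  using length_spine_le[of "from_spine ts"] by simp

section \<open>Predicates, lists and lists of lists as polynomial-time values\<close>

definition bool_tree :: "bool \<Rightarrow> tree" where
  "bool_tree b = (if b then Node Leaf Leaf else Leaf)"

lemma bool_tree_eq_Leaf [simp]: "bool_tree b = Leaf \<longleftrightarrow> \<not> b"
  by (simp add: bool_tree_def)

definition polytime_pred :: "(tree \<Rightarrow> bool) \<Rightarrow> bool" where
  "polytime_pred P \<longleftrightarrow> polytime (\<lambda>x. bool_tree (P x))"

definition polytime_list :: "(tree \<Rightarrow> tree list) \<Rightarrow> bool" where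
  "polytime_list l \<longleftrightarrow> polytime (\<lambda>x. from_spine (l x))"

definition polytime_lists :: "(tree \<Rightarrow> tree list list) \<Rightarrow> bool" where
  "polytime_lists l \<longleftrightarrow> polytime_list (\<lambda>x. map from_spine (l x))"

lemma polytime_comp: "polytime g \<Longrightarrow> polytime f \<Longrightarrow> polytime (\<lambda>x. g (f x))"
  by (rule polytime_on_comp)

lemma polytime_pred_comp: "polytime_pred P \<Longrightarrow> polytime f \<Longrightarrow> polytime_pred (\<lambda>x. P (f x))"
  unfolding polytime_pred_def by (rule polytime_on_comp)

lemma polytime_list_comp: "polytime_list l \<Longrightarrow> polytime f \<Longrightarrow> polytime_list (\<lambda>x. l (f x))"
  unfolding polytime_list_def by (rule polytime_on_comp)

lemma polytime_lists_comp: "polytime_lists l \<Longrightarrow> polytime f \<Longrightarrow> polytime_lists (\<lambda>x. l (f x))"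
  unfolding polytime_lists_def by (rule polytime_list_comp)

lemma polytime_const: "polytime (\<lambda>x. c)"
  by (induction c) (auto intro: polytime_Leaf polytime_Node)

lemma polytime_from_spine: "polytime_list l \<Longrightarrow> polytime (\<lambda>x. from_spine (l x))"
  unfolding polytime_list_def .

lemma polytime_spine: "polytime f \<Longrightarrow> polytime_list (\<lambda>x. spine (f x))"
  unfolding polytime_list_def by simp

lemma polytime_list_Cons: "polytime f \<Longrightarrow> polytime_list l \<Longrightarrow> polytime_list (\<lambda>x. f x # l x)"
  unfolding polytime_list_def by (simp add: polytime_Node)

lemma polytime_list_Nil: "polytime_list (\<lambda>x. [])"
  unfolding polytime_list_def by (simp add: polytime_const)

lemma polytime_list_tl: "polytime_list l \<Longrightarrow> polytime_list (\<lambda>x. tl (l x))"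
proof -
  have "from_spine (tl ts) = right_part (from_spine ts)" for ts by (cases ts) auto
  then show "polytime_list l \<Longrightarrow> polytime_list (\<lambda>x. tl (l x))"
    unfolding polytime_list_def by (simp add: polytime_right_part)
qed

lemma polytime_pred_const: "polytime_pred (\<lambda>x. c)"
  unfolding polytime_pred_def by (rule polytime_const)

lemma polytime_pred_not_Leaf: "polytime f \<Longrightarrow> polytime_pred (\<lambda>x. f x \<noteq> Leaf)"
  unfolding polytime_pred_def bool_tree_def
  by (intro polytime_if polytime_const)

lemma polytime_If:
  "polytime_pred P \<Longrightarrow> polytime f \<Longrightarrow> polytime g \<Longrightarrow> polytime (\<lambda>x. if P x then f x else g x)"
  using polytime_if[of UNIV "\<lambda>x. bool_tree (P x)" f g] unfolding polytime_pred_def by simp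

lemma polytime_list_If:
  "polytime_pred P \<Longrightarrow> polytime_list f \<Longrightarrow> polytime_list g
   \<Longrightarrow> polytime_list (\<lambda>x. if P x then f x else g x)"
  unfolding polytime_list_def by (simp add: if_distrib polytime_If)

lemma polytime_lists_If:
  "polytime_pred P \<Longrightarrow> polytime_lists f \<Longrightarrow> polytime_lists g
   \<Longrightarrow> polytime_lists (\<lambda>x. if P x then f x else g x)"
  unfolding polytime_lists_def by (simp add: if_distrib polytime_list_If)

lemma polytime_pred_If:
  assumes "polytime_pred P" "polytime_pred Q" "polytime_pred R"
  shows "polytime_pred (\<lambda>x. if P x then Q x else R x)"
  using polytime_If[OF assms(1)] assms(2,3)
  unfolding polytime_pred_def if_distrib[of bool_tree] by blast

lemma polytime_pred_not: "polytime_pred P \<Longrightarrow> polytime_pred (\<lambda>x. \<not> P x)"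
  by (rule back_subst[of polytime_pred, OF polytime_pred_If[of P "\<lambda>x. False" "\<lambda>x. True"]])
    (auto intro: polytime_pred_const)

lemma polytime_pred_conj:
  "polytime_pred P \<Longrightarrow> polytime_pred Q \<Longrightarrow> polytime_pred (\<lambda>x. P x \<and> Q x)"
  by (rule back_subst[of polytime_pred, OF polytime_pred_If[of P Q "\<lambda>x. False"]])
    (auto intro: polytime_pred_const)

lemma polytime_pred_disj:
  "polytime_pred P \<Longrightarrow> polytime_pred Q \<Longrightarrow> polytime_pred (\<lambda>x. P x \<or> Q x)"
  by (rule back_subst[of polytime_pred, OF polytime_pred_If[of P "\<lambda>x. True" Q]])
    (auto intro: polytime_pred_const)

lemma polytime_pred_imp:
  "polytime_pred P \<Longrightarrow> polytime_pred Q \<Longrightarrow> polytime_pred (\<lambda>x. P x \<longrightarrow> Q x)"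
  by (rule back_subst[of polytime_pred, OF polytime_pred_If[of P Q "\<lambda>x. True"]])
    (auto intro: polytime_pred_const)

lemma polytime_pred_eq:
  "polytime_pred P \<Longrightarrow> polytime_pred Q \<Longrightarrow> polytime_pred (\<lambda>x. P x = Q x)"
  by (rule back_subst[of polytime_pred, OF polytime_pred_If[of P Q "\<lambda>x. \<not> Q x"]])
    (auto intro: polytime_pred_not)

lemma polytime_pred_Nil: "polytime_list l \<Longrightarrow> polytime_pred (\<lambda>x. l x = [])"
proof -
  have eq: "(l x = []) = (\<not> from_spine (l x) \<noteq> Leaf)" for x by (cases "l x") auto
  show "polytime_list l \<Longrightarrow> polytime_pred (\<lambda>x. l x = [])"
    unfolding polytime_list_def eq by (intro polytime_pred_not polytime_pred_not_Leaf)
qed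

text \<open>For \<open>l x = []\<close> the value is the unspecified, but fixed, tree \<open>hd []\<close>.\<close>

lemma polytime_hd: 
  assumes "polytime_list l"
  shows "polytime (\<lambda>x. hd (l x))"
proof -
  have "hd (l x) = (if l x = [] then hd [] else left_part (from_spine (l x)))" for x
    by (cases "l x") auto
  moreover have "polytime (\<lambda>x. if l x = [] then hd [] else left_part (from_spine (l x)))"
    using assms by (intro polytime_If polytime_pred_Nil polytime_const polytime_left_part
        polytime_from_spine)
  ultimately show ?thesis by simp
qed

text \<open>One step enlarges the encoded accumulator by an amount that depends on \<open>x\<close>
  and the list entry alone. The growth is thus additive along the list, which keeps all intermediate
  results polynomial. The pair \<open>d\<close>, \<open>e\<close> admits accumulators that are not
  trees.\<close>

lemma polytime_fold:
  assumes de: "\<And>a. d (e a) = a"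
    and l: "polytime_list l" and i: "polytime (\<lambda>x. e (i x))"
    and h: "polytime (\<lambda>z. e (h (left_part z) (left_part (right_part z)) (d (right_part (right_part z)))))"
    and c: "\<And>x a b. tree_size (e (h x a b)) \<le> tree_size (e b) + poly c (tree_size x + tree_size a)"
  shows "polytime (\<lambda>x. e (fold (h x) (l x) (i x)))"
proof -
  let ?h = "\<lambda>x a t. e (h x a (d t))"
  obtain pl where pl: "\<And>x. tree_size (from_spine (l x)) \<le> poly pl (tree_size x)"
    using polytime_size l unfolding polytime_list_def by blast
  obtain pi where pi: "\<And>x. tree_size (e (i x)) \<le> poly pi (tree_size x)"
    using polytime_size i by blast
  have fold_eq: "e (fold (h x) ts b) = fold (?h x) ts (e b)" for x ts b
    by (induction ts arbitrary: b) (auto simp: de)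
  have size: "tree_size (e (fold (h x) ts b)) \<le> tree_size (e b) + length ts * poly c (tree_size x + N)"
    if "\<And>t. t \<in> set ts \<Longrightarrow> tree_size t \<le> N" for x ts b N
    using that
  proof (induction ts arbitrary: b)
    case (Cons a ts)
    have "poly c (tree_size x + tree_size a) \<le> poly c (tree_size x + N)"
      using Cons.prems by (intro poly_nat_mono) auto
    then show ?case using Cons.IH[of "h x a b"] Cons.prems c[of x a b] by fastforce
  qed simp
  let ?b = "\<lambda>n. poly pi n + poly pl n * poly c (n + poly pl n)"
  have "tree_size (fold (?h x) (take n (l x)) (e (i x))) \<le> ?b (tree_size x)" for x n
  proof -
    have "tree_size t \<le> poly pl (tree_size x)" if "t \<in> set (take n (l x))" for t
      using that tree_size_mem_spine[OF in_set_takeD] pl order_trans by blast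
    moreover have "length (take n (l x)) \<le> poly pl (tree_size x)"
      using length_le_tree_size[of "l x"] pl[of x] by simp
    ultimately show ?thesis unfolding fold_eq[symmetric]
      by (intro order_trans[OF size] add_mono mult_mono pi) auto
  qed
  moreover have "poly_bounded ?b" by (intro poly_bounded_intros)
  ultimately show ?thesis unfolding fold_eq
    using l i h unfolding polytime_list_def by (intro polytime_on_fold) auto
qed

lemmas polytime_fold_tree = polytime_fold[where d = "\<lambda>t. t" and e = "\<lambda>t. t"]

lemma polytime_list_fold:
  assumes "polytime_list l" "polytime_list i"
    and "polytime_list (\<lambda>z. h (left_part z) (left_part (right_part z)) (spine (right_part (right_part z))))"
    and "\<And>x a b. tree_size (from_spine (h x a b)) \<le> tree_size (from_spine b) + poly c (tree_size x + tree_size a)"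
  shows "polytime_list (\<lambda>x. fold (h x) (l x) (i x))"
  unfolding polytime_list_def
  by (rule polytime_fold[where d = spine]) (use assms in \<open>auto simp: polytime_list_def\<close>)

lemma polytime_lists_fold:
  assumes "polytime_list l" "polytime_lists i"
    and "polytime_lists (\<lambda>z. h (left_part z) (left_part (right_part z)) (map spine (spine (right_part (right_part z)))))"
    and "\<And>x a b. tree_size (from_spine (map from_spine (h x a b))) \<le>
       tree_size (from_spine (map from_spine b)) + poly c (tree_size x + tree_size a)"
  shows "polytime_lists (\<lambda>x. fold (h x) (l x) (i x))"
  unfolding polytime_lists_def polytime_list_def
  by (rule polytime_fold[where d = "\<lambda>t. map spine (spine t)" and e = "\<lambda>t. from_spine (map from_spine t)"])
    (use assms in \<open>auto simp: polytime_lists_def polytime_list_def comp_def\<close>)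

text \<open>A fold step receives \<open>Node x (Node a b)\<close> with accumulator \<open>b\<close>;
  forgetting \<open>b\<close> leaves the pair \<open>Node x a\<close> on which predicates and
  functions with context are stated.\<close>

lemma polytime_fold_context:
  assumes "polytime f"
  shows "polytime (\<lambda>z. Node (left_part (f z)) (left_part (right_part (f z))))"
  using assms by (intro polytime_Node polytime_left_part polytime_right_part)

section \<open>Quantifiers and list functions as folds\<close>

lemma polytime_pred_Bex:
  assumes "polytime_list l" "polytime_pred (\<lambda>z. P (left_part z) (right_part z))"
  shows "polytime_pred (\<lambda>x. \<exists>a\<in>set (l x). P x a)"
proof -
  have eq: "bool_tree (\<exists>a\<in>set ts. P x a) = fold (\<lambda>a b. if P x a then Node Leaf Leaf else b) ts Leaf" for x ts
  proof -
    have "fold (\<lambda>a b. if P x a then Node Leaf Leaf else b) ts b =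
       (if \<exists>a\<in>set ts. P x a then Node Leaf Leaf else b)" for b
      by (induction ts arbitrary: b) auto
    then show ?thesis by (simp add: bool_tree_def)
  qed
  have "polytime_pred (\<lambda>z. P (left_part z) (left_part (right_part z)))"
    using polytime_pred_comp[OF assms(2) polytime_fold_context[OF polytime_id]] by simp
  then have "polytime (\<lambda>x. fold (\<lambda>a b. if P x a then Node Leaf Leaf else b) (l x) Leaf)"
    using assms(1)
    by (intro polytime_fold_tree[where c = "[:3:]"] polytime_If polytime_const
        polytime_right_part polytime_id) auto
  then show ?thesis unfolding polytime_pred_def eq .
qed

lemma polytime_pred_Ball:
  assumes "polytime_list l" "polytime_pred (\<lambda>z. P (left_part z) (right_part z))"
  shows "polytime_pred (\<lambda>x. \<forall>a\<in>set (l x). P x a)"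
  using polytime_pred_not[OF polytime_pred_Bex[OF assms(1), of "\<lambda>x a. \<not> P x a"]] assms(2)
  by (simp add: polytime_pred_not)

lemma polytime_list_rev:
  assumes "polytime_list l"
  shows "polytime_list (\<lambda>x. rev (l x))"
proof -
  \<comment> \<open>Prepending \<open>a\<close> costs one node besides \<open>a\<close>, hence the
    growth bound \<open>[:1, 1:]\<close>.\<close>
  have "polytime_list (\<lambda>x. fold (#) (l x) [])"
    by (rule polytime_list_fold[where c = "[:1, 1:]"])
      (use assms in \<open>auto intro!: polytime_list_Cons polytime_list_Nil polytime_left_part polytime_spine polytime_right_part polytime_id\<close>)
  moreover have "fold (#) ts [] = rev ts" for ts :: "tree list"
    by (simp add: fold_Cons_rev)
  ultimately show ?thesis by simp
qed

lemma polytime_list_append: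
  assumes "polytime_list l" "polytime_list l'"
  shows "polytime_list (\<lambda>x. l x @ l' x)"
proof -
  have "polytime_list (\<lambda>x. fold (#) (rev (l x)) (l' x))"
    by (rule polytime_list_fold[where c = "[:1, 1:]"])
      (use assms in \<open>auto intro!: polytime_list_rev polytime_list_Cons polytime_list_Nil polytime_left_part polytime_spine polytime_right_part polytime_id\<close>)
  then show ?thesis by (simp add: fold_Cons_rev)
qed

lemma polytime_list_filter:
  assumes "polytime_list l" "polytime_pred (\<lambda>z. P (left_part z) (right_part z))"
  shows "polytime_list (\<lambda>x. filter (P x) (l x))"
proof -
  have eq: "filter (P x) ts = rev (fold (\<lambda>a b. if P x a then a # b else b) ts [])" for x ts
  proof -
    have "fold (\<lambda>a b. if P x a then a # b else b) ts b = rev (filter (P x) ts) @ b" for b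
      by (induction ts arbitrary: b) auto
    then show ?thesis by simp
  qed
  have "polytime_pred (\<lambda>z. P (left_part z) (left_part (right_part z)))"
    using polytime_pred_comp[OF assms(2) polytime_fold_context[OF polytime_id]] by simp
  then have "polytime_list (\<lambda>x. fold (\<lambda>a b. if P x a then a # b else b) (l x) [])"
    using assms(1)
    by (intro polytime_list_fold[where c = "[:1, 1:]"] polytime_list_If polytime_list_Cons polytime_list_Nil
        polytime_spine polytime_left_part polytime_right_part polytime_id) auto
  then show ?thesis unfolding eq by (rule polytime_list_rev)
qed

lemma polytime_list_map:
  assumes "polytime_list l" "polytime (\<lambda>z. f (left_part z) (right_part z))"
  shows "polytime_list (\<lambda>x. map (f x) (l x))"
proof -
  have eq: "map (f x) ts = rev (fold (\<lambda>a b. f x a # b) ts [])" for x ts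
  proof -
    have "fold (\<lambda>a b. f x a # b) ts b = rev (map (f x) ts) @ b" for b
      by (induction ts arbitrary: b) auto
    then show ?thesis by simp
  qed
  have f: "polytime (\<lambda>z. f (left_part z) (left_part (right_part z)))"
    using polytime_comp[OF assms(2) polytime_fold_context[OF polytime_id]] by simp
  obtain p where p: "\<And>z. tree_size (f (left_part z) (right_part z)) \<le> poly p (tree_size z)"
    using polytime_size[OF assms(2)] by blast
  have "tree_size (f x a) \<le> poly (pcompose p [:1, 1:]) (tree_size x + tree_size a)" for x a
    using p[of "Node x a"] by (simp add: poly_pcompose)
  then have "polytime_list (\<lambda>x. fold (\<lambda>a b. f x a # b) (l x) [])"
    using assms(1) f
    by (intro polytime_list_fold[where c = "1 + pcompose p [:1, 1:]"] polytime_list_Cons polytime_list_Nil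
        polytime_spine polytime_right_part polytime_id) auto
  then show ?thesis unfolding eq by (rule polytime_list_rev)
qed

lemma polytime_lists_Cons:
  "polytime_list f \<Longrightarrow> polytime_lists l \<Longrightarrow> polytime_lists (\<lambda>x. f x # l x)"
  unfolding polytime_lists_def by (simp add: polytime_list_Cons polytime_from_spine)

lemma polytime_lists_tl: "polytime_lists l \<Longrightarrow> polytime_lists (\<lambda>x. tl (l x))"
  unfolding polytime_lists_def by (simp add: polytime_list_tl map_tl)

lemma polytime_lists_rev: "polytime_lists l \<Longrightarrow> polytime_lists (\<lambda>x. rev (l x))"
  unfolding polytime_lists_def by (simp add: polytime_list_rev flip: rev_map)

lemma polytime_pred_Nil_lists: "polytime_lists l \<Longrightarrow> polytime_pred (\<lambda>x. l x = [])"
  unfolding polytime_lists_def by (drule polytime_pred_Nil) simp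

lemma polytime_lists_spine: "polytime f \<Longrightarrow> polytime_lists (\<lambda>x. map spine (spine (f x)))"
  unfolding polytime_lists_def by (simp add: comp_def polytime_spine)

lemma polytime_map_from_spine: "polytime_lists l \<Longrightarrow> polytime_list (\<lambda>x. map from_spine (l x))"
  unfolding polytime_lists_def .

lemma polytime_list_concat:
  assumes "polytime_lists l"
  shows "polytime_list (\<lambda>x. concat (l x))"
proof -
  have eq: "concat ls = fold (\<lambda>a b. spine a @ b) (rev (map from_spine ls)) []" for ls
  proof -
    have "fold (\<lambda>a b. spine a @ b) (rev ts) [] = concat (map spine ts)" for ts
      by (induction ts) auto
    then show ?thesis by (simp add: comp_def)
  qed
  have "tree_size (from_spine (ts @ us)) \<le> tree_size (from_spine us) + tree_size (from_spine ts)" for ts us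
    by (induction ts) auto
  from this[of "spine a" for a]
  have size: "tree_size (from_spine (spine a @ us)) \<le> tree_size (from_spine us) + tree_size a" for a us
    by simp
  have "polytime_list (\<lambda>x. fold (\<lambda>a b. spine a @ b) (rev (map from_spine (l x))) [])"
  proof (rule polytime_list_fold[where c = "[:0, 1:]"])
    show "tree_size (from_spine (spine a @ b)) \<le> tree_size (from_spine b) + poly [:0, 1:] (tree_size x + tree_size a)"
      for x a b using size[of a b] by simp
  qed (intro assms polytime_list_rev polytime_map_from_spine polytime_list_append
        polytime_list_Nil polytime_left_part polytime_spine polytime_right_part polytime_id)+
  then show ?thesis unfolding eq .
qed

text \<open>Iterating \<open>tl\<close> along another list realises \<open>drop\<close> by its
  length, and with it the comparison of lengths, without arithmetic on numbers.\<close>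

lemma fold_tl: "fold (\<lambda>_. tl) us ts = drop (length us) ts"
  by (induction us arbitrary: ts) (auto simp: drop_Suc)

lemma polytime_list_drop:
  assumes "polytime_list l" "polytime_list l'"
  shows "polytime_list (\<lambda>x. drop (length (l x)) (l' x))"
proof -
  have "tree_size (from_spine (tl b)) \<le> tree_size (from_spine b)" for b
    by (cases b) auto
  then have "polytime_list (\<lambda>x. fold (\<lambda>_. tl) (l x) (l' x))"
    by (intro polytime_list_fold[where c = 0] assms polytime_list_tl polytime_spine polytime_right_part polytime_id) auto
  then show ?thesis unfolding fold_tl .
qed

lemma polytime_lists_drop:
  assumes "polytime_lists l" "polytime_lists l'"
  shows "polytime_lists (\<lambda>x. drop (length (l x)) (l' x))"
  using polytime_list_drop[OF assms[THEN polytime_map_from_spine]]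
  unfolding polytime_lists_def by (simp add: drop_map)

text \<open>The factor \<open>n\<close> is a constant of the program, so the multiple is formed by
  appending \<open>l'\<close> to a spare list \<open>l''\<close> that many times.\<close>

lemma polytime_pred_length_le:
  assumes "polytime_list l" "polytime_list l'"
  shows "polytime_pred (\<lambda>x. length (l x) \<le> n * length (l' x))"
proof -
  have "polytime_pred (\<lambda>x. length (l x) \<le> n * length (l' x) + length (l'' x))" if "polytime_list l''" for l''
    using that
  proof (induction n arbitrary: l'')
    case 0
    \<comment> \<open>The additional \<open>Leaf\<close> turns the strict comparison decided by
      \<open>drop\<close> into \<open>\<le>\<close>.\<close>
    have "polytime_pred (\<lambda>x. \<not> drop (length (l x)) (Leaf # l'' x) = [])"
      using assms 0 by (intro polytime_pred_not polytime_pred_Nil polytime_list_drop polytime_list_Cons polytime_const)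
    then show ?case by (simp add: not_le less_Suc_eq_le)
  next
    case (Suc n)
    have "polytime_pred (\<lambda>x. length (l x) \<le> n * length (l' x) + length (l' x @ l'' x))"
      using Suc assms by (intro Suc.IH polytime_list_append)
    then show ?case by (simp add: add_ac)
  qed
  from this[OF polytime_list_Nil] show ?thesis by simp
qed

lemma polytime_pred_length_less:
  "polytime_list l \<Longrightarrow> polytime_pred (\<lambda>x. length (l x) < n)"
proof (induction n arbitrary: l)
  case (Suc n)
  have eq: "(length (l x) < Suc n) = (l x = [] \<or> length (tl (l x)) < n)" for x
    by (cases "l x") auto
  show ?case unfolding eq
    by (intro polytime_pred_disj polytime_pred_Nil polytime_list_tl Suc)
qed (simp add: polytime_pred_const)

text \<open>On trees that do not encode a number, comparing digits is coarser than equality.\<close>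

definition digits :: "tree \<Rightarrow> bool list" where
  "digits t = map (\<lambda>d. d \<noteq> Leaf) (spine t)"

lemma digits_encode_nat: "digits (encode_nat m) = digits (encode_nat n) \<longleftrightarrow> m = n"
proof (induction m arbitrary: n rule: less_induct)
  case (less m)
  consider "m = 0" "n = 0" | "m = 0" "n > 0" | "m > 0" "n = 0" | "m > 0" "n > 0" by blast
  then show ?case
  proof cases
    case 4
    have "digits (encode_nat m) = digits (encode_nat n) \<longleftrightarrow> odd m = odd n \<and> m div 2 = n div 2"
      using less.IH[of "m div 2" "n div 2"] 4
      by (simp add: encode_nat_pos[of m] encode_nat_pos[of n] digits_def)
    also have "\<dots> \<longleftrightarrow> m = n" by presburger
    finally show ?thesis .
  qed (simp_all add: encode_nat_0 encode_nat_pos digits_def)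
qed

text \<open>The accumulator is \<open>Leaf\<close> after a mismatch, and otherwise \<open>Node u Leaf\<close>, where \<open>u\<close> holds the
  digits that remain to be read.\<close>

definition match_digit :: "tree \<Rightarrow> tree \<Rightarrow> tree" where
  "match_digit d b = (if b \<noteq> Leaf \<and> left_part b \<noteq> Leaf \<and> ((d \<noteq> Leaf) = (left_part (left_part b) \<noteq> Leaf))
     then Node (right_part (left_part b)) Leaf else Leaf)"

text \<open>The final accumulator is tested for two failures: \<open>Leaf\<close> signals a
  mismatch, and a left part other than \<open>Leaf\<close> means that digits of \<open>u\<close>
  were left unread.\<close>

lemma fold_match_digit:
  "(fold match_digit ds (Node u Leaf) \<noteq> Leaf \<and> left_part (fold match_digit ds (Node u Leaf)) = Leaf)
   \<longleftrightarrow> map (\<lambda>d. d \<noteq> Leaf) ds = digits u"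
proof (induction ds arbitrary: u)
  case Nil
  then show ?case by (cases u) (auto simp: digits_def)
next
  case (Cons d ds)
  have fold_Leaf: "fold match_digit es Leaf = Leaf" for es
    by (induction es) (auto simp: match_digit_def)
  show ?case
  proof (cases u)
    case Leaf
    have "match_digit d (Node Leaf Leaf) = Leaf" by (simp add: match_digit_def)
    then show ?thesis using Leaf fold_Leaf by (simp add: digits_def)
  next
    case (Node a v)
    have "match_digit d (Node u Leaf) = (if (d \<noteq> Leaf) = (a \<noteq> Leaf) then Node v Leaf else Leaf)"
      using Node by (simp add: match_digit_def)
    then show ?thesis using Node Cons.IH[of v] fold_Leaf by (simp add: digits_def)
  qed
qed

lemma polytime_pred_digits_eq:
  assumes "polytime f" "polytime g"
  shows "polytime_pred (\<lambda>x. digits (f x) = digits (g x))"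
proof -
  let ?F = "\<lambda>x. fold match_digit (spine (f x)) (Node (g x) Leaf)"
  have size: "tree_size (match_digit d b) \<le> tree_size b" for d b
    by (cases b; cases "left_part b") (auto simp: match_digit_def)
  have "polytime ?F"
  proof (rule polytime_fold_tree[where c = 0])
    show "polytime (\<lambda>z. match_digit (left_part (right_part z)) (right_part (right_part z)))"
      unfolding match_digit_def
      by (intro polytime_Node polytime_const polytime_If polytime_pred_conj polytime_pred_eq
          polytime_pred_not_Leaf polytime_left_part polytime_right_part polytime_id)
  qed (use size in \<open>auto intro: assms polytime_spine polytime_Node polytime_const\<close>)
  then have "polytime_pred (\<lambda>x. ?F x \<noteq> Leaf \<and> \<not> left_part (?F x) \<noteq> Leaf)"
    by (intro polytime_pred_conj polytime_pred_not_Leaf polytime_pred_not polytime_left_part)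
  then show ?thesis by (simp add: fold_match_digit flip: digits_def)
qed

section \<open>The search on abstract edges\<close>

text \<open>A state of the search consists of a partial matching \<open>M\<close> and a list \<open>Xs\<close> of layers of tree edges,
  newest first. The tree vertices in \<open>A\<close> are the root, which is the first unmatched vertex, and the
  vertices of the edges of \<open>M\<close> that meet a tree edge in \<open>B\<close>. A suffix \<open>rest\<close> of \<open>Xs\<close> stands for its
  head layer, and the suffix \<open>[]\<close> for the root. The parameter \<open>con\<close> says that two edges share a vertex
  in \<open>B\<close>.\<close>

locale matching_search =
  fixes inc :: "'a \<Rightarrow> 'e \<Rightarrow> bool" and con :: "'e \<Rightarrow> 'e \<Rightarrow> bool"
    and U m :: nat and as :: "'a list" and es :: "'e list"
begin

definition unmatched :: "'e list \<Rightarrow> 'a list" where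
  "unmatched M = filter (\<lambda>a. \<not> (\<exists>f\<in>set M. inc a f)) as"

definition reached :: "'e list \<Rightarrow> 'e list \<Rightarrow> 'a \<Rightarrow> bool" where
  "reached M X a \<longleftrightarrow> (\<exists>f\<in>set M. inc a f \<and> (\<exists>x\<in>set X. con x f))"

definition frontier :: "'e list \<Rightarrow> 'e list list \<Rightarrow> 'a list" where
  "frontier M Xs = (if Xs = [] then [hd (unmatched M)] else filter (reached M (hd Xs)) as)"

text \<open>For a suffix \<open>rest\<close> of \<open>Xs\<close> these are the edges of the layers
  newer than \<open>rest\<close>. Reversal makes the older layers a prefix, which
  \<open>drop\<close> removes; any order of the result will do.\<close>

definition above :: "'e list list \<Rightarrow> 'e list list \<Rightarrow> 'e list" where
  "above Xs rest = concat (drop (length rest) (rev Xs))"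

definition ready_edges :: "'e list \<Rightarrow> 'e list \<Rightarrow> 'a \<Rightarrow> 'e list" where
  "ready_edges M X a = filter (\<lambda>x. inc a x \<and> \<not> (\<exists>f\<in>set M. con x f)) X"

definition ready :: "'e list \<Rightarrow> 'e list list \<Rightarrow> 'e list list \<Rightarrow> 'a list" where
  "ready M Xs rest = filter (\<lambda>a. \<not> ready_edges M (above Xs rest) a = []) (frontier M rest)"

text \<open>The first conjunct excludes an empty frontier, for which the inequality is
  trivial.\<close>

definition collapsible :: "'e list \<Rightarrow> 'e list list \<Rightarrow> 'e list list \<Rightarrow> bool" where
  "collapsible M Xs rest \<longleftrightarrow> \<not> ready M Xs rest = [] \<and>
     length (frontier M rest) \<le> m * length (ready M Xs rest)"

text \<open>The second \<open>Xs\<close> is the start, the first one a mere loop counter. The search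
  passes from the longest suffix to shorter ones, stays at the first collapsible one, and has just
  enough rounds to arrive at \<open>[]\<close>. Hence the result fails to be collapsible only if
  every suffix does.\<close>

definition collapse_point :: "'e list \<Rightarrow> 'e list list \<Rightarrow> 'e list list" where
  "collapse_point M Xs = fold (\<lambda>_ rest. if collapsible M Xs rest then rest else tl rest) Xs Xs"

definition swap :: "'e list \<Rightarrow> 'e list list \<Rightarrow> 'e list list \<Rightarrow> 'e list" where
  "swap M Xs rest = filter (\<lambda>f. \<not> (\<exists>a\<in>set (ready M Xs rest). inc a f)) M @
     map (\<lambda>a. hd (ready_edges M (above Xs rest) a)) (ready M Xs rest)"

text \<open>The last two conjuncts together say that \<open>e\<close> avoids in \<open>B\<close>
  both the tree edges and their blockers.\<close>

definition addable :: "'e list \<Rightarrow> 'e list \<Rightarrow> 'e list \<Rightarrow> 'e \<Rightarrow> bool" where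
  "addable M X L e \<longleftrightarrow>
     (inc (hd (unmatched M)) e \<or> (\<exists>a\<in>set as. inc a e \<and> reached M X a)) \<and>
     length (filter (\<lambda>x. \<exists>a\<in>set as. inc a e \<and> inc a x) (L @ X)) < U \<and>
     (\<forall>x\<in>set (L @ X). \<not> con e x) \<and>
     (\<forall>f\<in>set M. con e f \<longrightarrow> \<not> (\<exists>x\<in>set (L @ X). con x f))"

definition new_layer :: "'e list \<Rightarrow> 'e list \<Rightarrow> 'e list" where
  "new_layer M X = fold (\<lambda>e L. if addable M X L e then e # L else L) es []"

definition step_matching :: "'e list \<Rightarrow> 'e list list \<Rightarrow> 'e list" where
  "step_matching M Xs = (if \<not> unmatched M = [] \<and> collapsible M Xs (collapse_point M Xs)
     then swap M Xs (collapse_point M Xs) else M)"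

definition step_layers :: "'e list \<Rightarrow> 'e list list \<Rightarrow> 'e list list" where
  "step_layers M Xs = (if unmatched M = [] then Xs
     else if collapsible M Xs (collapse_point M Xs) then collapse_point M Xs
     else new_layer M (concat Xs) # Xs)"

text \<open>Once all vertices are matched a step changes nothing, so the loop may run for a fixed
  number of rounds without testing for success.\<close>

definition step :: "'e list \<times> 'e list list \<Rightarrow> 'e list \<times> 'e list list" where
  "step = (\<lambda>(M, Xs). (step_matching M Xs, step_layers M Xs))"

lemma collapse_point_suffix:
  "\<exists>hs. Xs = hs @ collapse_point M Xs"
  and collapse_point_complete:
  "\<not> collapsible M Xs (collapse_point M Xs) \<Longrightarrow> Xs = hs @ rest \<Longrightarrow> \<not> collapsible M Xs rest"
proof -
  let ?s = "\<lambda>_ rest. if collapsible M Xs rest then rest else tl rest"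
  have fix_point: "fold ?s ys rs = rs" if "collapsible M Xs rs" for ys rs :: "'e list list"
    using that by (induction ys) auto
  have suffix: "\<exists>hs. rs = hs @ fold ?s ys rs" for ys rs :: "'e list list"
  proof (induction ys arbitrary: rs)
    case (Cons y ys)
    show ?case
    proof (cases "collapsible M Xs rs \<or> rs = []")
      case True
      then show ?thesis using fix_point[of rs] Cons.IH[of rs] by (cases "rs = []") auto
    next
      case False
      obtain hs where "tl rs = hs @ fold ?s ys (tl rs)" using Cons.IH by blast
      then have "rs = (hd rs # hs) @ fold ?s (y # ys) rs" using False by (cases rs) auto
      then show ?thesis by blast
    qed
  qed simp
  have complete: "\<not> collapsible M Xs rest"
    if "length ys = length rs" "\<not> collapsible M Xs (fold ?s ys rs)" "rs = hs @ rest"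
    for ys rs hs rest :: "'e list list"
    using that
  proof (induction ys arbitrary: rs hs)
    case (Cons y ys)
    have nc: "\<not> collapsible M Xs rs"
    proof
      assume c: "collapsible M Xs rs"
      show False using Cons.prems(2) c unfolding fix_point[OF c] by contradiction
    qed
    have "fold ?s (y # ys) rs = fold ?s ys (tl rs)" using nc by simp
    then have nc': "\<not> collapsible M Xs (fold ?s ys (tl rs))" using Cons.prems(2) by (simp only: not_False_eq_True)
    show ?case
    proof (cases hs)
      case Nil
      then show ?thesis using nc Cons.prems(3) by simp
    next
      case hs: (Cons h hs')
      have "length ys = length (tl rs)" "tl rs = hs' @ rest" using hs Cons.prems(1,3) by auto
      then show ?thesis using Cons.IH nc' by blast
    qed
  qed auto
  show "\<exists>hs. Xs = hs @ collapse_point M Xs"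
    unfolding collapse_point_def by (rule suffix)
  show "\<not> collapsible M Xs (collapse_point M Xs) \<Longrightarrow> Xs = hs @ rest \<Longrightarrow> \<not> collapsible M Xs rest"
    unfolding collapse_point_def by (rule complete[OF refl])
qed

lemma above_append: "set (above (hs @ rest) rest) = set (concat hs)"
  by (simp add: above_def)

end

text \<open>\<open>U\<close> makes saturated tree vertices so rare that they consume at most half of
  the surplus \<open>\<epsilon>\<close>; \<open>\<beta>\<close> is the growth ratio guaranteed for a
  maximal layer. If no suffix is collapsible, \<open>m\<close> keeps the unblocked edges of a layer
  below \<open>\<beta> / 4\<close> of the older tree, and \<open>\<gamma>\<close> is what then
  remains of \<open>\<beta> / 2\<close>. A collapse shrinks a tree by the factor
  \<open>1 + \<gamma> / (2 * m)\<close>, which \<open>p\<close> turns into a factor 3 in weight.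
  Stating \<open>haxell\<close> for arbitrary hitting sets \<open>T\<close> keeps the minimum in
  \<open>hitting_number\<close> out of the argument.\<close>

locale hypergraph_search = matching_search inc con U m as es
  for inc :: "'a \<Rightarrow> 'e \<Rightarrow> bool" and con :: "'e \<Rightarrow> 'e \<Rightarrow> bool"
    and U m :: nat and as :: "'a list" and es :: "'e list" +
  fixes av :: "'e \<Rightarrow> 'a" and bv :: "'e \<Rightarrow> 'v set" and r p :: nat and \<epsilon> \<beta> \<gamma> :: real
  assumes distinct_as: "distinct as" and distinct_es: "distinct es"
    and av_mem: "e \<in> set es \<Longrightarrow> av e \<in> set as"
    and finite_bv: "e \<in> set es \<Longrightarrow> finite (bv e)"
    and card_bv: "e \<in> set es \<Longrightarrow> card (bv e) = r - 1"
    and inc_iff: "a \<in> set as \<Longrightarrow> e \<in> set es \<Longrightarrow> inc a e \<longleftrightarrow> av e = a"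
    and con_iff: "e \<in> set es \<Longrightarrow> f \<in> set es \<Longrightarrow> con e f \<longleftrightarrow> bv e \<inter> bv f \<noteq> {}"
    and r: "2 \<le> r" and eps: "0 < \<epsilon>" "\<epsilon> \<le> 1"
    and haxell: "S \<subseteq> set as \<Longrightarrow> finite T \<Longrightarrow> (\<And>e. e \<in> set es \<Longrightarrow> av e \<in> S \<Longrightarrow> T \<inter> bv e \<noteq> {})
      \<Longrightarrow> (2 * real r - 3 + \<epsilon>) * (real (card S) - 1) < real (card T)"
    and U: "2 * (2 * real r - 3 + \<epsilon>) \<le> \<epsilon> * real U"
    and beta: "\<beta> = \<epsilon> / (8 * (real r)\<^sup>2)" and gamma: "\<gamma> = \<beta> / 4"
    and m: "2 \<le> m" "4 * real U \<le> \<beta> * real m"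
    and p: "3 \<le> (1 + \<gamma> / (2 * real m)) ^ p"
begin

section \<open>Trees, blockers and the invariant\<close>

definition root :: "'e list \<Rightarrow> 'a" where
  "root M = hd (unmatched M)"

definition blockers :: "'e list \<Rightarrow> 'e list \<Rightarrow> 'e set" where
  "blockers M X = {f \<in> set M. \<exists>x\<in>set X. bv x \<inter> bv f \<noteq> {}}"

definition tree_verts :: "'e list \<Rightarrow> 'e list list \<Rightarrow> 'a set" where
  "tree_verts M Xs = insert (root M) (av ` blockers M (concat Xs))"

definition tree_card :: "'e list \<Rightarrow> 'e list list \<Rightarrow> nat" where
  "tree_card M Xs = card (tree_verts M Xs)"

definition unblocked :: "'e list \<Rightarrow> 'e \<Rightarrow> bool" where
  "unblocked M x \<longleftrightarrow> (\<forall>f\<in>set M. bv x \<inter> bv f = {})"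

definition matching :: "'e list \<Rightarrow> bool" where
  "matching M \<longleftrightarrow> distinct M \<and> set M \<subseteq> set es \<and> inj_on av (set M) \<and>
     (\<forall>f\<in>set M. \<forall>g\<in>set M. f \<noteq> g \<longrightarrow> bv f \<inter> bv g = {})"

text \<open>By the fourth clause a matching edge blocks at most one tree edge, so blockers can be
  counted edge by edge and layer by layer. All clauses pass to sublists.\<close>

definition clean :: "'e list \<Rightarrow> 'e list \<Rightarrow> bool" where
  "clean M X \<longleftrightarrow> distinct X \<and> set X \<subseteq> set es \<and>
     (\<forall>x\<in>set X. \<forall>y\<in>set X. x \<noteq> y \<longrightarrow> bv x \<inter> bv y = {}) \<and>
     (\<forall>f\<in>set M. \<forall>x\<in>set X. \<forall>y\<in>set X. bv x \<inter> bv f \<noteq> {} \<longrightarrow> bv y \<inter> bv f \<noteq> {} \<longrightarrow> x = y) \<and>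
     (\<forall>a. card {x \<in> set X. av x = a} \<le> U)"

primrec layered :: "'e list \<Rightarrow> 'e list list \<Rightarrow> bool" where
  "layered M [] \<longleftrightarrow> True"
| "layered M (X # Xs) \<longleftrightarrow> layered M Xs \<and>
     av ` set X \<subseteq> tree_verts M Xs \<and> \<beta> / 2 * tree_card M Xs \<le> length X"

primrec grown :: "'e list \<Rightarrow> 'e list list \<Rightarrow> bool" where
  "grown M [] \<longleftrightarrow> True"
| "grown M (X # Xs) \<longleftrightarrow> grown M Xs \<and> \<gamma> * tree_card M Xs \<le> card (blockers M X)"

text \<open>The top layer may have lost too many of its blockers; the others are still large.\<close>

definition valid_state :: "'e list \<Rightarrow> 'e list list \<Rightarrow> bool" where
  "valid_state M Xs \<longleftrightarrow> matching M \<and> (unmatched M = [] \<longrightarrow> Xs = []) \<and>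
     clean M (concat Xs) \<and> layered M Xs \<and> grown M (tl Xs)"

lemma beta_pos: "0 < \<beta>" and beta_le: "\<beta> \<le> 1" and gamma_pos: "0 < \<gamma>" and gamma_le: "\<gamma> \<le> 1"
proof -
  show "0 < \<beta>" using eps r by (simp add: beta)
  then show "0 < \<gamma>" by (simp add: gamma)
  have "(1::real) \<le> (real r)\<^sup>2" using r by (simp add: self_le_power)
  then show "\<beta> \<le> 1" using eps unfolding beta by (simp add: divide_le_eq)
  then show "\<gamma> \<le> 1" using \<open>0 < \<beta>\<close> by (simp add: gamma)
qed

lemma bv_nonempty: "e \<in> set es \<Longrightarrow> bv e \<noteq> {}"
  using card_bv[of e] r by auto

lemma matching_mem: "matching M \<Longrightarrow> f \<in> set M \<Longrightarrow> f \<in> set es"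
  unfolding matching_def by blast

lemma inc_iff_matching:
  "matching M \<Longrightarrow> a \<in> set as \<Longrightarrow> (\<exists>f\<in>set M. inc a f) \<longleftrightarrow> a \<in> av ` set M"
  using inc_iff matching_mem by (auto simp: image_iff)

lemma set_unmatched: "matching M \<Longrightarrow> set (unmatched M) = set as - av ` set M"
  using inc_iff_matching by (auto simp: unmatched_def)

lemma root_mem:
  "matching M \<Longrightarrow> unmatched M \<noteq> [] \<Longrightarrow> root M \<in> set as \<and> root M \<notin> av ` set M"
  using set_unmatched hd_in_set unfolding root_def by blast

lemma blockers_subset: "blockers M X \<subseteq> set M"
  unfolding blockers_def by blast

lemma finite_blockers [simp]: "finite (blockers M X)"
  using finite_subset[OF blockers_subset] by blast

lemma blockers_append: "blockers M (X @ X') = blockers M X \<union> blockers M X'"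
  unfolding blockers_def by auto

lemma clean_append: "clean M (X @ X') \<Longrightarrow> clean M X \<and> clean M X'"
proof -
  assume c: "clean M (X @ X')"
  have "card {x \<in> set Z. av x = a} \<le> U" if "set Z \<subseteq> set (X @ X')" for a Z
  proof -
    have "card {x \<in> set Z. av x = a} \<le> card {x \<in> set (X @ X'). av x = a}"
      by (rule card_mono) (use that in auto)
    then show ?thesis using c unfolding clean_def by (meson order_trans)
  qed
  then show ?thesis using c unfolding clean_def by auto
qed

text \<open>A common blocker would block an edge of \<open>X\<close> and one of \<open>X'\<close>.
  Cleanness makes these equal, against the distinctness of \<open>X @ X'\<close>.\<close>

lemma blockers_disjoint:
  "clean M (X @ X') \<Longrightarrow> blockers M X \<inter> blockers M X' = {}"
proof (rule ccontr)
  assume c: "clean M (X @ X')" and "blockers M X \<inter> blockers M X' \<noteq> {}"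
  then obtain f x y where "f \<in> set M" "x \<in> set X" "y \<in> set X'" "bv x \<inter> bv f \<noteq> {}" "bv y \<inter> bv f \<noteq> {}"
    unfolding blockers_def by blast
  moreover from this have "x = y" using c unfolding clean_def by auto
  ultimately show False using c unfolding clean_def by auto
qed

lemma clean_mem: "clean M X \<Longrightarrow> x \<in> set X \<Longrightarrow> x \<in> set es"
  unfolding clean_def by blast

lemma reached_iff:
  assumes "matching M" "clean M X" "a \<in> set as"
  shows "reached M X a \<longleftrightarrow> a \<in> av ` blockers M X"
proof -
  have "inc a f \<and> (\<exists>x\<in>set X. con x f) \<longleftrightarrow> av f = a \<and> (\<exists>x\<in>set X. bv x \<inter> bv f \<noteq> {})"
    if "f \<in> set M" for f
    using inc_iff[OF assms(3) matching_mem[OF assms(1) that]]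
      con_iff[OF clean_mem[OF assms(2)] matching_mem[OF assms(1) that]] by blast
  then show ?thesis unfolding reached_def blockers_def by blast
qed

lemma av_blockers_subset: "matching M \<Longrightarrow> av ` blockers M X \<subseteq> set as"
  using av_mem matching_mem blockers_subset by blast

lemma card_av_blockers: "matching M \<Longrightarrow> card (av ` blockers M X) = card (blockers M X)"
  using card_image inj_on_subset[OF _ blockers_subset] unfolding matching_def by blast

lemma set_frontier:
  assumes "matching M" "clean M (concat (X # Xs))"
  shows "set (frontier M (X # Xs)) = av ` blockers M X"
  using reached_iff[OF assms(1), of X] clean_append[of M X "concat Xs"] assms av_blockers_subset[of M X]
  by (auto simp: frontier_def)

lemma frontier_Nil: "frontier M [] = [root M]"
  by (simp add: frontier_def root_def)

lemma length_frontier: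
  assumes "matching M" "clean M (concat (X # Xs))"
  shows "length (frontier M (X # Xs)) = card (blockers M X)"
proof -
  have "distinct (frontier M (X # Xs))" using distinct_as by (simp add: frontier_def)
  then show ?thesis
    using set_frontier[OF assms] distinct_card card_av_blockers[OF assms(1), of X] by metis
qed

lemma tree_verts_Cons: "tree_verts M (X # Xs) = av ` blockers M X \<union> tree_verts M Xs"
  by (auto simp: tree_verts_def blockers_append image_Un)

lemma finite_tree_verts [simp]: "finite (tree_verts M Xs)"
  by (simp add: tree_verts_def)

lemma tree_verts_Nil: "tree_verts M [] = {root M}"
  by (simp add: tree_verts_def blockers_def)

text \<open>The \<open>Suc\<close> is the root: being unmatched, it is not the vertex of a blocker.
  The blockers have different vertices because \<open>av\<close> is injective on a matching.\<close>

lemma tree_card_eq: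
  assumes "matching M" "unmatched M \<noteq> []"
  shows "tree_card M Xs = Suc (card (blockers M (concat Xs)))"
proof -
  have "root M \<notin> av ` blockers M (concat Xs)"
    using root_mem[OF assms] blockers_subset by blast
  then show ?thesis
    using card_av_blockers[OF assms(1)] by (simp add: tree_card_def tree_verts_def)
qed

lemma tree_card_Cons:
  assumes "matching M" "unmatched M \<noteq> []" "clean M (concat (X # Xs))"
  shows "tree_card M (X # Xs) = card (blockers M X) + tree_card M Xs"
  using assms tree_card_eq[OF assms(1,2)] blockers_disjoint[of M X "concat Xs"]
  by (simp add: blockers_append card_Un_disjoint)

text \<open>This also holds when every vertex is matched and \<open>root M\<close> is the
  unspecified \<open>hd []\<close>, so the potential of a finished state is still 1.\<close>

lemma tree_card_Nil: "tree_card M [] = 1"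
  by (simp add: tree_card_def tree_verts_Nil)

lemma tree_card_pos: "1 \<le> tree_card M Xs"
proof -
  have "tree_card M Xs \<noteq> 0" by (simp add: tree_card_def tree_verts_def)
  then show ?thesis by simp
qed

lemma tree_verts_subset:
  assumes "matching M" "unmatched M \<noteq> []"
  shows "tree_verts M Xs \<subseteq> set as"
  using root_mem[OF assms] av_blockers_subset[OF assms(1)] by (simp add: tree_verts_def)

lemma tree_card_le:
  assumes "matching M" "unmatched M \<noteq> []"
  shows "tree_card M Xs \<le> length as"
  unfolding tree_card_def using card_mono[OF finite_set tree_verts_subset[OF assms]] card_length order_trans by blast

section \<open>Ready vertices and unblocked tree edges\<close>

lemma set_ready:
  assumes "matching M" "unmatched M \<noteq> []" "clean M (concat Xs)" "Xs = hs @ rest"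
  shows "set (ready M Xs rest) =
    {a \<in> set (frontier M rest). \<exists>x\<in>set (concat hs). av x = a \<and> unblocked M x}"
proof -
  have fr: "set (frontier M rest) \<subseteq> set as"
    using root_mem[OF assms(1,2)] by (auto simp: frontier_def root_def)
  have "ready_edges M (above Xs rest) a \<noteq> [] \<longleftrightarrow> (\<exists>x\<in>set (concat hs). av x = a \<and> unblocked M x)"
    if "a \<in> set (frontier M rest)" for a
  proof -
    have *: "x \<in> set es" if "x \<in> set (concat hs)" for x
      using clean_mem[OF assms(3)] assms(4) that by auto
    have "ready_edges M (above Xs rest) a \<noteq> [] \<longleftrightarrow>
        (\<exists>x\<in>set (concat hs). inc a x \<and> \<not> (\<exists>f\<in>set M. con x f))"
      unfolding ready_edges_def filter_empty_conv assms(4) above_append by blast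
    also have "\<dots> \<longleftrightarrow> (\<exists>x\<in>set (concat hs). av x = a \<and> unblocked M x)"
      using * inc_iff con_iff matching_mem[OF assms(1)] fr that unfolding unblocked_def by blast
    finally show ?thesis .
  qed
  then show ?thesis by (auto simp: ready_def)
qed

lemma distinct_frontier: "distinct (frontier M rest)"
  using distinct_as by (simp add: frontier_def)

lemma distinct_ready: "distinct (ready M Xs rest)"
  using distinct_frontier by (simp add: ready_def)

primrec all_ready :: "'e list \<Rightarrow> 'e list list \<Rightarrow> 'e list list \<Rightarrow> 'a list" where
  "all_ready M Xs [] = ready M Xs []"
| "all_ready M Xs (X # rest) = ready M Xs (X # rest) @ all_ready M Xs rest"

lemma all_ready_append: "set (all_ready M Xs rest) \<subseteq> set (all_ready M Xs (hs @ rest))"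
  by (induction hs) auto

text \<open>In each suffix that is not collapsible the ready vertices are at most a fraction
  \<open>1 / m\<close> of the frontier, and the frontiers partition the tree vertices. Strictness
  comes from the root: it counts in \<open>tree_card\<close>, but if it were ready, the suffix
  \<open>[]\<close> would be collapsible.\<close>

lemma length_all_ready:
  assumes "matching M" "unmatched M \<noteq> []" "clean M (concat Xs)"
    and "\<And>hs rest. Xs = hs @ rest \<Longrightarrow> \<not> collapsible M Xs rest"
  shows "Xs = hs @ rest \<Longrightarrow> m * length (all_ready M Xs rest) < tree_card M rest"
proof (induction rest arbitrary: hs)
  case Nil
  have "\<not> collapsible M Xs []" using assms(4)[of Xs "[]"] by simp
  moreover have "1 \<le> m * length (ready M Xs [])" if "ready M Xs [] \<noteq> []"
    using that m(1) by (simp add: Suc_le_eq)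
  ultimately have "ready M Xs [] = []" unfolding collapsible_def frontier_Nil by auto
  then show ?case by (simp add: tree_card_Nil)
next
  case (Cons X rest)
  have c: "clean M (concat (X # rest))"
    using assms(3) Cons.prems clean_append[of M "concat hs" "concat (X # rest)"] by simp
  have "m * length (ready M Xs (X # rest)) \<le> card (blockers M X)"
    using assms(4)[OF Cons.prems] length_frontier[OF assms(1) c] unfolding collapsible_def
    by (cases "ready M Xs (X # rest) = []") auto
  moreover have "m * length (all_ready M Xs rest) < tree_card M rest"
    using Cons.IH[of "hs @ [X]"] Cons.prems by simp
  ultimately show ?case
    using tree_card_Cons[OF assms(1,2) c] by (simp add: algebra_simps)
qed

text \<open>The vertex of \<open>x\<close> entered the tree either as the root or through a blocker
  of some layer in \<open>rest\<close>. Seen from the suffix that starts with this layer,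
  \<open>x\<close> lies above, so its vertex is ready there.\<close>

lemma unblocked_mem_all_ready:
  assumes "matching M" "unmatched M \<noteq> []" "clean M (concat Xs)"
  shows "Xs = hs @ rest \<Longrightarrow> x \<in> set (concat hs) \<Longrightarrow> unblocked M x \<Longrightarrow> av x \<in> tree_verts M rest
    \<Longrightarrow> av x \<in> set (all_ready M Xs rest)"
proof (induction rest arbitrary: hs)
  case Nil
  then show ?case using set_ready[OF assms Nil.prems(1)]
    by (auto simp: frontier_Nil tree_verts_Nil)
next
  case (Cons X rest)
  have c: "clean M (concat (X # rest))"
    using assms(3) Cons.prems clean_append[of M "concat hs" "concat (X # rest)"] by simp
  show ?case
  proof (cases "av x \<in> av ` blockers M X")
    case True
    then have "av x \<in> set (ready M Xs (X # rest))"
      using set_ready[OF assms Cons.prems(1)] set_frontier[OF assms(1) c] Cons.prems by blast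
    then show ?thesis by simp
  next
    case False
    then have "av x \<in> tree_verts M rest" using Cons.prems(4) by (simp add: tree_verts_Cons)
    then have "av x \<in> set (all_ready M Xs rest)"
      using Cons.IH[of "hs @ [X]"] Cons.prems by simp
    then show ?thesis by simp
  qed
qed

lemma card_degree_bound:
  assumes "clean M X" "Z \<subseteq> set X" "av ` Z \<subseteq> set bs"
  shows "card Z \<le> U * length bs"
proof -
  have "card Z \<le> card (\<Union>a\<in>set bs. {x \<in> set X. av x = a})"
    by (rule card_mono) (use assms in auto)
  also have "\<dots> \<le> (\<Sum>a\<in>set bs. card {x \<in> set X. av x = a})"
    by (rule card_UN_le) simp
  also have "\<dots> \<le> (\<Sum>a\<in>set bs. U)"
    by (rule sum_mono) (use assms(1) in \<open>simp add: clean_def\<close>)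
  also have "\<dots> \<le> U * length bs"
    using card_length[of bs] by (simp add: mult.commute)
  finally show ?thesis .
qed

lemma layered_suffix: "layered M (hs @ rest) \<Longrightarrow> layered M rest"
  by (induction hs) auto

lemma grown_suffix: "grown M (hs @ rest) \<Longrightarrow> grown M rest"
  by (induction hs) auto

lemma layeredD:
  assumes "layered M (hs @ X # rest)"
  shows "av ` set X \<subseteq> tree_verts M rest" "\<beta> / 2 * tree_card M rest \<le> length X"
  using layered_suffix[OF assms] by auto

lemma grownI:
  assumes "\<And>hs X rest. Xs = hs @ X # rest \<Longrightarrow> \<gamma> * tree_card M rest \<le> card (blockers M X)"
  shows "grown M Xs"
  using assms
proof (induction Xs)
  case (Cons X Xs)
  have "grown M Xs" by (rule Cons.IH) (use Cons.prems[of "X # hs" for hs] in simp)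
  then show ?case using Cons.prems[of "[]" X Xs] by simp
qed simp

lemma distinct_if_clean: "clean M X \<Longrightarrow> distinct X"
  unfolding clean_def by (rule conjunct1)

text \<open>Unblocked edges of \<open>X\<close> hang at ready vertices. There are fewer than
  \<open>tree_card M rest / m\<close> of these, each with at most \<open>U\<close> tree edges, and
  \<open>4 * U \<le> \<beta> * m\<close>.\<close>

lemma card_unblocked_layer:
  assumes "matching M" "unmatched M \<noteq> []" "clean M (concat Xs)" "layered M Xs"
    and nc: "\<And>hs rest. Xs = hs @ rest \<Longrightarrow> \<not> collapsible M Xs rest"
    and Xs: "Xs = hs @ X # rest"
  shows "4 * card {x \<in> set X. unblocked M x} \<le> \<beta> * tree_card M rest"
proof -
  let ?Q = "{x \<in> set X. unblocked M x}"
  have "av ` ?Q \<subseteq> set (all_ready M Xs rest)"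
  proof
    fix a assume "a \<in> av ` ?Q"
    then obtain x where x: "a = av x" "x \<in> set X" "unblocked M x" by blast
    then have "av x \<in> tree_verts M rest" using layeredD(1) assms(4) unfolding Xs by blast
    then show "a \<in> set (all_ready M Xs rest)"
      using unblocked_mem_all_ready[OF assms(1-3), of "hs @ [X]" rest x] x Xs by simp
  qed
  then have "card ?Q \<le> U * length (all_ready M Xs rest)"
    by (intro card_degree_bound[OF assms(3)]) (auto simp: Xs)
  then have "m * card ?Q \<le> U * (m * length (all_ready M Xs rest))"
    by (metis mult.left_commute mult_le_mono2)
  also have "\<dots> \<le> U * tree_card M rest"
  proof -
    have "m * length (all_ready M Xs rest) < tree_card M rest"
      by (rule length_all_ready[where hs = "hs @ [X]", OF assms(1-3) nc]) (simp_all add: Xs)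
    then show ?thesis by simp
  qed
  finally have "real m * real (card ?Q) \<le> real U * real (tree_card M rest)"
    using of_nat_mono by (metis of_nat_mult)
  then have "real m * (4 * real (card ?Q)) \<le> (4 * real U) * real (tree_card M rest)"
    by simp
  also have "\<dots> \<le> \<beta> * real m * real (tree_card M rest)"
    by (intro mult_right_mono m) simp
  finally have "real m * (4 * real (card ?Q)) \<le> real m * (\<beta> * real (tree_card M rest))"
    by (simp add: mult.commute mult.left_commute)
  then show ?thesis using m(1) by (simp add: mult_le_cancel_left)
qed

text \<open>In a clean list different blocked edges have different blockers, so choosing one blocker
  for each is injective.\<close>

lemma card_blocked_le:
  assumes "clean M X"
  shows "card {x \<in> set X. \<not> unblocked M x} \<le> card (blockers M X)"
proof -
  have "card {x \<in> set X. \<not> unblocked M x} \<le> card (\<Union>f\<in>blockers M X. {x \<in> set X. bv x \<inter> bv f \<noteq> {}})"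
    by (rule card_mono) (auto simp: unblocked_def blockers_def)
  also have "\<dots> \<le> (\<Sum>f\<in>blockers M X. card {x \<in> set X. bv x \<inter> bv f \<noteq> {}})"
    by (rule card_UN_le) simp
  also have "\<dots> \<le> (\<Sum>f\<in>blockers M X. 1)"
  proof (rule sum_mono)
    fix f assume f: "f \<in> blockers M X"
    have "{x \<in> set X. bv x \<inter> bv f \<noteq> {}} \<subseteq> {x}" if "x \<in> set X" "bv x \<inter> bv f \<noteq> {}" for x
      using assms f that unfolding clean_def blockers_def by blast
    then obtain x where "{x \<in> set X. bv x \<inter> bv f \<noteq> {}} \<subseteq> {x}" by blast
    then show "card {x \<in> set X. bv x \<inter> bv f \<noteq> {}} \<le> 1"
      using card_mono[of "{x}"] by fastforce
  qed
  finally show ?thesis by simp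
qed

lemma card_filter_split: "card {x \<in> set X. P x} + card {x \<in> set X. \<not> P x} = card (set X)"
proof -
  have "card (set X) = card ({x \<in> set X. P x} \<union> {x \<in> set X. \<not> P x})"
    by (rule arg_cong[of _ _ card]) auto
  then show ?thesis by (simp add: card_Un_disjoint disjoint_iff)
qed

text \<open>Of the share \<open>\<beta> / 2\<close> that the layer had from the start, at most
  \<open>\<beta> / 4\<close> is unblocked; every other edge has a blocker of its own. The difference
  is \<open>\<gamma>\<close>.\<close>

lemma grown_if_not_collapsible:
  assumes "matching M" "unmatched M \<noteq> []" "clean M (concat Xs)" "layered M Xs"
    and nc: "\<And>hs rest. Xs = hs @ rest \<Longrightarrow> \<not> collapsible M Xs rest"
  shows "grown M Xs"
proof (rule grownI)
  fix hs X rest assume Xs: "Xs = hs @ X # rest"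
  have c: "clean M X"
    using assms(3) Xs clean_append[of M "concat hs" "X @ concat rest"] clean_append[of M X "concat rest"] by simp
  have "real (card (set X)) = card {x \<in> set X. unblocked M x} + card {x \<in> set X. \<not> unblocked M x}"
    using card_filter_split[of X "unblocked M"] by simp
  moreover have "card (set X) = length X" using distinct_card[OF distinct_if_clean[OF c]] .
  moreover have "\<beta> / 2 * tree_card M rest \<le> length X"
    using layeredD(2) assms(4) unfolding Xs by blast
  moreover have "real (card {x \<in> set X. \<not> unblocked M x}) \<le> card (blockers M X)"
    using card_blocked_le[OF c] by simp
  moreover have "4 * card {x \<in> set X. unblocked M x} \<le> \<beta> * tree_card M rest"
    by (rule card_unblocked_layer[OF assms(1-4) nc Xs])
  ultimately show "\<gamma> * tree_card M rest \<le> card (blockers M X)"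
    unfolding gamma by simp
qed

section \<open>The greedy layer and its maximality\<close>

lemma addable_iff:
  assumes M: "matching M" "unmatched M \<noteq> []" and c: "clean M (L @ concat Xs)" and e: "e \<in> set es"
  shows "addable M (concat Xs) L e \<longleftrightarrow>
    av e \<in> tree_verts M Xs \<and> card {x \<in> set (L @ concat Xs). av x = av e} < U \<and>
    (\<forall>x\<in>set (L @ concat Xs). bv e \<inter> bv x = {}) \<and>
    (\<forall>f\<in>blockers M (L @ concat Xs). bv e \<inter> bv f = {})"
proof -
  let ?Z = "L @ concat Xs"
  have cX: "clean M (concat Xs)" using clean_append[OF c] by blast
  have "(inc (hd (unmatched M)) e \<or> (\<exists>a\<in>set as. inc a e \<and> reached M (concat Xs) a)) \<longleftrightarrow>
      av e \<in> tree_verts M Xs"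
    using inc_iff[OF _ e] root_mem[OF M] reached_iff[OF M(1) cX] av_mem[OF e]
    unfolding tree_verts_def root_def by auto
  moreover have "length (filter (\<lambda>x. \<exists>a\<in>set as. inc a e \<and> inc a x) ?Z) = card {x \<in> set ?Z. av x = av e}"
  proof -
    have "(\<exists>a\<in>set as. inc a e \<and> inc a x) \<longleftrightarrow> av x = av e" if "x \<in> set ?Z" for x
      using inc_iff e clean_mem[OF c that] av_mem[OF e] by auto
    then have "filter (\<lambda>x. \<exists>a\<in>set as. inc a e \<and> inc a x) ?Z = filter (\<lambda>x. av x = av e) ?Z"
      by (rule filter_cong[OF refl])
    moreover have "distinct (filter (\<lambda>x. av x = av e) ?Z)"
      using distinct_if_clean[OF c] by (rule distinct_filter)
    ultimately show ?thesis using distinct_card by (metis set_filter)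
  qed
  moreover have "(\<forall>x\<in>set ?Z. \<not> con e x) \<longleftrightarrow> (\<forall>x\<in>set ?Z. bv e \<inter> bv x = {})"
    using con_iff[OF e clean_mem[OF c]] by blast
  moreover have "(\<forall>f\<in>set M. con e f \<longrightarrow> \<not> (\<exists>x\<in>set ?Z. con x f)) \<longleftrightarrow>
      (\<forall>f\<in>blockers M ?Z. bv e \<inter> bv f = {})"
  proof -
    have "(con e f \<longrightarrow> \<not> (\<exists>x\<in>set ?Z. con x f)) \<longleftrightarrow> (f \<in> blockers M ?Z \<longrightarrow> bv e \<inter> bv f = {})"
      if "f \<in> set M" for f
    proof -
      have f: "f \<in> set es" using matching_mem[OF M(1) that] .
      have "(\<exists>x\<in>set ?Z. con x f) \<longleftrightarrow> f \<in> blockers M ?Z"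
        using con_iff[OF clean_mem[OF c] f] that unfolding blockers_def by blast
      then show ?thesis using con_iff[OF e f] by blast
    qed
    then show ?thesis using blockers_subset by blast
  qed
  ultimately show ?thesis unfolding addable_def by presburger
qed

lemma clean_Cons:
  assumes c: "clean M X" and e: "e \<in> set es" "card {x \<in> set X. av x = av e} < U"
    and dx: "\<And>x. x \<in> set X \<Longrightarrow> bv e \<inter> bv x = {}"
    and df: "\<And>f. f \<in> blockers M X \<Longrightarrow> bv e \<inter> bv f = {}"
  shows "clean M (e # X)"
proof -
  have "e \<notin> set X" using dx[of e] bv_nonempty[OF e(1)] by blast
  have deg: "card {x \<in> set (e # X). av x = a} \<le> U" for a
  proof (cases "a = av e")
    case True
    then have "{x \<in> set (e # X). av x = a} = insert e {x \<in> set X. av x = av e}" by auto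
    then show ?thesis using e(2) \<open>e \<notin> set X\<close> by simp
  next
    case False
    then have "{x \<in> set (e # X). av x = a} = {x \<in> set X. av x = a}" by auto
    then show ?thesis using c unfolding clean_def by simp
  qed
  have dis: "bv x \<inter> bv y = {}" if "x \<in> set (e # X)" "y \<in> set (e # X)" "x \<noteq> y" for x y
  proof -
    have "bv x \<inter> bv y = {}" if "x \<in> set X" "y \<in> set X" using c that \<open>x \<noteq> y\<close> unfolding clean_def by blast
    moreover have "bv x \<inter> bv e = {}" if "x \<in> set X" for x using dx[OF that] by blast
    ultimately show ?thesis using that dx by auto
  qed
  have uniq: "x = y" if "f \<in> set M" "x \<in> set (e # X)" "y \<in> set (e # X)"
      "bv x \<inter> bv f \<noteq> {}" "bv y \<inter> bv f \<noteq> {}" for f x y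
  proof -
    have "bv e \<inter> bv f = {}" if "z \<in> set X" "bv z \<inter> bv f \<noteq> {}" for z
      using df[of f] that \<open>f \<in> set M\<close> unfolding blockers_def by blast
    moreover have "x = y" if "x \<in> set X" "y \<in> set X"
      using c that \<open>f \<in> set M\<close> \<open>bv x \<inter> bv f \<noteq> {}\<close> \<open>bv y \<inter> bv f \<noteq> {}\<close> unfolding clean_def by blast
    ultimately show ?thesis using that by auto
  qed
  have "distinct (e # X)" "set (e # X) \<subseteq> set es"
    using c e(1) \<open>e \<notin> set X\<close> unfolding clean_def by auto
  then show ?thesis using deg dis uniq unfolding clean_def by blast
qed

text \<open>An edge that the greedy pass rejects stays rejected while the layer grows, so a single
  pass through \<open>es\<close> produces a maximal layer.\<close>

lemma addable_antimono: "addable M X (K @ L) e \<Longrightarrow> addable M X L e"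
  unfolding addable_def by auto

lemma fold_new_layer:
  fixes Xs :: "'e list list"
  assumes M: "matching M" "unmatched M \<noteq> []"
  defines "add \<equiv> \<lambda>e L. if addable M (concat Xs) L e then e # L else L"
  shows "clean M (L @ concat Xs) \<Longrightarrow> av ` set L \<subseteq> tree_verts M Xs \<Longrightarrow> set ds \<subseteq> set es \<Longrightarrow>
    clean M (fold add ds L @ concat Xs) \<and> av ` set (fold add ds L) \<subseteq> tree_verts M Xs \<and>
    (\<exists>K. fold add ds L = K @ L) \<and>
    (\<forall>e\<in>set ds. e \<in> set (fold add ds L) \<or> \<not> addable M (concat Xs) (fold add ds L) e)"
proof (induction ds arbitrary: L)
  case (Cons e ds)
  have e: "e \<in> set es" using Cons.prems(3) by simp
  have "clean M (add e L @ concat Xs) \<and> av ` set (add e L) \<subseteq> tree_verts M Xs"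
  proof (cases "addable M (concat Xs) L e")
    case True
    then have ad: "av e \<in> tree_verts M Xs" "card {x \<in> set (L @ concat Xs). av x = av e} < U"
        "\<And>x. x \<in> set (L @ concat Xs) \<Longrightarrow> bv e \<inter> bv x = {}"
        "\<And>f. f \<in> blockers M (L @ concat Xs) \<Longrightarrow> bv e \<inter> bv f = {}"
      unfolding addable_iff[OF M Cons.prems(1) e] by blast+
    show ?thesis using clean_Cons[OF Cons.prems(1) e ad(2-4)] ad(1) Cons.prems(2) True
      by (simp add: add_def)
  qed (use Cons.prems in \<open>simp add: add_def\<close>)
  then have IH: "clean M (fold add ds (add e L) @ concat Xs)"
    "av ` set (fold add ds (add e L)) \<subseteq> tree_verts M Xs"
    "\<exists>K. fold add ds (add e L) = K @ add e L"
    "\<forall>e'\<in>set ds. e' \<in> set (fold add ds (add e L)) \<or> \<not> addable M (concat Xs) (fold add ds (add e L)) e'"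
    using Cons.IH[of "add e L"] Cons.prems(3) by auto
  then obtain K where K: "fold add ds (add e L) = K @ add e L" by blast
  have "\<exists>K. fold add ds (add e L) = K @ L" unfolding K by (simp add: add_def)
  moreover have "e \<in> set (fold add ds (add e L)) \<or> \<not> addable M (concat Xs) (fold add ds (add e L)) e"
  proof (cases "addable M (concat Xs) L e")
    case True
    then show ?thesis unfolding K by (simp add: add_def)
  next
    case False
    then show ?thesis using addable_antimono[of M "concat Xs" K L e] unfolding K by (auto simp: add_def)
  qed
  ultimately show ?case using IH by simp
qed auto

lemma new_layer:
  assumes M: "matching M" "unmatched M \<noteq> []" and c: "clean M (concat Xs)"
  defines "L \<equiv> new_layer M (concat Xs)"
  shows "clean M (L @ concat Xs)" "av ` set L \<subseteq> tree_verts M Xs"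
    "\<And>e. e \<in> set es \<Longrightarrow> e \<in> set L \<or> \<not> addable M (concat Xs) L e"
  using fold_new_layer[OF M, where Xs = Xs and L = "[]" and ds = es] c unfolding L_def new_layer_def by auto

section \<open>Counting the vertices covered by a tree\<close>

definition edge_blockers :: "'e list \<Rightarrow> 'e \<Rightarrow> 'e set" where
  "edge_blockers M x = {f \<in> set M. bv x \<inter> bv f \<noteq> {}}"

lemma finite_edge_blockers [simp]: "finite (edge_blockers M x)"
  by (simp add: edge_blockers_def)

lemma unblocked_iff: "unblocked M x \<longleftrightarrow> edge_blockers M x = {}"
  by (auto simp: unblocked_def edge_blockers_def)

lemma sum_card_edge_blockers:
  assumes "clean M X"
  shows "(\<Sum>x\<in>set X. card (edge_blockers M x)) = card (blockers M X)"
proof -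
  have "blockers M X = (\<Union>x\<in>set X. edge_blockers M x)"
    by (auto simp: blockers_def edge_blockers_def)
  moreover have "edge_blockers M x \<inter> edge_blockers M y = {}" if "x \<in> set X" "y \<in> set X" "x \<noteq> y" for x y
    using assms that unfolding clean_def edge_blockers_def by blast
  ultimately show ?thesis by (simp add: card_UN_disjoint)
qed

text \<open>As edges of a matching, the blockers of \<open>x\<close> are disjoint in
  \<open>B\<close>, and each of them uses at least one of the \<open>r - 1\<close> vertices in
  \<open>bv x\<close>.\<close>

lemma card_edge_blockers_le:
  assumes M: "matching M" and x: "x \<in> set es"
  shows "card (edge_blockers M x) \<le> r - 1"
proof -
  have "card (edge_blockers M x) = (\<Sum>f\<in>edge_blockers M x. 1)" by simp
  also have "\<dots> \<le> (\<Sum>f\<in>edge_blockers M x. card (bv x \<inter> bv f))"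
  proof (rule sum_mono)
    fix f assume "f \<in> edge_blockers M x"
    then show "1 \<le> card (bv x \<inter> bv f)"
      using finite_bv[OF x] by (simp add: edge_blockers_def card_gt_0_iff Suc_le_eq)
  qed
  also have "\<dots> = card (\<Union>f\<in>edge_blockers M x. bv x \<inter> bv f)"
  proof (rule card_UN_disjoint[symmetric])
    show "\<forall>f\<in>edge_blockers M x. \<forall>g\<in>edge_blockers M x. f \<noteq> g \<longrightarrow> bv x \<inter> bv f \<inter> (bv x \<inter> bv g) = {}"
      using M unfolding matching_def edge_blockers_def by blast
  qed (use finite_bv[OF x] in auto)
  also have "\<dots> \<le> card (bv x)" by (rule card_mono) (use finite_bv[OF x] in auto)
  finally show ?thesis using card_bv[OF x] by simp
qed

definition covered :: "'e list \<Rightarrow> 'e list \<Rightarrow> 'v set" where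
  "covered M X = (\<Union>x\<in>set X. bv x) \<union> (\<Union>f\<in>blockers M X. bv f)"

lemma finite_covered:
  assumes "matching M" "clean M X"
  shows "finite (covered M X)"
  unfolding covered_def
  using finite_bv clean_mem[OF assms(2)] matching_mem[OF assms(1)] blockers_subset[of M X] by auto

text \<open>A tree edge with \<open>k \<ge> 1\<close> blockers covers together with them at most
  \<open>(r - 1) + k * (r - 2) \<le> k * (2 * r - 3)\<close> vertices, as it shares a vertex with each of them.\<close>

lemma card_covered_le:
  assumes M: "matching M" and c: "clean M X"
  shows "card (covered M X) \<le>
    (2 * r - 3) * card (blockers M X) + (r - 1) * card {x \<in> set X. unblocked M x}"
proof -
  let ?C = "\<lambda>x. bv x \<union> (\<Union>f\<in>edge_blockers M x. bv f - bv x)"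
  have C: "card (?C x) \<le> (2 * r - 3) * card (edge_blockers M x) + (if unblocked M x then r - 1 else 0)"
    if x: "x \<in> set X" for x
  proof -
    have xe: "x \<in> set es" using clean_mem[OF c x] .
    let ?k = "card (edge_blockers M x)"
    have "card (bv f - bv x) \<le> r - 2" if f: "f \<in> edge_blockers M x" for f
    proof -
      have fe: "f \<in> set es" using f matching_mem[OF M] by (simp add: edge_blockers_def)
      obtain v where v: "v \<in> bv x" "v \<in> bv f" using f by (auto simp: edge_blockers_def)
      have "card (bv f - bv x) \<le> card (bv f - {v})"
        by (rule card_mono) (use finite_bv[OF fe] v in auto)
      then show ?thesis using v card_bv[OF fe] by simp
    qed
    then have "card (\<Union>f\<in>edge_blockers M x. bv f - bv x) \<le> ?k * (r - 2)"
      using card_UN_le[of "edge_blockers M x" "\<lambda>f. bv f - bv x"]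
        sum_bounded_above[of "edge_blockers M x" "\<lambda>f. card (bv f - bv x)" "r - 2"] by simp
    then have le: "card (?C x) \<le> (r - 1) + ?k * (r - 2)"
      using card_Un_le[of "bv x" "\<Union>f\<in>edge_blockers M x. bv f - bv x"] card_bv[OF xe] by simp
    show ?thesis
    proof (cases "unblocked M x")
      case True
      then show ?thesis using le by (simp add: unblocked_iff)
    next
      case False
      then have "1 \<le> ?k" by (simp add: unblocked_iff Suc_le_eq card_gt_0_iff)
      then have "r - 1 \<le> (r - 1) * ?k" using mult_le_mono2[of 1 ?k "r - 1"] by simp
      moreover have "(2 * r - 3) * ?k = (r - 1) * ?k + ?k * (r - 2)"
      proof -
        have "2 * r - 3 = (r - 1) + (r - 2)" using r by simp
        then show ?thesis unfolding add_mult_distrib[symmetric] by (simp add: add_mult_distrib mult.commute[of ?k])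
      qed
      ultimately show ?thesis using le unfolding if_not_P[OF False] by linarith
    qed
  qed
  have "covered M X = (\<Union>x\<in>set X. ?C x)"
    by (auto simp: covered_def blockers_def edge_blockers_def)
  then have "card (covered M X) \<le> (\<Sum>x\<in>set X. card (?C x))"
    using card_UN_le[of "set X" ?C] by simp
  also have "\<dots> \<le> (\<Sum>x\<in>set X. (2 * r - 3) * card (edge_blockers M x) + (if unblocked M x then r - 1 else 0))"
    by (rule sum_mono) (rule C)
  also have "\<dots> = (2 * r - 3) * (\<Sum>x\<in>set X. card (edge_blockers M x)) + (\<Sum>x\<in>set X. if unblocked M x then r - 1 else 0)"
    by (simp add: sum.distrib sum_distrib_left)
  also have "(\<Sum>x\<in>set X. if unblocked M x then r - 1 else 0) = (r - 1) * card {x \<in> set X. unblocked M x}"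
    by (simp add: sum.If_cases Int_def mult.commute)
  finally show ?thesis unfolding sum_card_edge_blockers[OF c] .
qed

text \<open>An edge contributes at most \<open>r - 1\<close> blockers and at most 1 to the unblocked
  edges. This crude bound converts what the new layer has to supply into its length.\<close>

lemma card_blockers_le:
  assumes "matching M" "clean M X"
  shows "card (blockers M X) + card {x \<in> set X. unblocked M x} \<le> r * length X"
proof -
  have "card (blockers M X) \<le> (\<Sum>x\<in>set X. r - 1)"
    unfolding sum_card_edge_blockers[OF assms(2), symmetric]
    by (rule sum_mono) (use card_edge_blockers_le[OF assms(1)] clean_mem[OF assms(2)] in blast)
  also have "\<dots> = (r - 1) * length X"
    using distinct_card[OF distinct_if_clean[OF assms(2)]] by (simp add: mult.commute)
  finally have "card (blockers M X) \<le> (r - 1) * length X" .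
  moreover have "card {x \<in> set X. unblocked M x} \<le> length X"
    using card_mono[of "set X" "{x \<in> set X. unblocked M x}"] card_length[of X] by auto
  moreover have "(r - 1) * length X + length X = r * length X"
    using r by (cases r) auto
  ultimately show ?thesis by linarith
qed

text \<open>An edge at a tree vertex below the cap that was not taken can only have failed the tests
  in \<open>B\<close>, so it meets a tree edge or a blocker. This makes \<open>covered\<close> a
  hitting set for the edges at unsaturated tree vertices.\<close>

lemma covered_hits:
  assumes M: "matching M" "unmatched M \<noteq> []" and c: "clean M (concat Xs)"
  defines "Z \<equiv> new_layer M (concat Xs) @ concat Xs"
  assumes e: "e \<in> set es" "av e \<in> tree_verts M Xs" "card {x \<in> set Z. av x = av e} < U"
  shows "covered M Z \<inter> bv e \<noteq> {}"
proof (cases "e \<in> set Z")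
  case True
  then show ?thesis using bv_nonempty[OF e(1)] by (auto simp: covered_def)
next
  case False
  then have "\<not> addable M (concat Xs) (new_layer M (concat Xs)) e"
    using new_layer(3)[OF M c e(1)] unfolding Z_def by auto
  then have "\<not> (\<forall>x\<in>set Z. bv e \<inter> bv x = {}) \<or> \<not> (\<forall>f\<in>blockers M Z. bv e \<inter> bv f = {})"
    using e unfolding addable_iff[OF M new_layer(1)[OF M c] e(1)] Z_def by blast
  then show ?thesis unfolding covered_def by blast
qed

text \<open>The hypothesis is applied to the unsaturated tree vertices \<open>S\<close> and the
  hitting set \<open>covered\<close>. The old blockers account for only \<open>2 * r - 3\<close>
  covered vertices per tree vertex, so the surplus \<open>\<epsilon>\<close> must come from the new
  layer, up to the losses through saturated vertices and old unblocked edges.\<close>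

lemma length_new_layer:
  assumes M: "matching M" "unmatched M \<noteq> []" and c: "clean M (concat Xs)" and "layered M Xs"
    and nc: "\<And>hs rest. Xs = hs @ rest \<Longrightarrow> \<not> collapsible M Xs rest"
  defines "L \<equiv> new_layer M (concat Xs)"
  shows "\<beta> * (real (tree_card M Xs) - 1) < length L"
proof -
  let ?Z = "L @ concat Xs"
  let ?T = "tree_verts M Xs"
  let ?c = "2 * real r - 3 + \<epsilon>"
  have cZ: "clean M ?Z" unfolding L_def using new_layer(1)[OF M c] .
  have cL: "clean M L" using clean_append[OF cZ] by blast
  define S where "S = {a \<in> ?T. card {x \<in> set ?Z. av x = a} < U}"
  define \<sigma> y q qL qX where "\<sigma> = card (blockers M (concat Xs))" and "y = card (blockers M L)"
    and "q = card {x \<in> set ?Z. unblocked M x}" and "qL = card {x \<in> set L. unblocked M x}"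
    and "qX = card {x \<in> set (concat Xs). unblocked M x}"
  have t: "tree_card M Xs = Suc \<sigma>" unfolding \<sigma>_def by (rule tree_card_eq[OF M])
  have bZ: "card (blockers M ?Z) = y + \<sigma>"
    using blockers_disjoint[OF cZ] by (simp add: blockers_append card_Un_disjoint y_def \<sigma>_def)
  have q: "q \<le> qL + qX"
  proof -
    have "{x \<in> set ?Z. unblocked M x} = {x \<in> set L. unblocked M x} \<union> {x \<in> set (concat Xs). unblocked M x}"
      by auto
    then show ?thesis unfolding q_def qL_def qX_def using card_Un_le by metis
  qed
  have "?c * (real (card S) - 1) < card (covered M ?Z)"
  proof (rule haxell)
    show "S \<subseteq> set as" using tree_verts_subset[OF M] unfolding S_def by blast
    show "finite (covered M ?Z)" by (rule finite_covered[OF M(1) cZ])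
    show "covered M ?Z \<inter> bv e \<noteq> {}" if "e \<in> set es" "av e \<in> S" for e
      using covered_hits[OF M c that(1)] that(2) unfolding S_def L_def by blast
  qed
  also have "real (card (covered M ?Z)) \<le> (2 * real r - 3) * (y + \<sigma>) + (real r - 1) * q"
  proof -
    have "real (card (covered M ?Z)) \<le> real ((2 * r - 3) * (y + \<sigma>) + (r - 1) * q)"
      using card_covered_le[OF M(1) cZ] unfolding bZ q_def by (rule of_nat_mono)
    then show ?thesis using r by (simp add: of_nat_diff)
  qed
  finally have 1: "?c * (real (card S) - 1) < (2 * real r - 3) * (y + \<sigma>) + (real r - 1) * q" .
  have "card S + card (?T - S) = Suc \<sigma>"
    using card_Un_disjoint[of S "?T - S"] t unfolding tree_card_def S_def
    by (metis (no_types, lifting) Diff_disjoint Diff_partition finite_Diff finite_tree_verts finite_subset mem_Collect_eq subsetI)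
  \<comment> \<open>The root, which \<open>\<sigma>\<close> does not count, cancels the
    \<open>- 1\<close> of the hypothesis.\<close>
  then have 2: "real (card S) - 1 = real \<sigma> - card (?T - S)" by linarith
  \<comment> \<open>Each saturated vertex owns at least \<open>U\<close> tree edges. A tree edge is
    unblocked or has a blocker of its own, so at most \<open>y + \<sigma> + q\<close> tree edges
    exist.\<close>
  have "U * card (?T - S) \<le> (y + \<sigma>) + q"
  proof -
    have "U * card (?T - S) \<le> (\<Sum>a\<in>?T - S. card {x \<in> set ?Z. av x = a})"
      using sum_bounded_below[of "?T - S" U "\<lambda>a. card {x \<in> set ?Z. av x = a}"]
      unfolding S_def by (simp add: not_less mult.commute)
    also have "\<dots> = card (\<Union>a\<in>?T - S. {x \<in> set ?Z. av x = a})"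
      by (rule card_UN_disjoint[symmetric]) auto
    also have "\<dots> \<le> card (set ?Z)" by (rule card_mono) auto
    also have "\<dots> \<le> (y + \<sigma>) + q"
      using card_blocked_le[OF cZ] card_filter_split[of ?Z "unblocked M"] bZ unfolding q_def by linarith
    finally show ?thesis .
  qed
  then have "real U * card (?T - S) \<le> y + \<sigma> + q" by (metis of_nat_mono of_nat_mult)
  then have "\<epsilon> * (real U * card (?T - S)) \<le> \<epsilon> * (y + \<sigma> + q)" using eps by simp
  moreover have "2 * ?c * card (?T - S) \<le> \<epsilon> * real U * card (?T - S)"
    by (intro mult_right_mono U) simp
  ultimately have 3: "2 * (?c * card (?T - S)) \<le> \<epsilon> * (y + \<sigma> + q)" by argo
  \<comment> \<open>Old unblocked edges hang at ready vertices, which are few because no suffix is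
    collapsible.\<close>
  have 4: "4 * real qX \<le> \<beta> * \<sigma>"
  proof -
    have "av x \<in> set (all_ready M Xs Xs)" if x: "x \<in> set (concat Xs)" "unblocked M x" for x
    proof -
      obtain X where X: "X \<in> set Xs" "x \<in> set X" using x(1) by auto
      then obtain hs rest where Xs: "Xs = hs @ X # rest" by (auto dest: split_list)
      have "av x \<in> tree_verts M rest" using layeredD(1) \<open>layered M Xs\<close> X(2) unfolding Xs by blast
      then have "av x \<in> set (all_ready M Xs rest)"
        using unblocked_mem_all_ready[OF M c, of "hs @ [X]" rest x] X x Xs by simp
      then show ?thesis using all_ready_append[of M Xs rest "hs @ [X]"] Xs by auto
    qed
    then have "qX \<le> U * length (all_ready M Xs Xs)"
      unfolding qX_def by (intro card_degree_bound[OF c]) auto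
    then have "m * qX \<le> U * (m * length (all_ready M Xs Xs))"
      by (metis mult.left_commute mult_le_mono2)
    also have "\<dots> \<le> U * \<sigma>"
    proof -
      have "m * length (all_ready M Xs Xs) < tree_card M Xs"
        by (rule length_all_ready[where hs = "[]", OF M c nc]) simp_all
      then show ?thesis unfolding t by simp
    qed
    finally have "real m * real qX \<le> real U * real \<sigma>" by (metis of_nat_mono of_nat_mult)
    then have "real m * (4 * real qX) \<le> (4 * real U) * real \<sigma>" by simp
    also have "\<dots> \<le> \<beta> * real m * real \<sigma>" by (intro mult_right_mono m) simp
    finally have "real m * (4 * real qX) \<le> real m * (\<beta> * real \<sigma>)" by (simp add: mult.commute mult.left_commute)
    then show ?thesis using m(1) by (simp add: mult_le_cancel_left)
  qed
  have 5: "real y + qL \<le> r * length L"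
    using card_blockers_le[OF M(1) cL] unfolding y_def qL_def by (metis of_nat_add of_nat_mono of_nat_mult)
  have b: "8 * (real r * real r * \<beta>) = \<epsilon>" using r by (simp add: beta power2_eq_square)
  have "?c * real \<sigma> - ?c * card (?T - S) < (2 * real r - 3) * (y + \<sigma>) + (real r - 1) * q"
    using 1 unfolding 2 by (simp add: right_diff_distrib)
  then have "2 * (?c * real \<sigma>) - \<epsilon> * (y + \<sigma> + q) < 2 * (2 * real r - 3) * (y + \<sigma>) + 2 * (real r - 1) * q"
    using 3 by argo
  \<comment> \<open>After cancelling \<open>2 * (2 * r - 3) * \<sigma>\<close>, the left side keeps
    \<open>2 * \<epsilon> * \<sigma>\<close>; the saturated vertices consume one half of it.\<close>
  then have "\<epsilon> * \<sigma> < (4 * real r - 6 + \<epsilon>) * y + (2 * real r - 2 + \<epsilon>) * q"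
    by (simp add: algebra_simps)
  also have "\<dots> \<le> (4 * real r) * y + (4 * real r) * q"
    by (intro add_mono mult_right_mono) (use eps r in auto)
  also have "\<dots> \<le> (4 * real r) * y + (4 * real r) * (real qL + qX)"
    by (intro add_left_mono mult_left_mono) (use q in auto)
  also have "\<dots> = 4 * (real r * (real y + qL)) + real r * (4 * real qX)"
    by (simp add: algebra_simps)
  also have "\<dots> \<le> 4 * (real r * (r * length L)) + real r * (\<beta> * \<sigma>)"
    by (intro add_mono mult_left_mono 4 5) (use r in auto)
  also have "\<dots> \<le> 4 * (real r * (r * length L)) + real r * (real r * \<beta> * \<sigma>)"
    by (intro add_mono mult_left_mono mult_right_mono) (use r beta_pos in auto)
  finally have "8 * (real r * real r * \<beta>) * \<sigma> < 4 * (real r * (r * length L)) + real r * (real r * \<beta> * \<sigma>)"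
    unfolding b .
  \<comment> \<open>With \<open>8 * r * r * \<beta>\<close> in place of \<open>\<epsilon>\<close>
    the square of \<open>r\<close> cancels, which explains the form of \<open>\<beta>\<close>. The
    remaining inequality, \<open>7 * \<beta> * \<sigma>\<close> below \<open>4 * length L\<close>,
    is more than enough.\<close>
  then have "(real r * real r) * (8 * (\<beta> * \<sigma>)) < (real r * real r) * (4 * length L + \<beta> * \<sigma>)"
    by (simp add: algebra_simps)
  then have "8 * (\<beta> * \<sigma>) < 4 * length L + \<beta> * \<sigma>"
    using r by (simp add: mult_less_cancel_left)
  moreover have "0 \<le> \<beta> * \<sigma>" using beta_pos by simp
  ultimately have "\<beta> * \<sigma> < length L" by linarith
  then show ?thesis by (simp add: t)
qed

text \<open>Passing from \<open>tree_card - 1\<close> to \<open>tree_card\<close> costs half of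
  \<open>\<beta>\<close> if the tree has at least two vertices. If it consists of the root alone,
  one edge in the layer suffices because \<open>\<beta> \<le> 1\<close>.\<close>

lemma valid_state_build:
  assumes v: "valid_state M Xs" and u: "unmatched M \<noteq> []"
    and nc: "\<And>hs rest. Xs = hs @ rest \<Longrightarrow> \<not> collapsible M Xs rest"
  shows "valid_state M (new_layer M (concat Xs) # Xs)"
proof -
  let ?L = "new_layer M (concat Xs)"
  have M: "matching M" and c: "clean M (concat Xs)" and l: "layered M Xs"
    using v by (simp_all add: valid_state_def)
  have "\<beta> * (real (tree_card M Xs) - 1) < length ?L"
    by (rule length_new_layer[OF M u c l nc])
  then have "\<beta> / 2 * tree_card M Xs \<le> length ?L"
  proof (cases "tree_card M Xs = 1")
    case True
    then have "0 < length ?L" using \<open>\<beta> * _ < length ?L\<close> by simp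
    then have "1 \<le> real (length ?L)" by linarith
    then show ?thesis using True beta_le by simp
  next
    case False
    then have "real (tree_card M Xs) \<le> 2 * (real (tree_card M Xs) - 1)"
      using tree_card_pos[of M Xs] by simp
    then have "\<beta> * real (tree_card M Xs) \<le> \<beta> * (2 * (real (tree_card M Xs) - 1))"
      using beta_pos by simp
    then show ?thesis using \<open>\<beta> * _ < length ?L\<close> by linarith
  qed
  moreover have "grown M Xs" by (rule grown_if_not_collapsible[OF M u c l nc])
  ultimately show ?thesis
    using M u l new_layer(1,2)[OF M u c] by (simp add: valid_state_def)
qed

section \<open>The potential\<close>

definition weight :: "'e list \<Rightarrow> 'e list list \<Rightarrow> real" where
  "weight M Xs = 1 / real (tree_card M Xs) ^ p"

primrec potential :: "'e list \<Rightarrow> 'e list list \<Rightarrow> real" where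
  "potential M [] = weight M []"
| "potential M (X # Xs) = weight M (X # Xs) + potential M Xs"

lemma weight_nonneg: "0 \<le> weight M Xs"
  by (simp add: weight_def)

lemma weight_Nil: "weight M [] = 1"
  by (simp add: weight_def tree_card_Nil)

lemma potential_nonneg: "0 \<le> potential M Xs"
  by (induction Xs) (auto simp: weight_nonneg)

lemma weight_ge:
  assumes "matching M" "unmatched M \<noteq> []"
  shows "1 / real (length as) ^ p \<le> weight M Xs"
  unfolding weight_def
  by (intro divide_left_mono power_mono) (use tree_card_le[OF assms] tree_card_pos[of M Xs] in \<open>auto intro!: mult_pos_pos zero_less_power simp: Suc_le_eq le_trans\<close>)

lemma weight_Cons_le:
  assumes "matching M" "unmatched M \<noteq> []" "clean M (concat (X # Xs))"
  shows "weight M (X # Xs) \<le> weight M Xs"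
  unfolding weight_def
  by (intro divide_left_mono power_mono)
    (use tree_card_Cons[OF assms] tree_card_pos[of M Xs] in \<open>auto intro!: mult_pos_pos zero_less_power\<close>)

lemma scaled_power:
  assumes "0 < s'" "(1 + d) * s' \<le> s" "0 \<le> d" "c \<le> (1 + d) ^ p"
  shows "c * (1 / s ^ p) \<le> 1 / (s' :: real) ^ p"
proof -
  have "(1 + d) ^ p * s' ^ p \<le> s ^ p"
    using power_mono[OF assms(2), of p] assms by (simp add: power_mult_distrib)
  moreover have "c * s' ^ p \<le> (1 + d) ^ p * s' ^ p" using assms by (intro mult_right_mono) auto
  ultimately have "c * s' ^ p \<le> s ^ p" by linarith
  moreover have "0 < (1 + d) * s'" using assms by simp
  then have "0 < s" using assms(2) by linarith
  ultimately show ?thesis using assms(1) by (simp add: field_simps)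
qed

text \<open>The exponent \<open>p\<close> is tuned to the smaller ratio
  \<open>1 + \<gamma> / (2 * m)\<close> of a collapse, so for the ratio \<open>1 + \<gamma>\<close>
  of a grown layer it gives more than the factor 2.\<close>

lemma weight_Cons_grown:
  assumes "matching M" "unmatched M \<noteq> []" "clean M (concat (X # Xs))" "grown M (X # Xs)"
  shows "2 * weight M (X # Xs) \<le> weight M Xs"
  unfolding weight_def
proof (rule scaled_power[where d = \<gamma>])
  show "(1 + \<gamma>) * real (tree_card M Xs) \<le> real (tree_card M (X # Xs))"
    using assms(4) tree_card_Cons[OF assms(1-3)] by (simp add: algebra_simps)
  have "(1 + \<gamma> / (2 * real m)) ^ p \<le> (1 + \<gamma>) ^ p"
    by (intro power_mono add_left_mono) (use gamma_pos m in \<open>auto simp: divide_le_eq mult_le_cancel_left1\<close>)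
  then show "2 \<le> (1 + \<gamma>) ^ p" using p by linarith
qed (use tree_card_pos[of M Xs] gamma_pos in auto)

text \<open>Weights at least halve from layer to layer; counting the top weight twice makes the
  geometric sum telescope.\<close>

lemma potential_append_grown:
  assumes "matching M" "unmatched M \<noteq> []"
  shows "clean M (concat (hs @ rest)) \<Longrightarrow> grown M (hs @ rest) \<Longrightarrow>
    potential M (hs @ rest) + weight M (hs @ rest) \<le> potential M rest + weight M rest"
proof (induction hs)
  case (Cons X hs)
  have "2 * weight M (X # (hs @ rest)) \<le> weight M (hs @ rest)"
    by (rule weight_Cons_grown[OF assms]) (use Cons.prems in auto)
  moreover have "clean M (concat (hs @ rest))" using Cons.prems(1) clean_append[of M X] by simp
  ultimately show ?case using Cons.IH Cons.prems(2) by simp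
qed simp

text \<open>The weights of the layers above \<open>rest\<close> sum up to at most the weight of \<open>rest\<close>: they decrease
  geometrically, except perhaps at the very top.\<close>

lemma potential_append:
  assumes "matching M" "unmatched M \<noteq> []" "clean M (concat (hs @ rest))" "grown M (tl (hs @ rest))"
  shows "potential M (hs @ rest) \<le> potential M rest + weight M rest"
proof (cases hs)
  case Nil
  then show ?thesis by (simp add: weight_nonneg)
next
  case (Cons X hs')
  have "weight M (X # (hs' @ rest)) \<le> weight M (hs' @ rest)"
    by (rule weight_Cons_le[OF assms(1,2)]) (use assms(3) Cons in simp)
  moreover have "potential M (hs' @ rest) + weight M (hs' @ rest) \<le> potential M rest + weight M rest"
    by (rule potential_append_grown[OF assms(1,2)]) (use assms(3,4) Cons clean_append[of M X] in auto)
  ultimately show ?thesis using Cons by simp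
qed

text \<open>These notions depend on the matching only through the root and the blockers of tree
  edges. A collapse changes neither for the layers older than the collapsed one.\<close>

lemma invariants_cong:
  assumes "root M' = root M" "\<And>Z. set Z \<subseteq> set (concat Xs) \<Longrightarrow> blockers M' Z = blockers M Z"
  shows "tree_verts M' Xs = tree_verts M Xs" "layered M' Xs = layered M Xs"
    "grown M' Xs = grown M Xs" "potential M' Xs = potential M Xs"
proof -
  have tree: "tree_verts M' Xs = tree_verts M Xs"
    if "\<And>Z. set Z \<subseteq> set (concat Xs) \<Longrightarrow> blockers M' Z = blockers M Z" for Xs
    using assms(1) that[of "concat Xs"] by (simp add: tree_verts_def)
  show "tree_verts M' Xs = tree_verts M Xs" by (rule tree[OF assms(2)])
  show "layered M' Xs = layered M Xs" "grown M' Xs = grown M Xs" "potential M' Xs = potential M Xs"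
    using assms(2)
  proof (induction Xs)
    case Nil
    case 1 then show ?case by simp
    case 2 then show ?case by simp
    case 3 then show ?case by (simp add: weight_Nil)
  next
    case (Cons X Xs)
    have sub: "blockers M' Z = blockers M Z" if "set Z \<subseteq> set (concat Xs)"
        "\<And>Z. set Z \<subseteq> set (concat (X # Xs)) \<Longrightarrow> blockers M' Z = blockers M Z" for Z
      using that by auto
    case 1 then show ?case using Cons.IH(1)[OF sub] tree[of Xs, OF sub] by (simp add: tree_card_def)
    case 2 then show ?case using Cons.IH(2)[OF sub] tree[of Xs, OF sub] 2[of X] by (simp add: tree_card_def)
    case 3 then show ?case using Cons.IH(3)[OF sub] tree[of "X # Xs", OF 3]
      by (simp add: tree_card_def weight_def)
  qed
qed

section \<open>Collapsing a layer\<close>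

lemma unmatched_cong:
  assumes "matching M" "matching M'" "av ` set M' = av ` set M"
  shows "unmatched M' = unmatched M"
  unfolding unmatched_def
  using inc_iff_matching[OF assms(1)] inc_iff_matching[OF assms(2)] assms(3)
  by (intro filter_cong) simp_all

text \<open>One collapse at the suffix \<open>rest\<close>: the ready vertices \<open>R\<close> give
  up their matching edges \<open>F\<close>, and each \<open>a\<close> among them receives the
  unblocked tree edge \<open>g a\<close>.\<close>

context
  fixes M hs rest Xs R g F M'
  assumes v: "valid_state M Xs" and u: "unmatched M \<noteq> []" and Xs: "Xs = hs @ rest"
    and coll: "collapsible M Xs rest"
  defines "R \<equiv> ready M Xs rest"
    and "g \<equiv> \<lambda>a. hd (ready_edges M (above Xs rest) a)"
    and "F \<equiv> {f \<in> set M. av f \<in> set R}"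
    and "M' \<equiv> swap M Xs rest"
begin

lemma collapse_assms:
  "matching M" "clean M (concat Xs)" "clean M (concat hs @ concat rest)" "layered M Xs" "grown M (tl Xs)"
  using v Xs by (auto simp: valid_state_def)

lemma set_R: "set R = {a \<in> set (frontier M rest). \<exists>x\<in>set (concat hs). av x = a \<and> unblocked M x}"
  unfolding R_def by (rule set_ready[OF collapse_assms(1) u collapse_assms(2) Xs])

lemma R_nonempty: "R \<noteq> []"
  using coll by (simp add: collapsible_def R_def)

lemma R_subset: "set R \<subseteq> set as"
  using set_R root_mem[OF collapse_assms(1) u] by (auto simp: frontier_def root_def)

lemma swapped_edge:
  assumes "a \<in> set R"
  shows "g a \<in> set (concat hs)" "g a \<in> set es" "av (g a) = a" "unblocked M (g a)"
proof -
  have "ready_edges M (above Xs rest) a \<noteq> []" using assms by (simp add: R_def ready_def)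
  then have "g a \<in> set (ready_edges M (above Xs rest) a)" unfolding g_def by simp
  then have *: "g a \<in> set (concat hs)" "inc a (g a)" "\<not> (\<exists>f\<in>set M. con (g a) f)"
    unfolding ready_edges_def Xs set_filter above_append by auto
  show "g a \<in> set (concat hs)" by fact
  then show e: "g a \<in> set es" using clean_mem[OF collapse_assms(2)] Xs by auto
  show "av (g a) = a" using *(2) inc_iff[OF _ e] R_subset assms by blast
  show "unblocked M (g a)"
    using *(3) con_iff[OF e] matching_mem[OF collapse_assms(1)] unfolding unblocked_def by blast
qed

text \<open>New matching edges come from discarded layers, and tree edges are disjoint in
  \<open>B\<close>. Hence they block no kept edge, and kept layers can only lose blockers.\<close>

lemma swapped_edge_disjoint: "a \<in> set R \<Longrightarrow> x \<in> set (concat rest) \<Longrightarrow> bv x \<inter> bv (g a) = {}"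
proof -
  assume a: "a \<in> set R" and x: "x \<in> set (concat rest)"
  have "x \<noteq> g a" using distinct_if_clean[OF collapse_assms(3)] swapped_edge(1)[OF a] x by auto
  then show ?thesis
    using collapse_assms(3) swapped_edge(1)[OF a] x unfolding clean_def set_append by blast
qed

lemma swapped_edge_not_mem: "a \<in> set R \<Longrightarrow> g a \<notin> set M"
  using swapped_edge(4) bv_nonempty[OF swapped_edge(2)] unfolding unblocked_def by blast

lemma M'_eq: "M' = filter (\<lambda>f. f \<notin> F) M @ map g R"
proof -
  have "filter (\<lambda>f. \<not> (\<exists>a\<in>set R. inc a f)) M = filter (\<lambda>f. f \<notin> F) M"
  proof (rule filter_cong[OF refl])
    fix f assume f: "f \<in> set M"
    then have "(\<exists>a\<in>set R. inc a f) \<longleftrightarrow> av f \<in> set R"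
      using inc_iff[OF _ matching_mem[OF collapse_assms(1)]] R_subset by blast
    then show "(\<not> (\<exists>a\<in>set R. inc a f)) = (f \<notin> F)" using f by (simp add: F_def)
  qed
  then show ?thesis by (simp add: M'_def swap_def R_def g_def)
qed

lemma set_M': "set M' = (set M - F) \<union> g ` set R"
  unfolding M'_eq by auto

text \<open>Conflicts in \<open>A\<close> vanish with \<open>F\<close>. In \<open>B\<close> the new
  edges avoid the old matching because they are unblocked, and each other because they are tree
  edges.\<close>

lemma matching_M': "matching M'"
proof -
  have M: "matching M" by (rule collapse_assms)
  have inj: "inj_on g (set R)" using swapped_edge(3) by (metis inj_onI)
  have "distinct M'"
    using M distinct_ready[of M Xs rest] inj swapped_edge_not_mem unfolding M'_eq matching_def
    by (auto simp: distinct_map R_def)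
  moreover have "set M' \<subseteq> set es" using M swapped_edge(2) unfolding set_M' matching_def by auto
  moreover have "f = f'" if "f \<in> set M'" "f' \<in> set M'" "av f = av f'" for f f'
  proof -
    have "f = f'" if "f \<in> set M" "f' \<in> set M" using M that \<open>av f = av f'\<close> unfolding matching_def inj_on_def by blast
    then show ?thesis using that swapped_edge(3) unfolding set_M' F_def by auto
  qed
  then have "inj_on av (set M')" by (blast intro: inj_onI)
  moreover have "bv f \<inter> bv f' = {}" if "f \<in> set M'" "f' \<in> set M'" "f \<noteq> f'" for f f'
  proof -
    have 1: "bv f \<inter> bv f' = {}" if "f \<in> set M" "f' \<in> set M"
      using M that \<open>f \<noteq> f'\<close> unfolding matching_def by blast
    have 2: "bv (g a) \<inter> bv h = {}" "bv h \<inter> bv (g a) = {}" if "a \<in> set R" "h \<in> set M" for a h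
      using swapped_edge(4)[OF that(1)] that(2) unfolding unblocked_def by blast+
    have 3: "bv (g a) \<inter> bv (g b) = {}" if "a \<in> set R" "b \<in> set R" "g a \<noteq> g b" for a b
      using collapse_assms(3) swapped_edge(1)[OF that(1)] swapped_edge(1)[OF that(2)] that(3)
      unfolding clean_def set_append by blast
    show ?thesis using that 1 2 3 unfolding set_M' by blast
  qed
  ultimately show ?thesis unfolding matching_def by blast
qed

lemma blockers_M':
  assumes "set Z \<subseteq> set (concat rest)"
  shows "blockers M' Z = blockers M Z - F"
proof -
  have "\<not> (\<exists>x\<in>set Z. bv x \<inter> bv f \<noteq> {})" if f: "f \<in> g ` set R" for f
  proof -
    obtain a where "f = g a" "a \<in> set R" using f by blast
    then show ?thesis using swapped_edge_disjoint assms by blast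
  qed
  then show ?thesis unfolding blockers_def set_M' by blast
qed

lemma clean_M': "clean M' (concat rest)"
proof -
  have c: "clean M (concat rest)" using clean_append[OF collapse_assms(3)] by blast
  have "x = y" if "f \<in> set M'" "x \<in> set (concat rest)" "y \<in> set (concat rest)"
      "bv x \<inter> bv f \<noteq> {}" "bv y \<inter> bv f \<noteq> {}" for f x y
  proof -
    have "f \<notin> g ` set R"
    proof
      assume "f \<in> g ` set R"
      then obtain a where "f = g a" "a \<in> set R" by blast
      then show False using swapped_edge_disjoint that(2,4) by blast
    qed
    then have "f \<in> set M" using that(1) unfolding set_M' by blast
    then show ?thesis using c that(2-5) unfolding clean_def by blast
  qed
  then show ?thesis using c unfolding clean_def by simp
qed

lemma hs_nonempty: "hs \<noteq> []"
  using R_nonempty set_R hd_in_set[of R] by auto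

text \<open>At the suffix \<open>[]\<close> the unmatched root is the only ready vertex, so no
  matching edge is given up.\<close>

lemma collapse_root:
  assumes "rest = []"
  shows "valid_state M' rest" "card (av ` set M') = Suc (card (av ` set M))"
proof -
  show "valid_state M' rest"
    using matching_M' clean_M' assms by (simp add: valid_state_def)
  have "set R \<subseteq> {root M}" using set_R assms by (auto simp: frontier_Nil)
  from subset_singletonD[OF this] have R: "set R = {root M}" using R_nonempty by simp
  have F: "F = {}"
  proof (rule ccontr)
    assume "F \<noteq> {}"
    then obtain f where "f \<in> set M" "av f = root M" unfolding F_def R by auto
    then show False using root_mem[OF collapse_assms(1) u] by (metis imageI)
  qed
  have "set M' = insert (g (root M)) (set M)" unfolding set_M' F R by simp
  moreover have "av (g (root M)) = root M" using swapped_edge(3)[of "root M"] R by simp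
  ultimately show "card (av ` set M') = Suc (card (av ` set M))"
    using root_mem[OF collapse_assms(1) u] by simp
qed

text \<open>The ready vertices merely change partners, so the matched vertices and the root stay the
  same. The layer \<open>X\<close> loses one blocker per ready vertex, and the weight of
  \<open>rest\<close> at least triples, which outweighs all discarded layers.\<close>

lemma collapse_layer:
  assumes rest: "rest = X # t"
  shows "valid_state M' rest" "card (av ` set M') = card (av ` set M)"
    "potential M Xs + 1 / real (length as) ^ p \<le> potential M' rest"
proof -
  have M: "matching M" by (rule collapse_assms)
  have c: "clean M (concat (X # t))" using clean_append[OF collapse_assms(3)] rest by simp
  have fr: "set (frontier M rest) = av ` blockers M X"
    unfolding rest by (rule set_frontier[OF M c])
  have F: "F \<subseteq> blockers M X"
  proof
    fix f assume f: "f \<in> F"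
    then obtain f' where "f' \<in> blockers M X" "av f = av f'" using set_R fr unfolding F_def by auto
    then show "f \<in> blockers M X"
      using f M blockers_subset unfolding F_def matching_def inj_on_def by blast
  qed
  have "set R \<subseteq> av ` set M" using set_R fr blockers_subset[of M X] by blast
  then have avF: "av ` F = set R" unfolding F_def by blast
  have "av ` set M' = av ` (set M - F) \<union> set R"
    unfolding set_M' image_Un image_image using swapped_edge(3) by simp
  also have "\<dots> = av ` (set M - F) \<union> av ` F" by (simp only: avF)
  also have "\<dots> = av ` set M" unfolding image_Un[symmetric] by (rule arg_cong[of _ _ "(`) av"]) (auto simp: F_def)
  finally have av: "av ` set M' = av ` set M" .
  then show "card (av ` set M') = card (av ` set M)" by simp
  have um: "unmatched M' = unmatched M" by (rule unmatched_cong[OF M matching_M' av])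
  have root: "root M' = root M" by (simp add: root_def um)
  \<comment> \<open>The edges of \<open>F\<close> block \<open>X\<close>, and blockers of different
    layers are disjoint, so older layers keep theirs.\<close>
  have bl: "blockers M' Z = blockers M Z" if "set Z \<subseteq> set (concat t)" for Z
  proof -
    have "blockers M Z \<subseteq> blockers M (concat t)" using that unfolding blockers_def by blast
    then have "blockers M Z \<inter> F = {}"
      using F blockers_disjoint[of M X "concat t"] c by auto
    moreover have "blockers M' Z = blockers M Z - F"
      by (rule blockers_M') (use that rest in auto)
    ultimately show ?thesis by blast
  qed
  note cong = invariants_cong[OF root bl]
  \<comment> \<open>As \<open>hs\<close> is nonempty, \<open>X\<close> is not the top layer of
    \<open>Xs\<close>, so before the swap it still has all the blockers required of a grown
    layer.\<close>
  have "grown M (X # t)"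
    using collapse_assms(5) hs_nonempty grown_suffix[of M "tl hs" rest] Xs rest by (cases hs) auto
  moreover have "layered M (X # t)"
    using collapse_assms(4) layered_suffix[of M hs rest] Xs rest by simp
  ultimately show "valid_state M' rest"
    using matching_M' clean_M' cong um u unfolding rest by (simp add: valid_state_def tree_card_def)
  have grown: "\<gamma> * tree_card M t \<le> card (blockers M X)" using \<open>grown M (X # t)\<close> by simp
  let ?s = "tree_card M rest" and ?s' = "tree_card M' rest" and ?d = "\<gamma> / (2 * real m)"
  have s: "?s = card (blockers M X) + tree_card M t"
    unfolding rest by (rule tree_card_Cons[OF M u c])
  have "card F = length R"
    using card_image[of av F] avF distinct_card[OF distinct_ready[of M Xs rest]] M inj_on_subset[of av "set M" F]
    unfolding R_def[symmetric] matching_def F_def by auto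
  moreover have "blockers M' (concat rest) = blockers M (concat rest) - F"
    by (rule blockers_M') simp
  moreover have "F \<subseteq> blockers M (concat rest)" using F unfolding rest by (auto simp: blockers_append)
  moreover have "finite F" unfolding F_def by simp
  ultimately have s': "?s' + length R = ?s"
    using tree_card_eq[OF M u, of rest] tree_card_eq[OF matching_M', of rest] um u
      card_Diff_subset[of F "blockers M (concat rest)"] card_mono[of "blockers M (concat rest)" F]
    by simp
  have mR: "card (blockers M X) \<le> m * length R"
    using coll length_frontier[OF M c] unfolding collapsible_def R_def rest by simp
  \<comment> \<open>The blockers of \<open>X\<close> bound both parts of the tree: the older part
    because \<open>X\<close> is grown, their own share because
    \<open>\<gamma> \<le> 1\<close>.\<close>
  have "\<gamma> * ?s \<le> 2 * (m * length R)"
  proof -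
    have "\<gamma> * ?s = \<gamma> * card (blockers M X) + \<gamma> * tree_card M t"
      unfolding s by (simp add: algebra_simps)
    also have "\<dots> \<le> 1 * real (card (blockers M X)) + real (card (blockers M X))"
      by (intro add_mono mult_right_mono gamma_le grown) simp
    also have "\<dots> \<le> 2 * real (m * length R)" using mR by linarith
    finally show ?thesis by simp
  qed
  then have "?d * ?s \<le> length R" using m by (simp add: field_simps)
  moreover have "?d * ?s' \<le> ?d * ?s" using s' gamma_pos by (intro mult_left_mono) auto
  ultimately have "(1 + ?d) * ?s' \<le> ?s" using s' by (simp add: distrib_right)
  then have "3 * weight M rest \<le> weight M' rest"
    unfolding weight_def
    by (intro scaled_power[where d = ?d]) (use tree_card_pos[of M' rest] gamma_pos p in auto)
  moreover have "1 / real (length as) ^ p \<le> weight M rest" by (rule weight_ge[OF M u])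
  moreover have "potential M Xs \<le> potential M rest + weight M rest"
    unfolding Xs by (rule potential_append[OF M u]) (use collapse_assms Xs in auto)
  \<comment> \<open>Tripling gains twice \<open>weight M rest\<close>: once to pay for the discarded
    layers, once as the net increase.\<close>
  ultimately show "potential M Xs + 1 / real (length as) ^ p \<le> potential M' rest"
    using cong(4) unfolding rest by simp
qed

end

text \<open>The potential never exceeds 2, so with the factor 3 a larger matching raises the sum
  even though the whole tree is discarded.\<close>

definition progress :: "'e list \<Rightarrow> 'e list list \<Rightarrow> real" where
  "progress M Xs = 3 * card (av ` set M) + potential M Xs"

lemma potential_le:
  assumes "valid_state M Xs"
  shows "potential M Xs \<le> 2"
proof (cases "unmatched M = []")
  case True
  then show ?thesis using assms by (simp add: valid_state_def weight_Nil)
next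
  case False
  then show ?thesis
    using potential_append[of M Xs "[]"] assms by (simp add: valid_state_def weight_Nil)
qed

lemma card_matched_le: "matching M \<Longrightarrow> card (av ` set M) \<le> length as"
  using card_mono[of "set as" "av ` set M"] av_mem matching_mem card_length[of as] by fastforce

lemma progress_le:
  assumes "valid_state M Xs"
  shows "progress M Xs \<le> 3 * length as + 2"
  using potential_le[OF assms] card_matched_le[of M] assms
  by (simp add: progress_def valid_state_def)

lemma valid_state_step:
  assumes v: "valid_state M Xs"
  shows "valid_state (step_matching M Xs) (step_layers M Xs)"
    and "unmatched M \<noteq> [] \<Longrightarrow>
      progress M Xs + 1 / real (length as) ^ p \<le> progress (step_matching M Xs) (step_layers M Xs)"
proof -
  let ?rest = "collapse_point M Xs"
  have M: "matching M" using v by (simp add: valid_state_def)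
  have *: "valid_state (step_matching M Xs) (step_layers M Xs) \<and>
     progress M Xs + 1 / real (length as) ^ p \<le> progress (step_matching M Xs) (step_layers M Xs)"
    if u: "unmatched M \<noteq> []"
  proof (cases "collapsible M Xs ?rest")
    case coll: True
    obtain hs where Xs: "Xs = hs @ ?rest" using collapse_point_suffix[of Xs M] by blast
    have eq: "step_matching M Xs = swap M Xs ?rest" "step_layers M Xs = ?rest"
      using u coll by (simp_all add: step_matching_def step_layers_def)
    show ?thesis
    proof (cases ?rest)
      case Nil
      have "root M \<in> set as" using root_mem[OF M u] by blast
      then have "1 \<le> length as" by (cases as) auto
      then have "1 / real (length as) ^ p \<le> 1" by (simp add: divide_le_eq)
      then show ?thesis
        using collapse_root[OF v u Xs coll Nil] potential_le[OF v] unfolding eq progress_def Nil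
        by (simp add: weight_Nil)
    next
      case (Cons X t)
      then show ?thesis
        using collapse_layer[OF v u Xs coll Cons] unfolding eq progress_def by simp
    qed
  next
    case False
    have eq: "step_matching M Xs = M" "step_layers M Xs = new_layer M (concat Xs) # Xs"
      using u False by (simp_all add: step_matching_def step_layers_def)
    show ?thesis
      using valid_state_build[OF v u collapse_point_complete[OF False]] weight_ge[OF M u]
      unfolding eq progress_def by simp
  qed
  show "valid_state (step_matching M Xs) (step_layers M Xs)"
    using * v by (cases "unmatched M = []") (simp_all add: step_matching_def step_layers_def)
  show "unmatched M \<noteq> [] \<Longrightarrow>
      progress M Xs + 1 / real (length as) ^ p \<le> progress (step_matching M Xs) (step_layers M Xs)"
    using * by blast
qed

lemma valid_state_iterate:
  "case (step ^^ k) ([], []) of (M, Xs) \<Rightarrow>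
     valid_state M Xs \<and> (unmatched M = [] \<or> k / real (length as) ^ p \<le> progress M Xs)"
proof (induction k)
  case 0
  have "valid_state [] []" by (simp add: valid_state_def matching_def clean_def)
  then show ?case using potential_nonneg[of "[]" "[]"] by (simp add: progress_def)
next
  case (Suc k)
  obtain M Xs where k: "(step ^^ k) ([], []) = (M, Xs)" by fastforce
  then have v: "valid_state M Xs" and pr: "unmatched M = [] \<or> k / real (length as) ^ p \<le> progress M Xs"
    using Suc.IH by auto
  have "unmatched (step_matching M Xs) = [] \<or>
      Suc k / real (length as) ^ p \<le> progress (step_matching M Xs) (step_layers M Xs)"
  proof (cases "unmatched M = []")
    case True
    then show ?thesis by (simp add: step_matching_def)
  next
    case False
    then show ?thesis using pr valid_state_step(2)[OF v] by (simp add: add_divide_distrib)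
  qed
  then show ?case using valid_state_step(1)[OF v] k by (simp add: step_def)
qed

text \<open>While a vertex is unmatched, every step adds \<open>1 / length as ^ p\<close> to
  \<open>progress\<close>, which is bounded by \<open>3 * length as + 2\<close>.\<close>

lemma iterate_matches_all:
  assumes "(3 * length as + 2) * length as ^ p < k" and "(step ^^ k) ([], []) = (M, Xs)"
  shows "matching M \<and> av ` set M = set as"
proof -
  have v: "valid_state M Xs" and pr: "unmatched M = [] \<or> k / real (length as) ^ p \<le> progress M Xs"
    using valid_state_iterate[of k] assms(2) by auto
  have M: "matching M" using v by (simp add: valid_state_def)
  have "unmatched M = []"
  proof (rule ccontr)
    assume u: "unmatched M \<noteq> []"
    then have "length as \<noteq> 0" by (auto simp: unmatched_def)
    moreover have "k / real (length as) ^ p \<le> 3 * length as + 2"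
      using pr u progress_le[OF v] by linarith
    ultimately have "real k \<le> (3 * length as + 2) * real (length as) ^ p"
      by (simp add: divide_le_eq)
    also have "\<dots> = real ((3 * length as + 2) * length as ^ p)" by (simp add: distrib_right)
    finally show False using assms(1) by linarith
  qed
  then show ?thesis using set_unmatched[OF M] M av_mem matching_mem by auto
qed

text \<open>Empty layers would take up space without containing edges; excluding them bounds the
  size of a state by that of the edge list.\<close>

lemma layer_nonempty:
  assumes "layered M Xs" "X \<in> set Xs"
  shows "X \<noteq> []"
proof -
  obtain hs rest where "Xs = hs @ X # rest" using assms(2) by (auto dest: split_list)
  then have "\<beta> / 2 * tree_card M rest \<le> length X" using layeredD(2) assms(1) by blast
  moreover have "0 < \<beta> / 2 * tree_card M rest" using beta_pos tree_card_pos[of M rest] by simp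
  ultimately show ?thesis by auto
qed

end

section \<open>The search on encoded hypergraphs\<close>

lemma polytime_list_const: "polytime_list (\<lambda>x. c)"
  unfolding polytime_list_def by (rule polytime_const)

lemma polytime_lists_hd:
  assumes "polytime_lists l"
  shows "polytime_list (\<lambda>x. hd (l x))"
proof -
  have "hd (l x) = (if l x = [] then hd [] else spine (hd (map from_spine (l x))))" for x
    by (cases "l x") auto
  moreover have "polytime_list (\<lambda>x. if l x = [] then hd [] else spine (hd (map from_spine (l x))))"
    using assms by (intro polytime_list_If polytime_pred_Nil_lists polytime_list_const polytime_spine
        polytime_hd polytime_map_from_spine)
  ultimately show ?thesis by simp
qed

lemmas polytime_intros =
  polytime_const polytime_id polytime_Node polytime_left_part polytime_right_part polytime_If
  polytime_from_spine polytime_hd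
  polytime_list_Nil polytime_list_Cons polytime_list_tl polytime_list_If polytime_list_rev
  polytime_list_append polytime_list_filter polytime_list_map polytime_list_concat polytime_list_drop
  polytime_spine polytime_lists_hd polytime_map_from_spine
  polytime_lists_Cons polytime_lists_tl polytime_lists_If polytime_lists_rev
  polytime_lists_drop polytime_lists_spine
  polytime_pred_const polytime_pred_not polytime_pred_conj polytime_pred_disj polytime_pred_imp
  polytime_pred_Nil polytime_pred_Nil_lists polytime_pred_Bex polytime_pred_Ball
  polytime_pred_length_le polytime_pred_length_less polytime_pred_digits_eq

section \<open>The search step as a polynomial-time function\<close>

definition inc_tree :: "tree \<Rightarrow> tree \<Rightarrow> bool" where
  "inc_tree a e \<longleftrightarrow> (\<exists>v\<in>set (spine e). digits v = digits a)"

text \<open>Membership in \<open>B\<close> is tested because an encoded edge also lists its vertex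
  in \<open>A\<close>, and sharing that one is not a conflict.\<close>

definition con_tree :: "tree list \<Rightarrow> tree \<Rightarrow> tree \<Rightarrow> bool" where
  "con_tree B e f \<longleftrightarrow> (\<exists>v\<in>set (spine e).
     (\<exists>w\<in>set (spine f). digits v = digits w) \<and> (\<exists>w\<in>set B. digits v = digits w))"

text \<open>The parameters also occur below binders, where the input has become the left part of a
  pair. The composition rules handle these occurrences, here and in the lemmas for the other parts
  of the step.\<close>

lemma polytime_inc_tree:
  assumes "polytime a" "polytime e"
  shows "polytime_pred (\<lambda>x. inc_tree (a x) (e x))"
  unfolding inc_tree_def
  by (rule polytime_intros polytime_comp[OF assms(1)] polytime_comp[OF assms(2)])+

lemma polytime_con_tree:
  assumes "polytime_list B" "polytime e" "polytime f"
  shows "polytime_pred (\<lambda>x. con_tree (B x) (e x) (f x))"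
  unfolding con_tree_def
  by (rule polytime_intros polytime_list_comp[OF assms(1)] polytime_comp[OF assms(2)] polytime_comp[OF assms(3)])+

lemma polytime_unmatched:
  assumes A: "polytime_list A" and M: "polytime_list M"
  shows "polytime_list (\<lambda>x. matching_search.unmatched inc_tree (A x) (M x))"
  unfolding matching_search.unmatched_def
  by (rule polytime_intros polytime_inc_tree polytime_list_comp[OF A] polytime_list_comp[OF M])+

lemma polytime_reached:
  assumes B: "polytime_list B" and M: "polytime_list M" and X: "polytime_list X" and a: "polytime a"
  shows "polytime_pred (\<lambda>x. matching_search.reached inc_tree (con_tree (B x)) (M x) (X x) (a x))"
  unfolding matching_search.reached_def
  by (rule polytime_intros polytime_inc_tree polytime_con_tree polytime_list_comp[OF B] polytime_list_comp[OF M]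
      polytime_list_comp[OF X] polytime_comp[OF a])+

lemma polytime_frontier:
  assumes A: "polytime_list A" and B: "polytime_list B" and M: "polytime_list M" and X: "polytime_lists X"
  shows "polytime_list (\<lambda>x. matching_search.frontier inc_tree (con_tree (B x)) (A x) (M x) (X x))"
  unfolding matching_search.frontier_def
  by (rule polytime_intros polytime_unmatched polytime_reached assms
      polytime_list_comp[OF A] polytime_list_comp[OF B] polytime_list_comp[OF M] polytime_lists_comp[OF X])+

lemma polytime_above:
  assumes "polytime_lists X" "polytime_lists Y"
  shows "polytime_list (\<lambda>x. matching_search.above (X x) (Y x))"
  unfolding matching_search.above_def by (rule polytime_intros assms)+

lemma polytime_ready_edges:
  assumes B: "polytime_list B" and M: "polytime_list M" and X: "polytime_list X" and a: "polytime a"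
  shows "polytime_list (\<lambda>x. matching_search.ready_edges inc_tree (con_tree (B x)) (M x) (X x) (a x))"
  unfolding matching_search.ready_edges_def
  by (rule polytime_intros polytime_inc_tree polytime_con_tree assms
      polytime_list_comp[OF B] polytime_list_comp[OF M] polytime_list_comp[OF X] polytime_comp[OF a])+

lemma polytime_ready:
  assumes A: "polytime_list A" and B: "polytime_list B" and M: "polytime_list M"
    and X: "polytime_lists X" and Y: "polytime_lists Y"
  shows "polytime_list (\<lambda>x. matching_search.ready inc_tree (con_tree (B x)) (A x) (M x) (X x) (Y x))"
  unfolding matching_search.ready_def
  by (rule polytime_intros polytime_frontier polytime_ready_edges polytime_above
      polytime_list_comp[OF A] polytime_list_comp[OF B] polytime_list_comp[OF M]
      polytime_lists_comp[OF X] polytime_lists_comp[OF Y])+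

lemma polytime_collapsible:
  assumes A: "polytime_list A" and B: "polytime_list B" and M: "polytime_list M"
    and X: "polytime_lists X" and Y: "polytime_lists Y"
  shows "polytime_pred (\<lambda>x. matching_search.collapsible inc_tree (con_tree (B x)) m (A x) (M x) (X x) (Y x))"
  unfolding matching_search.collapsible_def
  by (rule polytime_intros polytime_frontier polytime_ready assms)+

lemma polytime_collapse_point:
  assumes A: "polytime_list A" and B: "polytime_list B" and M: "polytime_list M" and X: "polytime_lists X"
  shows "polytime_lists (\<lambda>x. matching_search.collapse_point inc_tree (con_tree (B x)) m (A x) (M x) (X x))"
proof -
  \<comment> \<open>The fold rule iterates over a list of trees; as a mere counter, the list of
    lists may be replaced by its encodings.\<close>
  have eq: "fold (\<lambda>_. h) Xs Xs = fold (\<lambda>_. h) (map from_spine Xs) Xs" for h and Xs :: "tree list list"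
    by (simp add: fold_map comp_def)
  have size: "tree_size (from_spine (map from_spine (tl b))) \<le> tree_size (from_spine (map from_spine b))" for b
    by (cases b) auto
  show ?thesis
    unfolding matching_search.collapse_point_def eq
    by (rule polytime_lists_fold[where c = 0] polytime_intros polytime_collapsible
      polytime_list_comp[OF A] polytime_list_comp[OF B] polytime_list_comp[OF M]
      polytime_lists_comp[OF X])+ (use size in auto)
qed

lemma polytime_swap:
  assumes A: "polytime_list A" and B: "polytime_list B" and M: "polytime_list M"
    and X: "polytime_lists X" and Y: "polytime_lists Y"
  shows "polytime_list (\<lambda>x. matching_search.swap inc_tree (con_tree (B x)) (A x) (M x) (X x) (Y x))"
  unfolding matching_search.swap_def
  by (rule polytime_intros polytime_ready polytime_ready_edges polytime_above polytime_inc_tree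
      polytime_list_comp[OF A] polytime_list_comp[OF B] polytime_list_comp[OF M]
      polytime_lists_comp[OF X] polytime_lists_comp[OF Y])+

lemma polytime_addable:
  assumes A: "polytime_list A" and B: "polytime_list B" and M: "polytime_list M"
    and X: "polytime_list X" and L: "polytime_list L" and e: "polytime e"
  shows "polytime_pred (\<lambda>x. matching_search.addable inc_tree (con_tree (B x)) U (A x) (M x) (X x) (L x) (e x))"
  unfolding matching_search.addable_def
  by (rule polytime_intros polytime_inc_tree polytime_con_tree polytime_reached polytime_unmatched
      polytime_list_comp[OF A] polytime_list_comp[OF B] polytime_list_comp[OF M]
      polytime_list_comp[OF X] polytime_list_comp[OF L] polytime_comp[OF e])+

lemma polytime_new_layer:
  assumes A: "polytime_list A" and B: "polytime_list B" and E: "polytime_list E"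
    and M: "polytime_list M" and X: "polytime_list X"
  shows "polytime_list (\<lambda>x. matching_search.new_layer inc_tree (con_tree (B x)) U (A x) (E x) (M x) (X x))"
  unfolding matching_search.new_layer_def
  by (rule polytime_list_fold[where c = "[:1, 1:]"] polytime_intros polytime_addable
      polytime_list_comp[OF A] polytime_list_comp[OF B] polytime_list_comp[OF M] polytime_list_comp[OF E]
      polytime_list_comp[OF X])+ auto

lemma polytime_step_matching:
  assumes A: "polytime_list A" and B: "polytime_list B" and M: "polytime_list M" and X: "polytime_lists X"
  shows "polytime_list (\<lambda>x. matching_search.step_matching inc_tree (con_tree (B x)) m (A x) (M x) (X x))"
  unfolding matching_search.step_matching_def
  by (rule polytime_intros polytime_unmatched polytime_collapsible polytime_collapse_point polytime_swap assms)+

lemma polytime_step_layers: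
  assumes A: "polytime_list A" and B: "polytime_list B" and E: "polytime_list E"
    and M: "polytime_list M" and X: "polytime_lists X"
  shows "polytime_lists (\<lambda>x. matching_search.step_layers inc_tree (con_tree (B x)) U m (A x) (E x) (M x) (X x))"
  unfolding matching_search.step_layers_def
  by (rule polytime_intros polytime_unmatched polytime_collapsible polytime_collapse_point polytime_new_layer assms)+

section \<open>Iterating the step on encoded states\<close>

definition vertices_A :: "tree \<Rightarrow> tree list" where
  "vertices_A x = spine (left_part x)"

definition vertices_B :: "tree \<Rightarrow> tree list" where
  "vertices_B x = spine (left_part (right_part x))"

definition edges :: "tree \<Rightarrow> tree list" where
  "edges x = spine (right_part (right_part x))"

lemma polytime_input: "polytime_list vertices_A" "polytime_list vertices_B" "polytime_list edges"
  unfolding vertices_A_def vertices_B_def edges_def by (rule polytime_intros)+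

definition encode_state :: "tree list \<times> tree list list \<Rightarrow> tree" where
  "encode_state s = Node (from_spine (fst s)) (from_spine (map from_spine (snd s)))"

definition decode_state :: "tree \<Rightarrow> tree list \<times> tree list list" where
  "decode_state t = (spine (left_part t), map spine (spine (right_part t)))"

definition step_tree :: "nat \<Rightarrow> nat \<Rightarrow> tree \<Rightarrow> tree \<Rightarrow> tree" where
  "step_tree U m x t = encode_state
     (matching_search.step inc_tree (con_tree (vertices_B x)) U m (vertices_A x) (edges x) (decode_state t))"

lemma decode_encode_state [simp]: "decode_state (encode_state s) = s"
  by (simp add: decode_state_def encode_state_def comp_def)

lemma polytime_step_tree:
  assumes "polytime f" "polytime g"
  shows "polytime (\<lambda>z. step_tree U m (f z) (g z))"
  unfolding step_tree_def matching_search.step_def decode_state_def encode_state_def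
    prod.case fst_conv snd_conv
  by (rule polytime_intros polytime_step_matching polytime_step_layers assms
      polytime_input[THEN polytime_list_comp])+

text \<open>A unary counter, since loops run along lists. The three additional entries let its
  length exceed the bound on the number of steps even when \<open>A\<close> is empty.\<close>

primrec clock :: "nat \<Rightarrow> tree \<Rightarrow> tree list" where
  "clock 0 x = [Leaf]"
| "clock (Suc q) x = concat (map (\<lambda>_. Leaf # Leaf # Leaf # vertices_A x) (clock q x))"

lemma length_clock: "length (clock q x) = (length (vertices_A x) + 3) ^ q"
  by (induction q) (simp_all add: length_concat comp_def sum_list_triv algebra_simps)

lemma polytime_clock: "polytime_list (clock q)"
proof (induction q)
  case 0
  then show ?case by (simp add: polytime_list_const)
next
  case (Suc q)
  have "polytime_lists (\<lambda>x. map (\<lambda>_. Leaf # Leaf # Leaf # vertices_A x) (clock q x))"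
    unfolding polytime_lists_def map_map comp_def
    by (rule polytime_intros Suc polytime_input[THEN polytime_list_comp])+
  then show ?case by (simp add: polytime_list_concat)
qed

definition run_search :: "nat \<Rightarrow> nat \<Rightarrow> nat \<Rightarrow> tree \<Rightarrow> tree" where
  "run_search U m q x = fold (\<lambda>_. step_tree U m x) (clock q x) (encode_state ([], []))"

lemma fold_step_tree:
  "fold (\<lambda>_. step_tree U m x) ts (encode_state s) = encode_state
     ((matching_search.step inc_tree (con_tree (vertices_B x)) U m (vertices_A x) (edges x) ^^ length ts) s)"
proof (induction ts arbitrary: s)
  case (Cons t ts)
  let ?f = "matching_search.step inc_tree (con_tree (vertices_B x)) U m (vertices_A x) (edges x)"
  have "step_tree U m x (encode_state s) = encode_state (?f s)" by (simp add: step_tree_def)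
  then have "fold (\<lambda>_. step_tree U m x) (t # ts) (encode_state s) = encode_state ((?f ^^ length ts) (?f s))"
    using Cons.IH[of "?f s"] by simp
  then show ?case by (simp only: funpow_swap1[symmetric] list.size funpow.simps comp_apply add_0_right add_Suc_right)
qed simp

text \<open>On arbitrary trees no additive bound on the growth in one step is at hand. The size of
  all reached states is therefore a premise, to be established for the inputs in \<open>D\<close>
  only.\<close>

lemma polytime_run_search:
  assumes "poly_bounded b"
    and "\<And>x k. x \<in> D \<Longrightarrow> tree_size (encode_state
     ((matching_search.step inc_tree (con_tree (vertices_B x)) U m (vertices_A x) (edges x) ^^ k) ([], [])))
     \<le> b (tree_size x)"
  shows "polytime_on D (run_search U m q)"
proof -
  have D: "polytime f \<Longrightarrow> polytime_on D f" for f
    unfolding polytime_on_def computes_at_def by (meson UNIV_I)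
  show ?thesis unfolding run_search_def
  proof (rule polytime_on_fold[OF _ _ _ assms(1)])
    show "polytime_on D (\<lambda>x. from_spine (clock q x))"
      by (rule D polytime_from_spine polytime_clock)+
    show "polytime_on D (\<lambda>x. encode_state ([], []))" by (rule D polytime_const)+
    show "polytime (\<lambda>z. step_tree U m (left_part z) (right_part (right_part z)))"
      by (rule polytime_step_tree polytime_intros)+
    show "tree_size (fold (\<lambda>_. step_tree U m x) (take n (clock q x)) (encode_state ([], []))) \<le> b (tree_size x)"
      if "x \<in> D" for x n
      unfolding fold_step_tree by (rule assms(2)[OF that])
  qed
qed

section \<open>Encoded hypergraphs as instances of the search\<close>

lemma spine_encode_list [simp]: "spine (encode_list f xs) = map f xs"
  by (induction xs) auto

lemma from_spine_map [simp]: "from_spine (map f xs) = encode_list f xs"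
  by (induction xs) auto

lemma tree_size_subset:
  assumes "distinct M" "set M \<subseteq> set E"
  shows "tree_size (from_spine M) \<le> tree_size (from_spine E)"
proof -
  have "(\<Sum>t\<leftarrow>M. 1 + tree_size t) = (\<Sum>t\<in>set M. 1 + tree_size t)"
    using assms(1) by (rule sum_list_distinct_conv_sum_set)
  also have "\<dots> \<le> (\<Sum>t\<in>set E. 1 + tree_size t)" by (rule sum_mono2) (use assms in auto)
  also have "\<dots> = (\<Sum>t\<leftarrow>remdups E. 1 + tree_size t)"
    using sum_list_distinct_conv_sum_set[of "remdups E" "\<lambda>t. 1 + tree_size t"] by simp
  also have "\<dots> \<le> (\<Sum>t\<leftarrow>E. 1 + tree_size t)" by (induction E) auto
  finally show ?thesis unfolding tree_size_from_spine by simp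
qed

text \<open>Each layer costs two extra units of list structure, which a nonempty layer absorbs into
  the factor 3.\<close>

lemma tree_size_layers:
  assumes "[] \<notin> set Xs"
  shows "tree_size (from_spine (map from_spine Xs)) \<le> 3 * tree_size (from_spine (concat Xs))"
proof -
  have "(\<Sum>X\<leftarrow>Xs. 1 + tree_size (from_spine X)) \<le> (\<Sum>X\<leftarrow>Xs. 3 * (\<Sum>t\<leftarrow>X. 1 + tree_size t))"
  proof (rule sum_list_mono)
    fix X assume "X \<in> set Xs"
    then have "X \<noteq> []" using assms by metis
    then obtain a X' where "X = a # X'" by (cases X) auto
    then show "1 + tree_size (from_spine X) \<le> 3 * (\<Sum>t\<leftarrow>X. 1 + tree_size t)"
      unfolding tree_size_from_spine by simp
  qed
  also have "\<dots> = 3 * (\<Sum>t\<leftarrow>concat Xs. 1 + tree_size t)"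
    by (induction Xs) (simp_all add: sum_list_addf)
  finally show ?thesis
    unfolding tree_size_from_spine[of "map from_spine Xs"] tree_size_from_spine[of "concat Xs"] map_map
    by (simp add: comp_def)
qed

definition vertex_set :: "tree \<Rightarrow> nat set" where
  "vertex_set e = {n. encode_nat n \<in> set (spine e)}"

lemma vertex_set_encode [simp]: "vertex_set (encode_list encode_nat vs) = set vs"
  by (auto simp: vertex_set_def encode_nat_inject)

lemma hitting_number_le:
  assumes "finite T" "hits (T \<inter> B) F"
  shows "hitting_number B F \<le> card T"
proof -
  have "hitting_number B F \<le> card (T \<inter> B)"
    unfolding hitting_number_def by (rule Least_le) (use assms(2) in blast)
  also have "\<dots> \<le> card T" by (rule card_mono) (use assms(1) in auto)
  finally show ?thesis .
qed

text \<open>The abstract search assumes a surplus of at most 1 and is run with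
  \<open>\<epsilon>'\<close>; the hypothesis for \<open>\<epsilon>\<close> implies the one for
  \<open>\<epsilon>'\<close>.\<close>

locale encoded_instance =
  fixes \<epsilon> \<epsilon>' \<beta> \<gamma> :: real and r U m p :: nat and A B :: "nat set" and E :: "nat set set"
    and as bs :: "nat list" and es :: "nat list list"
  assumes r: "2 \<le> r" and eps: "0 < \<epsilon>" and eps': "\<epsilon>' = min \<epsilon> 1"
    and bip: "uniform_bipartite_hypergraph r A B E"
    and haxell: "\<And>S. S \<subseteq> A \<Longrightarrow>
      (2 * real r - 3 + \<epsilon>) * (real (card S) - 1) < real (hitting_number B (incident_edges E S))"
    and as: "distinct as" "set as = A" and bs: "set bs = B"
    and es: "\<And>l. l \<in> set es \<Longrightarrow> distinct l" "distinct (map set es)" "set (map set es) = E"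
    and U: "2 * (2 * real r - 3 + \<epsilon>') \<le> \<epsilon>' * real U"
    and beta: "\<beta> = \<epsilon>' / (8 * (real r)\<^sup>2)" and gamma: "\<gamma> = \<beta> / 4"
    and m: "2 \<le> m" "4 * real U \<le> \<beta> * real m"
    and p: "3 \<le> (1 + \<gamma> / (2 * real m)) ^ p"
begin

abbreviation "enc \<equiv> encode_list encode_nat"

definition owner :: "tree \<Rightarrow> tree" where
  "owner e = encode_nat (the_elem (vertex_set e \<inter> A))"

lemma inj_enc: "enc l = enc l' \<longleftrightarrow> l = l'"
  by (rule encode_list_inject) (simp add: inj_def encode_nat_inject)

lemma edge:
  assumes "l \<in> set es"
  shows "set l \<subseteq> A \<union> B" "\<exists>a. set l \<inter> A = {a}" "card (set l \<inter> B) = r - 1"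
proof -
  have "set l \<in> E" using es(3) assms by auto
  then show "set l \<subseteq> A \<union> B" "\<exists>a. set l \<inter> A = {a}" "card (set l \<inter> B) = r - 1"
    using bip unfolding uniform_bipartite_hypergraph_def by (auto simp: card_1_singleton_iff)
qed

lemma owner_enc: "l \<in> set es \<Longrightarrow> owner (enc l) = encode_nat a \<longleftrightarrow> set l \<inter> A = {a}"
proof -
  assume "l \<in> set es"
  then obtain b where b: "set l \<inter> A = {b}" using edge(2) by blast
  show ?thesis unfolding owner_def vertex_set_encode b by (auto simp: encode_nat_inject)
qed

lemma digits_mem:
  "(\<exists>w\<in>set (map encode_nat l). digits (encode_nat n) = digits w) \<longleftrightarrow> n \<in> set l"
  by (simp add: digits_encode_nat)

sublocale hypergraph_search inc_tree "con_tree (map encode_nat bs)" U m "map encode_nat as"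
  "map enc es" owner "\<lambda>e. vertex_set e \<inter> B" r p \<epsilon>' \<beta> \<gamma>
proof
  have inj: "inj_on encode_nat X" for X by (simp add: inj_on_def encode_nat_inject)
  show "distinct (map encode_nat as)" using as inj by (simp add: distinct_map)
  show "distinct (map enc es)"
    using es(2) inj_enc by (auto simp: distinct_map inj_on_def)
  show "owner e \<in> set (map encode_nat as)" if e: "e \<in> set (map enc es)" for e
  proof -
    obtain l where l: "l \<in> set es" "e = enc l" using e by auto
    obtain a where "set l \<inter> A = {a}" using edge(2)[OF l(1)] by blast
    then show ?thesis using owner_enc[OF l(1), of a] l as(2) by auto
  qed
  show "finite (vertex_set e \<inter> B)" for e
    using bip unfolding uniform_bipartite_hypergraph_def by simp
  show "card (vertex_set e \<inter> B) = r - 1" if "e \<in> set (map enc es)" for e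
    using that edge(3) by auto
  show "inc_tree a e \<longleftrightarrow> owner e = a" if ae: "a \<in> set (map encode_nat as)" "e \<in> set (map enc es)" for a e
  proof -
    obtain n l where n: "a = encode_nat n" "n \<in> A" and l: "l \<in> set es" "e = enc l"
      using ae as(2) by auto
    have "inc_tree a e \<longleftrightarrow> n \<in> set l" unfolding inc_tree_def n l by (auto simp: digits_encode_nat)
    also obtain b where b: "set l \<inter> A = {b}" using edge(2)[OF l(1)] by blast
    have "n \<in> set l \<longleftrightarrow> n \<in> set l \<inter> A" using n(2) by simp
    then have "n \<in> set l \<longleftrightarrow> set l \<inter> A = {n}" unfolding b by auto
    finally show ?thesis using owner_enc[OF l(1)] n l by simp
  qed
  show "con_tree (map encode_nat bs) e f \<longleftrightarrow> (vertex_set e \<inter> B) \<inter> (vertex_set f \<inter> B) \<noteq> {}"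
    if ef: "e \<in> set (map enc es)" "f \<in> set (map enc es)" for e f
  proof -
    obtain l l' where l: "e = enc l" "f = enc l'" using ef by auto
    have "con_tree (map encode_nat bs) e f \<longleftrightarrow> (\<exists>n\<in>set l. n \<in> set l' \<and> n \<in> set bs)"
      unfolding con_tree_def l spine_encode_list digits_mem[symmetric] by (simp only: set_map bex_simps)
    then show ?thesis by (auto simp: l bs)
  qed
  show "2 \<le> r" by (rule r)
  show "0 < \<epsilon>'" "\<epsilon>' \<le> 1" using eps eps' by auto
  show "(2 * real r - 3 + \<epsilon>') * (real (card S) - 1) < real (card T)"
    if S: "S \<subseteq> set (map encode_nat as)" and T: "finite T"
      "\<And>e. e \<in> set (map enc es) \<Longrightarrow> owner e \<in> S \<Longrightarrow> T \<inter> (vertex_set e \<inter> B) \<noteq> {}" for S T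
  \<comment> \<open>For empty \<open>S\<close> the factor \<open>card S - 1\<close> is negative, so
    replacing \<open>\<epsilon>\<close> by \<open>\<epsilon>'\<close> would not lower the left
    side.\<close>
  proof (cases "S = {}")
    case True
    have "0 < 2 * real r - 3 + \<epsilon>'" using r eps eps' by simp
    then show ?thesis using True by simp
  next
    case False
    define S' where "S' = {a \<in> A. encode_nat a \<in> S}"
    have S': "S = encode_nat ` S'" using S as(2) unfolding S'_def by auto
    then have card: "card S = card S'" using card_image[OF inj] by simp
    have "hits (T \<inter> B) (incident_edges E S')"
      unfolding hits_def
    proof
      fix e assume "e \<in> incident_edges E S'"
      then have e: "e \<in> E" "card (e \<inter> S') = 1" by (auto simp: incident_edges_def)
      obtain l where l: "l \<in> set es" "e = set l" using e(1) es(3) by auto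
      obtain a where a: "e \<inter> S' = {a}" using e(2) by (auto simp: card_1_singleton_iff)
      obtain b where b: "set l \<inter> A = {b}" using edge(2)[OF l(1)] by blast
      have "a \<in> set l \<inter> A" using a l(2) unfolding S'_def by auto
      then have "set l \<inter> A = {a}" using b by simp
      then have "owner (enc l) = encode_nat a" using owner_enc[OF l(1)] by blast
      moreover have "a \<in> S'" using a by blast
      ultimately have "owner (enc l) \<in> S" by (simp add: S'_def)
      then show "T \<inter> B \<inter> e \<noteq> {}" using T(2)[of "enc l"] l by auto
    qed
    then have le: "hitting_number B (incident_edges E S') \<le> card T"
      by (rule hitting_number_le[OF T(1)])
    have "finite S" using S finite_subset by blast
    then have "1 \<le> real (card S)" using False by (simp add: Suc_le_eq card_gt_0_iff)
    then have "(2 * real r - 3 + \<epsilon>') * (real (card S) - 1) \<le> (2 * real r - 3 + \<epsilon>) * (real (card S) - 1)"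
      using eps' by (intro mult_right_mono) auto
    also have "\<dots> < real (hitting_number B (incident_edges E S'))"
      unfolding card by (rule haxell) (simp add: S'_def)
    also have "\<dots> \<le> real (card T)" using le by simp
    finally show ?thesis .
  qed
qed (fact U beta gamma m p)+

text \<open>The matching and the concatenated layers are repetition-free selections of input edges;
  they contribute once and three times the input size.\<close>

lemma encode_state_size:
  assumes x: "x = Node a (Node b (enc' es))" and enc': "enc' = encode_list enc"
  shows "tree_size (encode_state ((step ^^ k) ([], []))) \<le> 4 * tree_size x + 1"
proof -
  obtain M Xs where k: "(step ^^ k) ([], []) = (M, Xs)" by fastforce
  then have v: "valid_state M Xs" using valid_state_iterate[of k] by simp
  then have M: "matching M" and X: "clean M (concat Xs)" and l: "layered M Xs"
    by (simp_all add: valid_state_def)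
  let ?E = "tree_size (from_spine (map enc es))"
  have "tree_size (from_spine M) \<le> ?E"
    by (rule tree_size_subset) (use M in \<open>auto simp: matching_def\<close>)
  moreover have "tree_size (from_spine (concat Xs)) \<le> ?E"
    by (rule tree_size_subset) (use X in \<open>auto simp: clean_def\<close>)
  moreover have "[] \<notin> set Xs" using layer_nonempty[OF l] by blast
  then have "tree_size (from_spine (map from_spine Xs)) \<le> 3 * tree_size (from_spine (concat Xs))"
    by (rule tree_size_layers)
  moreover have "?E \<le> tree_size x" by (simp add: x enc')
  ultimately show ?thesis unfolding k encode_state_def by simp
qed

text \<open>Different edges of \<open>M\<close> have different vertices in \<open>A\<close> by
  injectivity of \<open>owner\<close> and are disjoint in \<open>B\<close>, so the decoded edges are
  disjoint altogether.\<close>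

lemma perfect_matching_of_search:
  assumes "matching M" "owner ` set M = set (map encode_nat as)"
  shows "\<exists>Ms. encodes_edges (from_spine M) Ms \<and> perfect_matching A E Ms"
proof -
  have "\<exists>ml. M = map enc ml \<and> set ml \<subseteq> set es"
  proof -
    have "M = map enc (map (inv_into (set es) enc) M)"
      using assms(1) by (auto simp: matching_def f_inv_into_f map_idI comp_def subset_iff)
    moreover have "set (map (inv_into (set es) enc) M) \<subseteq> set es"
      using assms(1) by (auto simp: matching_def inv_into_into subset_iff)
    ultimately show ?thesis by blast
  qed
  then obtain ml where ml: "M = map enc ml" "set ml \<subseteq> set es" by blast
  let ?Ms = "set ` set ml"
  have dist: "distinct (map set ml)"
    using ml assms(1) es(2) inj_on_subset[of set "set es" "set ml"]
    by (auto simp: matching_def distinct_map)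
  have "encodes_edges (from_spine M) ?Ms"
    unfolding encodes_edges_def
    by (rule exI[of _ ml]) (use ml dist es(1) in auto)
  moreover have "perfect_matching A E ?Ms"
    unfolding perfect_matching_def
  proof (intro conjI ballI)
    show "?Ms \<subseteq> E" using ml(2) es(3) by auto
    have disj: "disjnt (set l) (set l')" if l: "l \<in> set ml" "l' \<in> set ml" "set l \<noteq> set l'" for l l'
    proof -
      have ne: "enc l \<noteq> enc l'" using l(3) inj_enc by auto
      have le: "l \<in> set es" "l' \<in> set es" using l ml(2) by auto
      obtain a a' where a: "set l \<inter> A = {a}" "set l' \<inter> A = {a'}" using edge(2) le by metis
      have "owner (enc l) \<noteq> owner (enc l')"
        using assms(1) ne l(1,2) ml(1) unfolding matching_def inj_on_def by auto
      then have "a \<noteq> a'" using owner_enc[OF le(1)] owner_enc[OF le(2)] a by metis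
      moreover have "(set l \<inter> B) \<inter> (set l' \<inter> B) = {}"
        using assms(1) ne l(1,2) ml(1) unfolding matching_def by auto
      moreover have "set l \<inter> set l' \<subseteq> (set l \<inter> A) \<inter> (set l' \<inter> A) \<union> (set l \<inter> B) \<inter> (set l' \<inter> B)"
        using edge(1)[OF le(1)] by blast
      ultimately show ?thesis unfolding disjnt_def a by simp
    qed
    show pw: "pairwise disjnt ?Ms"
    proof (rule pairwiseI)
      fix e e' assume "e \<in> ?Ms" "e' \<in> ?Ms" "e \<noteq> e'"
      then show "disjnt e e'" using disj by (elim imageE) simp
    qed
    fix a assume "a \<in> A"
    then have "encode_nat a \<in> owner ` set M" using assms(2) as(2) by auto
    then obtain l where l: "l \<in> set ml" "owner (enc l) = encode_nat a" using ml(1) by auto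
    then have "a \<in> set l" using owner_enc[of l a] ml(2) by auto
    then show "\<exists>!e. e \<in> ?Ms \<and> a \<in> e"
      using l(1) pw unfolding pairwise_def disjnt_def by (intro ex1I[of _ "set l"]) blast+
  qed
  ultimately show ?thesis by blast
qed

end

lemma run_search_correct:
  assumes inst: "encoded_instance \<epsilon> \<epsilon>' \<beta> \<gamma> r U m p A B E as bs es"
    and x: "x = Node (encode_list encode_nat as) (Node (encode_list encode_nat bs) (encode_list (encode_list encode_nat) es))"
  shows "\<exists>M. encodes_edges (left_part (run_search U m (p + 2) x)) M \<and> perfect_matching A E M"
    and "tree_size (encode_state
     ((matching_search.step inc_tree (con_tree (vertices_B x)) U m (vertices_A x) (edges x) ^^ k) ([], [])))
     \<le> 4 * tree_size x + 1"
proof -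
  interpret encoded_instance \<epsilon> \<epsilon>' \<beta> \<gamma> r U m p A B E as bs es by (rule inst)
  have eq: "vertices_A x = map encode_nat as" "vertices_B x = map encode_nat bs" "edges x = map enc es"
    by (simp_all add: x vertices_A_def vertices_B_def edges_def)
  show "tree_size (encode_state
     ((matching_search.step inc_tree (con_tree (vertices_B x)) U m (vertices_A x) (edges x) ^^ k) ([], [])))
     \<le> 4 * tree_size x + 1"
    unfolding eq by (rule encode_state_size[OF x refl])
  let ?n = "length (map encode_nat as)" and ?k = "length (clock (p + 2) x)"
  obtain M Xs where k: "(step ^^ ?k) ([], []) = (M, Xs)" by fastforce
  \<comment> \<open>Two of the \<open>p + 2\<close> factors of the clock dominate the linear term
    \<open>3 * n + 2\<close>, the others the power.\<close>
  have "(3 * ?n + 2) * ?n ^ p < (?n + 3) ^ 2 * (?n + 3) ^ p"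
  proof -
    have "3 * ?n + 2 < (?n + 3) ^ 2" by (simp add: power2_eq_square algebra_simps)
    then have "(3 * ?n + 2) * (?n + 3) ^ p < (?n + 3) ^ 2 * (?n + 3) ^ p"
      by (rule mult_strict_right_mono) simp
    moreover have "(3 * ?n + 2) * ?n ^ p \<le> (3 * ?n + 2) * (?n + 3) ^ p"
      by (intro mult_left_mono power_mono) auto
    ultimately show ?thesis by linarith
  qed
  moreover have "?k = (?n + 3) ^ 2 * (?n + 3) ^ p"
    unfolding length_clock eq power_add by (rule mult.commute)
  ultimately have "(3 * ?n + 2) * ?n ^ p < ?k" by (simp only:)
  then have M: "matching M" "owner ` set M = set (map encode_nat as)"
    using iterate_matches_all[OF _ k] by auto
  have "run_search U m (p + 2) x = encode_state (M, Xs)"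
    unfolding run_search_def fold_step_tree eq k ..
  then have "left_part (run_search U m (p + 2) x) = from_spine M" by (simp add: encode_state_def)
  then show "\<exists>M. encodes_edges (left_part (run_search U m (p + 2) x)) M \<and> perfect_matching A E M"
    using perfect_matching_of_search[OF M] by simp
qed

theorem theorem1p3:
  fixes \<epsilon> :: real and r :: nat
  assumes "\<epsilon> > 0" and "r \<ge> 2"
  shows "\<exists>(P :: program) (p :: nat poly).
    \<forall>(A :: nat set) (B :: nat set) (E :: nat set set) (x :: tree).
      uniform_bipartite_hypergraph r A B E \<longrightarrow>
      (\<forall>S\<subseteq>A. real (hitting_number B (incident_edges E S))
              > (2 * real r - 3 + \<epsilon>) * (real (card S) - 1)) \<longrightarrow>
      encodes_hypergraph x A B E \<longrightarrow>
      (\<exists>y M. runs_in_time P x (poly p (tree_size x)) y \<and>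
             encodes_edges y M \<and> perfect_matching A E M)"
proof -
  define \<epsilon>' where "\<epsilon>' = min \<epsilon> 1"
  define \<beta> where "\<beta> = \<epsilon>' / (8 * (real r)\<^sup>2)"
  define \<gamma> where "\<gamma> = \<beta> / 4"
  have pos: "0 < \<epsilon>'" "0 < \<beta>" "0 < \<gamma>" using assms by (simp_all add: \<epsilon>'_def \<beta>_def \<gamma>_def)
  \<comment> \<open>All constants depend on \<open>\<epsilon>\<close> and \<open>r\<close> alone, so
    program and polynomial are fixed before any instance is given.\<close>
  obtain U :: nat where "2 * (2 * real r - 3 + \<epsilon>') / \<epsilon>' \<le> real U" using real_arch_simple by blast
  then have U: "2 * (2 * real r - 3 + \<epsilon>') \<le> \<epsilon>' * real U" using pos by (simp add: divide_le_eq mult.commute)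
  obtain m :: nat where "max 2 (4 * real U / \<beta>) \<le> real m" using real_arch_simple by blast
  then have m: "2 \<le> m" "4 * real U \<le> \<beta> * real m" using pos by (auto simp: divide_le_eq mult.commute)
  have "1 < 1 + \<gamma> / (2 * real m)" using pos m by simp
  then obtain q where q: "3 < (1 + \<gamma> / (2 * real m)) ^ q" using real_arch_pow by blast
  \<comment> \<open>The size bound on states rests on the invariant and thereby on the hypothesis,
    so the domain consists of the encodings of admissible instances.\<close>
  let ?D = "{x. \<exists>A B E as bs es. encoded_instance \<epsilon> \<epsilon>' \<beta> \<gamma> r U m q A B E as bs es \<and>
    x = Node (encode_list encode_nat as) (Node (encode_list encode_nat bs) (encode_list (encode_list encode_nat) es))}"
  have "polytime_on ?D (run_search U m (q + 2))"
  proof (rule polytime_run_search)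
    show "poly_bounded (\<lambda>n. 4 * n + 1)" by (intro poly_bounded_intros)
    show "tree_size (encode_state
        ((matching_search.step inc_tree (con_tree (vertices_B x)) U m (vertices_A x) (edges x) ^^ k) ([], [])))
        \<le> 4 * tree_size x + 1" if "x \<in> ?D" for x k
      using that run_search_correct(2) by blast
  qed
  \<comment> \<open>The left part of the final state is the matching; the layers are dropped from
    the output.\<close>
  then have "polytime_on ?D (\<lambda>x. left_part (run_search U m (q + 2) x))"
    by (rule polytime_left_part)
  then obtain P p where P: "computes_at P (poly p) 0 ?D (\<lambda>x. left_part (run_search U m (q + 2) x))"
    by (rule polytime_onE)
  show ?thesis
  proof (intro exI[of _ P] exI[of _ p] allI impI)
    fix A B :: "nat set" and E x
    assume bip: "uniform_bipartite_hypergraph r A B E"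
      and haxell: "\<forall>S\<subseteq>A. real (hitting_number B (incident_edges E S))
              > (2 * real r - 3 + \<epsilon>) * (real (card S) - 1)"
      and "encodes_hypergraph x A B E"
    then obtain as bs es where x: "x = Node (encode_list encode_nat as)
        (Node (encode_list encode_nat bs) (encode_list (encode_list encode_nat) es))"
      and "distinct as" "set as = A" "set bs = B" "\<forall>l\<in>set es. distinct l"
        "distinct (map set es)" "set (map set es) = E"
      unfolding encodes_hypergraph_def encodes_vertices_def encodes_edges_def by blast
    then have inst: "encoded_instance \<epsilon> \<epsilon>' \<beta> \<gamma> r U m q A B E as bs es"
      using assms bip haxell U m q by unfold_locales (auto simp: \<epsilon>'_def \<beta>_def \<gamma>_def)
    then have "x \<in> ?D" using x by blast
    then have "initial_store x 0 \<in> ?D" by (simp only: initial_store_def fun_upd_same)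
    then obtain s' where "runs_within P (initial_store x) (poly p (tree_size x)) s'"
        "s' 0 = left_part (run_search U m (q + 2) x)"
      using computes_atE[where s = "initial_store x", OF P] by (metis fun_upd_same initial_store_def)
    then have "runs_in_time P x (poly p (tree_size x)) (left_part (run_search U m (q + 2) x))"
      unfolding runs_in_time_def runs_within_def by blast
    then show "\<exists>y M. runs_in_time P x (poly p (tree_size x)) y \<and> encodes_edges y M \<and> perfect_matching A E M"
      using run_search_correct(1)[OF inst x] by blast
  qed
qed

end
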